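(* Let $$g=2\,du\,dv+H\,du^2+\sum_{i=1}^{n-2}(dx^i)^2$$ be a Lorentzian pp-wave metric in dimension $n\ge3$, with $H=H(x^1,\dots,x^{n-2},u)$ a function not depending on $v$. Let $\Delta$ be the flat Laplacian in $n-2$ dimensions. Then an ambient metric for $[g]$, i.e. a solution of $Ric(\widetilde g)=O(\rho^m)$, is given by $$\widetilde g=2\,d(\rho t)\,dt+t^2g+t^2\left(\sum_{k=1}^{m}\frac{\Delta^k(H)}{k!\prod_{i=1}^k(2i-n)}\rho^k+\sum_{k=0}^\infty\frac{\Delta^k(f)}{k!\prod_{i=1}^k(2i+n)}\rho^{\frac n2+k}\right)du^2,\tag{$*$}$$ where $m=\infty$ when $n$ is odd and $m=\frac{n-2}2$ when $n$ is even, and $f=f(x^1,\dots,x^{n-2},u)$ is an arbitrary smooth function. Moreover: 1. When $n$ is odd, $f\equiv0$ gives the unique Ricci-flat ambient metric that is analytic in $\rho$. 2. When $n$ is even, the Fefferman-Graham obstruction tensor $\mathcal O$ is given by $\mathcal O=c_n\,\Delta^{\frac n2}(H)\,du^2$ for some nonzero constant $c_n$. If $\mathcal O$ vanishes, the metric $( * )$ is Ricci-flat.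
   Context: An ambient metric for $[g]$ (in normal form with respect to $g$) is a metric $\widetilde g=2\,dt\,d(\rho t)+t^2(g+h(x,\rho))$ on $(0,\infty)\times M\times(-\epsilon,\epsilon)$, with coordinates $(t,x,\rho)$, $h$ a $\rho$-dependent symmetric $(0,2)$-tensor on $M$ with $h|_{\rho=0}=0$, such that $Ric(\widetilde g)=O(\rho^m)$ with $m=\infty$ for $n$ odd and $m=\frac{n-2}2$ for $n$ even. Here $2\,dt\,d(\rho t)=2\rho\,dt^2+2t\,dt\,d\rho$, and $\Delta=\sum_{i=1}^{n-2}\partial_{x^i}^2$. Obstruction tensor ($n$ even): for an ambient metric which in addition satisfies $\mathrm{tr}_g\big(\rho^{1-n/2}Ric(\widetilde g)|_{TM\otimes TM}\big)=0$ at $\rho=0$, $\mathcal O$ is a fixed nonzero constant (depending on $n$) times $\big(\rho^{1-\frac n2}Ric(\widetilde g)|_{TM\otimes TM}\big)|_{\rho=0}$. *)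

theory Defs
  imports
    "HOL-Analysis.Analysis"
    "HOL-Library.Landau_Symbols"
    "HOL-Library.Extended_Nat"
begin

section \<open>Calculus and curvature in coordinates\<close>

definition partial :: "'m::finite \<Rightarrow> (real^'m \<Rightarrow> real) \<Rightarrow> real^'m \<Rightarrow> real" where
  "partial i f p = deriv (\<lambda>s. f (p + s *\<^sub>R axis i 1)) 0"

text \<open>Smoothness, for an open set \<open>S\<close>: every iterated partial derivative is (Frechet)
  differentiable, hence also continuous, on \<open>S\<close>.\<close>

definition smooth_on :: "(real^'m::finite) set \<Rightarrow> (real^'m \<Rightarrow> real) \<Rightarrow> bool" where
  "smooth_on S f \<longleftrightarrow> (\<forall>is. (foldr partial is f) differentiable_on S)"

text \<open>A (pseudo-Riemannian) metric is given by its matrix of components.\<close>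

type_synonym 'm metric = "real^'m \<Rightarrow> real^'m^'m"

definition christoffel :: "'m::finite metric \<Rightarrow> 'm \<Rightarrow> 'm \<Rightarrow> 'm \<Rightarrow> real^'m \<Rightarrow> real" where
  "christoffel G k i j p =
     (\<Sum>l\<in>UNIV. matrix_inv (G p) $ k $ l *
        (partial i (\<lambda>q. G q $ j $ l) p + partial j (\<lambda>q. G q $ i $ l) p
         - partial l (\<lambda>q. G q $ i $ j) p)) / 2"

definition ricci :: "'m::finite metric \<Rightarrow> real^'m \<Rightarrow> real^'m^'m" where
  "ricci G p = (\<chi> i j. \<Sum>k\<in>UNIV.
      partial k (christoffel G k i j) p - partial j (christoffel G k i k) p
      + (\<Sum>l\<in>UNIV. christoffel G k k l p * christoffel G l i j p
                 - christoffel G k j l p * christoffel G l i k p))"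

section \<open>Ambient metrics in normal form\<close>

text \<open>Coordinates \<open>(t, x, \<rho>)\<close>, where \<open>x\<close> are coordinates on the base, indexed by \<open>'m\<close>.\<close>

datatype 'm amb_coord = Ct | Cm 'm | Crho

instance amb_coord :: (finite) finite
proof
  have "(UNIV :: 'a amb_coord set) = {Ct, Crho} \<union> range Cm"
    using amb_coord.exhaust by auto
  then show "finite (UNIV :: 'a amb_coord set)"
    by (metis finite finite.emptyI finite_Un finite_imageI finite_insert)
qed

definition amb_point :: "real \<Rightarrow> real^'m::finite \<Rightarrow> real \<Rightarrow> real^('m amb_coord)" where
  "amb_point t x \<rho> = (\<chi> i. case i of Ct \<Rightarrow> t | Cm a \<Rightarrow> x $ a | Crho \<Rightarrow> \<rho>)"

definition base_point :: "real^('m::finite amb_coord) \<Rightarrow> real^'m" where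
  "base_point P = (\<chi> a. P $ Cm a)"

definition amb_domain :: "(real^'m::finite) set \<Rightarrow> real \<Rightarrow> (real^('m amb_coord)) set" where
  "amb_domain M \<epsilon> = {P. 0 < P $ Ct \<and> base_point P \<in> M \<and> \<bar>P $ Crho\<bar> < \<epsilon>}"

text \<open>The metric \<open>2 dt d(\<rho>t) + t\<^sup>2 (g + h(x,\<rho>)) = 2\<rho> dt\<^sup>2 + 2t dt d\<rho> + t\<^sup>2 (g + h(x,\<rho>))\<close>.
  Products of one-forms are symmetric products, so the mixed component is \<open>t\<close>.\<close>

definition amb :: "'m::finite metric \<Rightarrow> (real^'m \<Rightarrow> real \<Rightarrow> real^'m^'m) \<Rightarrow> 'm amb_coord metric" where
  "amb g h P = (\<chi> i j. case (i, j) of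
       (Ct, Ct) \<Rightarrow> 2 * P $ Crho
     | (Ct, Crho) \<Rightarrow> P $ Ct
     | (Crho, Ct) \<Rightarrow> P $ Ct
     | (Cm a, Cm b) \<Rightarrow> (P $ Ct)\<^sup>2 * (g (base_point P) + h (base_point P) (P $ Crho)) $ a $ b
     | _ \<Rightarrow> 0)"

text \<open>\<open>Ric = O(\<rho>\<^sup>k)\<close> as \<open>\<rho> \<rightarrow> 0\<close>, locally uniformly in \<open>(t, x)\<close>. The hypersurface \<open>\<rho> = 0\<close>
  itself is left out because second derivatives need not exist there when a term of order
  \<open>\<rho>\<^sup>n\<^sup>/\<^sup>2\<close> with odd \<open>n\<close> is present.\<close>

definition ricci_O :: "(real^'m::finite) set \<Rightarrow> 'm amb_coord metric \<Rightarrow> nat \<Rightarrow> bool" where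
  "ricci_O M G k \<longleftrightarrow> (\<forall>t>0. \<forall>x\<in>M. \<forall>i j.
      (\<lambda>P. ricci G P $ i $ j)
        \<in> O[at (amb_point t x 0) within {P. P $ Crho \<noteq> 0}](\<lambda>P. (P $ Crho) ^ k))"

definition ricci_flat_on :: "(real^'m::finite) set \<Rightarrow> 'm metric \<Rightarrow> bool" where
  "ricci_flat_on D G \<longleftrightarrow> (\<forall>P\<in>D. ricci G P = 0)"

definition amb_order :: "nat \<Rightarrow> enat" where
  "amb_order n = (if odd n then \<infinity> else enat ((n - 2) div 2))"

text \<open>Ambient metrics on \<open>(0,\<infinity>) \<times> M \<times> (-\<epsilon>,\<epsilon>)\<close>. Only continuity is required across \<open>\<rho> = 0\<close>,
  again in order to allow for \<open>\<rho>\<^sup>n\<^sup>/\<^sup>2\<close>; \<open>smooth_ambient_metric\<close> is the smooth version.\<close>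

definition ambient_metric ::
    "(real^'m::finite) set \<Rightarrow> real \<Rightarrow> 'm metric \<Rightarrow> (real^'m \<Rightarrow> real \<Rightarrow> real^'m^'m) \<Rightarrow> bool" where
  "ambient_metric M \<epsilon> g h \<longleftrightarrow>
     0 < \<epsilon> \<and>
     (\<forall>x\<in>M. h x 0 = 0) \<and>
     (\<forall>x\<in>M. \<forall>\<rho>. \<bar>\<rho>\<bar> < \<epsilon> \<longrightarrow> transpose (h x \<rho>) = h x \<rho> \<and> invertible (g x + h x \<rho>)) \<and>
     continuous_on (amb_domain M \<epsilon>) (amb g h) \<and>
     (\<forall>i j. smooth_on (amb_domain M \<epsilon> \<inter> {P. P $ Crho \<noteq> 0}) (\<lambda>P. amb g h P $ i $ j)) \<and>
     (\<forall>k. enat k \<le> amb_order CARD('m) \<longrightarrow> ricci_O M (amb g h) k)"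

definition smooth_ambient_metric ::
    "(real^'m::finite) set \<Rightarrow> real \<Rightarrow> 'm metric \<Rightarrow> (real^'m \<Rightarrow> real \<Rightarrow> real^'m^'m) \<Rightarrow> bool" where
  "smooth_ambient_metric M \<epsilon> g h \<longleftrightarrow>
     ambient_metric M \<epsilon> g h \<and>
     (\<forall>i j. smooth_on (amb_domain M \<epsilon>) (\<lambda>P. amb g h P $ i $ j))"

definition analytic_in_rho ::
    "(real^'m::finite) set \<Rightarrow> real \<Rightarrow> (real^'m \<Rightarrow> real \<Rightarrow> real^'m^'m) \<Rightarrow> bool" where
  "analytic_in_rho M \<epsilon> h \<longleftrightarrow>
     (\<forall>x\<in>M. \<forall>r. \<bar>r\<bar> < \<epsilon> \<longrightarrow>
        (\<forall>a b. \<exists>F. (\<lambda>s. h x (r + s) $ a $ b) has_fps_expansion F))"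

text \<open>The obstruction tensor for even dimension, normalised by the constant \<open>\<kappa>\<close>; \<open>L\<close> is the
  tensor \<open>(\<rho>\<^bsup>1-n/2\<^esup> Ric|\<^bsub>TM\<otimes>TM\<^esub>)|\<^bsub>\<rho>=0\<^esub>\<close>. It is introduced as a relation since its independence of
  the chosen ambient metric is a theorem.\<close>

definition is_obstruction ::
    "real \<Rightarrow> (real^'m::finite) set \<Rightarrow> 'm metric \<Rightarrow> (real^'m \<Rightarrow> real^'m^'m) \<Rightarrow> bool" where
  "is_obstruction \<kappa> M g Ob \<longleftrightarrow>
     (\<exists>\<epsilon> h L. smooth_ambient_metric M \<epsilon> g h \<and>
        (\<forall>x\<in>M. \<forall>t>0. \<forall>a b.
           ((\<lambda>\<rho>. ricci (amb g h) (amb_point t x \<rho>) $ Cm a $ Cm b / \<rho> ^ (CARD('m) div 2 - 1))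
              \<longlongrightarrow> L x $ a $ b) (at 0)) \<and>
        (\<forall>x\<in>M. (\<Sum>a\<in>UNIV. \<Sum>b\<in>UNIV. matrix_inv (g x) $ a $ b * L x $ a $ b) = 0) \<and>
        (\<forall>x\<in>M. Ob x = \<kappa> *\<^sub>R L x))"

section \<open>pp-waves\<close>

text \<open>Coordinates \<open>(u, v, x\<^sup>1, \<dots>, x\<^sup>n\<^sup>-\<^sup>2)\<close> with the \<open>x\<^sup>i\<close> indexed by the type \<open>'n\<close>. As types are
  non-empty, the dimension \<open>n = CARD('n pp_coord) = CARD('n) + 2\<close> ranges over all \<open>n \<ge> 3\<close>.\<close>

datatype 'n pp_coord = Cu | Cv | Cx 'n

instance pp_coord :: (finite) finite
proof
  have "(UNIV :: 'a pp_coord set) = {Cu, Cv} \<union> range Cx"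
    using pp_coord.exhaust by auto
  then show "finite (UNIV :: 'a pp_coord set)"
    by (metis finite finite.emptyI finite_Un finite_imageI finite_insert)
qed

lemma card_pp_coord: "CARD('n::finite pp_coord) = CARD('n) + 2"
proof -
  have "CARD('n pp_coord) = card (insert Cu (insert Cv (range (Cx :: 'n \<Rightarrow> 'n pp_coord))))"
    using pp_coord.exhaust by (intro arg_cong[where f = card]) auto
  also have "\<dots> = card (range (Cx :: 'n \<Rightarrow> 'n pp_coord)) + 2"
    by (subst card_insert_disjoint; auto)+
  also have "card (range (Cx :: 'n \<Rightarrow> 'n pp_coord)) = CARD('n)"
    by (intro card_image injI) simp
  finally show ?thesis .
qed

definition indep_v :: "(real^('n::finite pp_coord)) set \<Rightarrow> (real^('n pp_coord) \<Rightarrow> real) \<Rightarrow> bool" where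
  "indep_v M H \<longleftrightarrow> (\<forall>p\<in>M. \<forall>q\<in>M. (\<forall>i. i \<noteq> Cv \<longrightarrow> p $ i = q $ i) \<longrightarrow> H p = H q)"

definition laplacian :: "(real^('n::finite pp_coord) \<Rightarrow> real) \<Rightarrow> real^('n pp_coord) \<Rightarrow> real" where
  "laplacian f p = (\<Sum>i\<in>UNIV. partial (Cx i) (partial (Cx i) f) p)"

definition du2 :: "real^('n::finite pp_coord)^('n pp_coord)" where
  "du2 = (\<chi> a b. if a = Cu \<and> b = Cu then 1 else 0)"

definition pp_wave :: "(real^('n::finite pp_coord) \<Rightarrow> real) \<Rightarrow> 'n pp_coord metric" where
  "pp_wave H p = (\<chi> a b. case (a, b) of
       (Cu, Cu) \<Rightarrow> H p
     | (Cu, Cv) \<Rightarrow> 1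
     | (Cv, Cu) \<Rightarrow> 1
     | (Cx i, Cx j) \<Rightarrow> (if i = j then 1 else 0)
     | _ \<Rightarrow> 0)"

text \<open>The coefficients of \<open>\<rho>\<^sup>k\<close> (zero unless \<open>1 \<le> k \<le> m\<close>) and of \<open>\<rho>\<^bsup>n/2+k\<^esup>\<close> in the ambient metric.\<close>

definition coeff_H :: "(real^('n::finite pp_coord) \<Rightarrow> real) \<Rightarrow> nat \<Rightarrow> real^('n pp_coord) \<Rightarrow> real" where
  "coeff_H H k p =
     (if 1 \<le> k \<and> enat k \<le> amb_order CARD('n pp_coord)
      then (laplacian ^^ k) H p / (fact k * (\<Prod>i=1..k. 2 * real i - real CARD('n pp_coord)))
      else 0)"

definition coeff_f :: "(real^('n::finite pp_coord) \<Rightarrow> real) \<Rightarrow> nat \<Rightarrow> real^('n pp_coord) \<Rightarrow> real" where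
  "coeff_f f k p =
     (laplacian ^^ k) f p / (fact k * (\<Prod>i=1..k. 2 * real i + real CARD('n pp_coord)))"

text \<open>\<open>\<rho>\<^bsup>n/2\<^esup>\<close>; for odd \<open>n\<close> it is continued to \<open>\<rho> < 0\<close> as \<open>\<bar>\<rho>\<bar>\<^bsup>n/2\<^esup>\<close>, so that the metric is real on
  all of \<open>(-\<epsilon>,\<epsilon>)\<close>.\<close>

definition half_power :: "nat \<Rightarrow> real \<Rightarrow> real" where
  "half_power n \<rho> = (if even n then \<rho> ^ (n div 2) else \<bar>\<rho>\<bar> powr (real n / 2))"

definition pp_h ::
    "(real^('n::finite pp_coord) \<Rightarrow> real) \<Rightarrow> (real^('n pp_coord) \<Rightarrow> real)
      \<Rightarrow> real^('n pp_coord) \<Rightarrow> real \<Rightarrow> real^('n pp_coord)^('n pp_coord)" where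
  "pp_h H f x \<rho> =
     ((\<Sum>k. coeff_H H k x * \<rho> ^ k)
      + (\<Sum>k. coeff_f f k x * (half_power CARD('n pp_coord) \<rho> * \<rho> ^ k))) *\<^sub>R du2"

definition pp_h_trunc ::
    "(real^('n::finite pp_coord) \<Rightarrow> real) \<Rightarrow> (real^('n pp_coord) \<Rightarrow> real)
      \<Rightarrow> nat \<Rightarrow> real^('n pp_coord) \<Rightarrow> real \<Rightarrow> real^('n pp_coord)^('n pp_coord)" where
  "pp_h_trunc H f N x \<rho> =
     ((\<Sum>k\<le>N. coeff_H H k x * \<rho> ^ k)
      + (\<Sum>k\<le>N. coeff_f f k x * (half_power CARD('n pp_coord) \<rho> * \<rho> ^ k))) *\<^sub>R du2"

text \<open>The two readings of an infinite series in \<open>\<rho>\<close> with coefficients depending on \<open>x\<close>.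
  Actual: it converges pointwise, and the sum is smooth. Formal: a formal series
  of metrics satisfies \<open>Ric = O(\<rho>\<^sup>m)\<close> if, for every finite \<open>k \<le> m\<close>, so do all sufficiently long
  truncations to order \<open>k\<close>.\<close>

definition converges_smoothly ::
    "(real^'m::finite) set \<Rightarrow> real \<Rightarrow> (nat \<Rightarrow> real^'m \<Rightarrow> real) \<Rightarrow> bool" where
  "converges_smoothly M \<epsilon> c \<longleftrightarrow>
     (\<forall>x\<in>M. \<forall>\<rho>. \<bar>\<rho>\<bar> < \<epsilon> \<longrightarrow> summable (\<lambda>k. c k x * \<rho> ^ k)) \<and>
     smooth_on (amb_domain M \<epsilon>) (\<lambda>P. \<Sum>k. c k (base_point P) * (P $ Crho) ^ k)"

definition formal_ricci_O ::
    "(real^'m::finite) set \<Rightarrow> 'm metric \<Rightarrow> (nat \<Rightarrow> real^'m \<Rightarrow> real \<Rightarrow> real^'m^'m) \<Rightarrow> enat \<Rightarrow> bool" where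
  "formal_ricci_O M g hs m \<longleftrightarrow>
     (\<forall>k. enat k \<le> m \<longrightarrow> (\<forall>\<^sub>F N in sequentially. ricci_O M (amb g (hs N)) k))"

end

theory Submission
  imports Defs "HOL-Complex_Analysis.Cauchy_Integral_Formula"
begin

text \<open>
  For a metric in normal form the tangential part of the Ricci tensor is
  \<open>\<rho> G'' + (1 - n/2) G' - (tr G') G / 2 + Ric(G)\<close> up to terms \<open>\<rho> G' * G'\<close>, where the prime is
  \<open>\<partial>/\<partial>\<rho>\<close>. Over a pp-wave with potential \<open>F = H + \<phi>(x,\<rho>)\<close> all quadratic terms and traces vanish, and only
  the \<open>du\<^sup>2\<close>-component \<open>\<rho> F'' + (1 - n/2) F' - \<Delta>F / 2\<close> survives; the two series solve this linear
  equation term by term, up to a multiple of \<open>\<Delta>\<^bsup>n/2\<^esup>H \<rho>\<^bsup>(n-2)/2\<^esup>\<close> for even \<open>n\<close>.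

  A series is only assumed to converge pointwise to a smooth function. By Baire's theorem its
  coefficients are locally uniformly bounded on a dense open set; there the maximum principle shows
  that \<open>\<Delta>\<close> commutes with the summation, and the equation extends by continuity.

  For uniqueness, two solutions are compared modulo powers of \<open>\<rho>\<close>. The first coefficient in which they
  differ satisfies a linear equation that is singular only at the orders \<open>n/2\<close> and \<open>n\<close>; the latter
  is dealt with by the \<open>\<rho>\<rho>\<close>-component. At order \<open>n/2\<close> the trace condition still determines the
  obstruction tensor.
\<close>

section \<open>Partial derivatives and smooth functions\<close>

text \<open>The exponents 0 and n/2 at which the two series start are the indicial roots of \<rho>
  F'' + (1 - n/2) F' at the singular point \<rho> = 0. Solving for the coefficient of \<rho>^(k+1)
  divides by (k+1)(2k+2-n). For even n this is zero at k = (n-2)/2: the first series has to stop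
  there, the Laplacian of its last coefficient remains uncancelled, and this remainder determines
  the constant c_n up to normalisation. The second series starts at the larger root and meets no
  zero, which is why f is arbitrary. The convergence hypothesis shapes the analysis. Differentiation
  in \<rho> under the sum is automatic for a power series, but pointwise convergence to a smooth sum
  gives no control of derivatives in x. Only \<Delta> has to be exchanged with the sum, and for this
  the maximum principle suffices: it uses convergence of the functions and of their Laplacians, not
  of single derivatives. In the comparison of two metrics, tracing (j+1-n/2) \<phi> - (tr \<phi>)
  g/2 yields (j+1-n) tr \<phi>; this is where the second exceptional order n comes from.\<close>

lemma has_real_derivative_partial:
  fixes f :: "real^'m::finite \<Rightarrow> real"
  assumes "f differentiable (at (p + s0 *\<^sub>R axis i 1))"
  shows "((\<lambda>s. f (p + s *\<^sub>R axis i 1)) has_real_derivative partial i f (p + s0 *\<^sub>R axis i 1)) (at s0)"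
proof -
  from assms obtain f' where f': "(f has_derivative f') (at (p + s0 *\<^sub>R axis i 1))"
    by (auto simp: differentiable_def)
  have d: "(\<lambda>s. f (q + s *\<^sub>R axis i 1)) differentiable (at s1)"
    if "(f has_derivative f') (at (q + s1 *\<^sub>R axis i 1))" for q s1
  proof -
    have "((\<lambda>s. q + s *\<^sub>R axis i 1) has_derivative (\<lambda>s. s *\<^sub>R axis i (1::real))) (at s1)"
      by (auto intro!: derivative_eq_intros)
    from has_derivative_compose[OF this, of f f'] that show ?thesis
      by (auto simp: differentiable_def)
  qed
  have "((\<lambda>s. f (p + s0 *\<^sub>R axis i 1 + s *\<^sub>R axis i 1)) has_real_derivative
      partial i f (p + s0 *\<^sub>R axis i 1)) (at 0)"
    using d[of "p + s0 *\<^sub>R axis i 1" 0] f' unfolding partial_def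
    by (simp add: DERIV_deriv_iff_real_differentiable)
  then have "((\<lambda>s. f (p + (s + s0) *\<^sub>R axis i 1)) has_real_derivative
      partial i f (p + s0 *\<^sub>R axis i 1)) (at 0)"
    by (simp add: scaleR_add_left add_ac)
  from DERIV_shift[of "\<lambda>s. f (p + s *\<^sub>R axis i 1)" _ 0 s0] this show ?thesis by simp
qed

lemma has_real_derivative_partial_0:
  fixes f :: "real^'m::finite \<Rightarrow> real"
  assumes "f differentiable (at p)"
  shows "((\<lambda>s. f (p + s *\<^sub>R axis i 1)) has_real_derivative partial i f p) (at 0)"
  using has_real_derivative_partial[of f p 0 i] assms by simp

lemma partialI:
  assumes "((\<lambda>s. f (p + s *\<^sub>R axis i 1)) has_real_derivative D) (at 0)"
  shows "partial i f p = D"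
  using assms unfolding partial_def by (rule DERIV_imp_deriv)

lemma filterlim_line: "filterlim (\<lambda>s. p + s *\<^sub>R axis i (1::real)) (nhds (p::real^'m::finite)) (nhds 0)"
proof -
  have "((\<lambda>s. p + s *\<^sub>R axis i (1::real)) \<longlongrightarrow> p + 0 *\<^sub>R axis i 1) (nhds 0)"
    by (intro tendsto_intros filterlim_ident)
  then show ?thesis by simp
qed

lemma eventually_line:
  fixes p :: "real^'m::finite"
  assumes "open S" "p \<in> S"
  shows "eventually (\<lambda>s. p + s *\<^sub>R axis i 1 \<in> S) (nhds (0::real))"
  using filterlim_line[of p i] eventually_nhds_in_open[OF assms]
  by (auto simp: filterlim_iff)

lemma partial_cong:
  fixes p :: "real^'m::finite"
  assumes "open S" "p \<in> S" "\<And>q. q \<in> S \<Longrightarrow> f q = g q"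
  shows "partial i f p = partial i g p"
  unfolding partial_def
  by (intro deriv_cong_ev eventually_mono[OF eventually_line[OF assms(1,2), of i]]) (auto simp: assms)

lemma partial_zero_of_constant:
  fixes p :: "real^'m::finite"
  assumes "eventually (\<lambda>s. f (p + s *\<^sub>R axis i 1) = f p) (nhds (0::real))"
  shows "partial i f p = 0"
proof -
  have "deriv (\<lambda>s. f (p + s *\<^sub>R axis i 1)) 0 = deriv (\<lambda>s::real. f p) 0"
    by (rule deriv_cong_ev[OF assms]) simp
  then show ?thesis unfolding partial_def by simp
qed

lemma partial_const [simp]: "partial i (\<lambda>_. c) = (\<lambda>_. 0)"
  by (auto simp: partial_def)

lemma partial_add:
  assumes "f differentiable (at p)" "g differentiable (at p)"
  shows "partial i (\<lambda>q. f q + g q) p = partial i f p + partial i g p"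
  by (rule partialI) (intro derivative_intros has_real_derivative_partial_0 assms)

lemma partial_diff:
  assumes "f differentiable (at p)" "g differentiable (at p)"
  shows "partial i (\<lambda>q. f q - g q) p = partial i f p - partial i g p"
  by (rule partialI) (intro derivative_intros has_real_derivative_partial_0 assms)

lemma partial_mult:
  assumes "f differentiable (at p)" "g differentiable (at p)"
  shows "partial i (\<lambda>q. f q * g q) p = partial i f p * g p + f p * partial i g p"
  by (rule partialI)
    (use DERIV_mult[OF has_real_derivative_partial_0[OF assms(1)] has_real_derivative_partial_0[OF
      assms(2)], of i i]
      in \<open>simp add: algebra_simps\<close>)

lemma partial_cmult:
  assumes "f differentiable (at p)"
  shows "partial i (\<lambda>q. c * f q) p = c * partial i f p"
  using partial_mult[of "\<lambda>_. c" p f i] assms by simp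

lemma partial_sum:
  assumes "\<And>a. a \<in> A \<Longrightarrow> f a differentiable (at p)"
  shows "partial i (\<lambda>q. \<Sum>a\<in>A. f a q) p = (\<Sum>a\<in>A. partial i (f a) p)"
  by (rule partialI) (intro DERIV_sum has_real_derivative_partial_0 assms)

lemma partial_inverse:
  assumes "f differentiable (at p)" "f p \<noteq> 0"
  shows "partial i (\<lambda>q. inverse (f q)) p = - (partial i f p * (inverse (f p) * inverse (f p)))"
  by (rule partialI)
    (use DERIV_inverse_fun[OF has_real_derivative_partial_0[OF assms(1)], of i] assms(2) in
      \<open>simp add: power2_eq_square algebra_simps\<close>)

lemma partial_coord: "partial i (\<lambda>q. q $ j) p = (if i = j then 1 else 0)"
  by (rule partialI) (auto intro!: derivative_eq_intros simp: axis_def)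

text \<open>The order-by-order form of \<open>smooth_on\<close>. It peels off the derivative that is
  taken first, the last entry of the list in \<open>foldr\<close>, so that closure properties follow
  by induction on the order with \<open>f\<close> arbitrary.\<close>

primrec diff_upto :: "nat \<Rightarrow> (real^'m::finite) set \<Rightarrow> (real^'m \<Rightarrow> real) \<Rightarrow> bool" where
  "diff_upto 0 S f = (f differentiable_on S)"
| "diff_upto (Suc n) S f = (f differentiable_on S \<and> (\<forall>i. diff_upto n S (partial i f)))"

lemma diff_upto_iff:
  "diff_upto n S f \<longleftrightarrow> (\<forall>is. length is \<le> n \<longrightarrow> foldr partial is f differentiable_on S)"
proof (induction n arbitrary: f)
  case (Suc n)
  show ?case
  proof
    assume L: "diff_upto (Suc n) S f"
    show "\<forall>is. length is \<le> Suc n \<longrightarrow> foldr partial is f differentiable_on S"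
    proof (intro allI impI)
      fix "is" :: "'a list" assume "length is \<le> Suc n"
      then show "foldr partial is f differentiable_on S"
        using L Suc by (cases "is" rule: rev_cases) auto
    qed
  next
    assume R: "\<forall>is. length is \<le> Suc n \<longrightarrow> foldr partial is f differentiable_on S"
    have "foldr partial is (partial i f) differentiable_on S" if "length is \<le> n" for i "is"
      using R[rule_format, of "is @ [i]"] that by simp
    moreover have "f differentiable_on S" using R[rule_format, of "[]"] by simp
    ultimately show "diff_upto (Suc n) S f" by (simp add: Suc)
  qed
qed simp

lemma smooth_on_iff_diff_upto: "smooth_on S f \<longleftrightarrow> (\<forall>n. diff_upto n S f)"
  unfolding smooth_on_def diff_upto_iff by blast

lemma smooth_on_partial: "smooth_on S f \<Longrightarrow> smooth_on S (partial i f)"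
  unfolding smooth_on_iff_diff_upto by (metis diff_upto.simps(2))

lemma diff_upto_differentiable: "diff_upto n S f \<Longrightarrow> f differentiable_on S"
  by (cases n) auto

lemma diff_upto_Suc: "diff_upto (Suc n) S f \<Longrightarrow> diff_upto n S f"
  unfolding diff_upto_iff by simp

lemma smooth_on_differentiable_on: "smooth_on S f \<Longrightarrow> f differentiable_on S"
  unfolding smooth_on_iff_diff_upto by (metis diff_upto_differentiable)

lemma smooth_on_differentiable:
  "smooth_on S f \<Longrightarrow> open S \<Longrightarrow> p \<in> S \<Longrightarrow> f differentiable (at p)"
  using smooth_on_differentiable_on differentiable_on_eq_differentiable_at by blast

lemma smooth_on_continuous_on: "smooth_on S f \<Longrightarrow> continuous_on S f"
  by (intro differentiable_imp_continuous_on smooth_on_differentiable_on)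

lemma smooth_on_subset: "smooth_on S f \<Longrightarrow> T \<subseteq> S \<Longrightarrow> smooth_on T f"
  unfolding smooth_on_def by (meson differentiable_on_subset)

lemma diff_upto_cong:
  assumes "open S" "\<And>q. q \<in> S \<Longrightarrow> f q = g q" "diff_upto n S f"
  shows "diff_upto n S g"
proof -
  have d: "g differentiable_on S" if "f differentiable_on S" "\<forall>q\<in>S. f q
    = g q" for f g :: "real^'a \<Rightarrow> real"
    unfolding differentiable_on_def
  proof
    fix x assume "x \<in> S"
    with that show "g differentiable (at x within S)"
      by (intro differentiable_transform_within[of f x S 1 g]) (auto simp: differentiable_on_def)
  qed
  show ?thesis using assms(2,3)
  proof (induction n arbitrary: f g)
    case 0
    then show ?case using d[of f g] by simp
  next
    case (Suc n)
    have "diff_upto n S (partial i g)" for i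
    proof (rule Suc.IH[of "partial i f"])
      show "partial i f q = partial i g q" if "q \<in> S" for q
        using partial_cong[OF assms(1) that Suc.prems(1)] .
    qed (use Suc.prems in auto)
    then show ?case using Suc.prems d[of f g] by simp
  qed
qed

lemma smooth_on_cong:
  assumes "open S" "\<And>q. q \<in> S \<Longrightarrow> f q = g q" "smooth_on S f"
  shows "smooth_on S g"
  unfolding smooth_on_iff_diff_upto
proof
  fix n
  have "diff_upto n S f" using assms(3) by (simp add: smooth_on_iff_diff_upto)
  then show "diff_upto n S g" using diff_upto_cong[of S f g] assms(1,2) by simp
qed

text \<open>\<open>F i\<close> may be any formula valid on \<open>S\<close>, and it may contain
  \<open>f\<close> itself, whose order \<open>n\<close> is already known in an induction. This is
  how reciprocals and \<open>half_power\<close> are handled.\<close>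

lemma diff_uptoI:
  assumes "open S" "f differentiable_on S"
    "\<And>i q. q \<in> S \<Longrightarrow> partial i f q = F i q" "\<And>i. diff_upto n S (F i)"
  shows "diff_upto (Suc n) S f"
proof -
  have "diff_upto n S (partial i f)" for i
    by (rule diff_upto_cong[OF assms(1) _ assms(4)[of i]]) (simp add: assms(3))
  then show ?thesis using assms(2) by simp
qed

lemma diff_upto_const: "diff_upto n S (\<lambda>_. c)"
  by (induction n arbitrary: c) (auto simp: differentiable_on_const)

lemma smooth_on_const [simp, intro]: "smooth_on S (\<lambda>_. c)"
  by (simp add: smooth_on_iff_diff_upto diff_upto_const)

lemma diff_upto_add:
  assumes "open S" "diff_upto n S f" "diff_upto n S g"
  shows "diff_upto n S (\<lambda>q. f q + g q)"
  using assms(2,3)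
proof (induction n arbitrary: f g)
  case (Suc n)
  show ?case
  proof (rule diff_uptoI[OF assms(1), where F = "\<lambda>i q. partial i f q + partial i g q"])
    show "(\<lambda>q. f q + g q) differentiable_on S" using Suc.prems by (auto intro: differentiable_on_add)
    show "partial i (\<lambda>q. f q + g q) q = partial i f q + partial i g q" if "q \<in> S" for i q
      using Suc.prems that assms(1) by (auto intro!: partial_add simp:
        differentiable_on_eq_differentiable_at)
    show "diff_upto n S (\<lambda>q. partial i f q + partial i g q)" for i
      using Suc by auto
  qed
qed (auto intro: differentiable_on_add)

lemma diff_upto_mult:
  assumes "open S" "diff_upto n S f" "diff_upto n S g"
  shows "diff_upto n S (\<lambda>q. f q * g q)"
  using assms(2,3)
proof (induction n arbitrary: f g)
  case (Suc n)
  show ?case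
  proof (rule diff_uptoI[OF assms(1), where F = "\<lambda>i q. partial i f q * g q + f q * partial i g q"])
    show "(\<lambda>q. f q * g q) differentiable_on S" using Suc.prems by (auto intro: differentiable_on_mult)
    show "partial i (\<lambda>q. f q * g q) q = partial i f q * g q + f q * partial i g q" if "q \<in> S" for i q
      using Suc.prems that assms(1) by (auto intro!: partial_mult simp:
        differentiable_on_eq_differentiable_at)
    have "diff_upto n S f" "diff_upto n S g" using Suc.prems diff_upto_Suc by blast+
    then show "diff_upto n S (\<lambda>q. partial i f q * g q + f q * partial i g q)" for i
      using Suc by (intro diff_upto_add assms(1)) auto
  qed
qed (auto intro: differentiable_on_mult)

lemma smooth_on_add: "open S \<Longrightarrow> smooth_on S f \<Longrightarrow> smooth_on S g \<Longrightarrow> smooth_on S (\<lambda>q. f q + g q)"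
  by (simp add: smooth_on_iff_diff_upto diff_upto_add)

lemma smooth_on_mult: "open S \<Longrightarrow> smooth_on S f \<Longrightarrow> smooth_on S g \<Longrightarrow> smooth_on S (\<lambda>q. f q * g q)"
  by (simp add: smooth_on_iff_diff_upto diff_upto_mult)

lemma smooth_on_minus: "open S \<Longrightarrow> smooth_on S f \<Longrightarrow> smooth_on S (\<lambda>q. - f q)"
  using smooth_on_mult[of S "\<lambda>_. -1" f] by simp

lemma smooth_on_diff: "open S \<Longrightarrow> smooth_on S f \<Longrightarrow> smooth_on S g \<Longrightarrow> smooth_on S (\<lambda>q. f q - g q)"
  using smooth_on_add[of S f "\<lambda>q. - g q"] smooth_on_minus[of S g] by simp

lemma smooth_on_sum:
  "open S \<Longrightarrow> (\<And>a. a \<in> A \<Longrightarrow> smooth_on S (f a)) \<Longrightarrow> smooth_on S (\<lambda>q. \<Sum>a\<in>A. f a q)"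
  by (induction A rule: infinite_finite_induct) (auto intro: smooth_on_add)

lemma smooth_on_prod:
  "open S \<Longrightarrow> (\<And>a. a \<in> A \<Longrightarrow> smooth_on S (f a)) \<Longrightarrow> smooth_on S (\<lambda>q. \<Prod>a\<in>A. f a q)"
  by (induction A rule: infinite_finite_induct) (auto intro: smooth_on_mult)

lemma smooth_on_power: "open S \<Longrightarrow> smooth_on S f \<Longrightarrow> smooth_on S (\<lambda>q. f q ^ k)"
  by (induction k) (auto intro: smooth_on_mult)

lemma smooth_on_inverse:
  assumes "open S" "smooth_on S f" "\<And>q. q \<in> S \<Longrightarrow> f q \<noteq> 0"
  shows "smooth_on S (\<lambda>q. inverse (f q))"
proof -
  have d: "(\<lambda>q. inverse (f q)) differentiable_on S"
    using assms smooth_on_differentiable_on by (auto intro: differentiable_on_inverse)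
  have "diff_upto n S (\<lambda>q. inverse (f q))" for n
  proof (induction n)
    case (Suc n)
    show ?case
    proof (rule diff_uptoI[OF assms(1) d])
      show "partial i (\<lambda>q. inverse (f q)) q = (-1) * (partial i f q * (inverse (f q) * inverse (f q)))"
        if "q \<in> S" for i q
        using partial_inverse[OF smooth_on_differentiable[OF assms(2,1) that] assms(3)[OF that]] by simp
      have "diff_upto n S (partial i f)" for i
        using smooth_on_partial[OF assms(2)] smooth_on_iff_diff_upto by blast
      then show "diff_upto n S (\<lambda>q. (-1) * (partial i f q * (inverse (f q) * inverse (f q))))" for i
        by (intro diff_upto_mult diff_upto_const Suc assms(1))
    qed
  qed (use d in simp)
  then show ?thesis by (simp add: smooth_on_iff_diff_upto)
qed

lemma smooth_on_divide:
  assumes "open S" "smooth_on S f" "smooth_on S g" "\<And>q. q \<in> S \<Longrightarrow> g q \<noteq> 0"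
  shows "smooth_on S (\<lambda>q. f q / g q)"
  using smooth_on_mult[OF assms(1,2) smooth_on_inverse[OF assms(1,3,4)]] by (simp add: divide_inverse)

lemma smooth_on_coord: "smooth_on S (\<lambda>q. q $ j)"
proof -
  have d: "(\<lambda>q::real^'a. q $ j) differentiable_on S"
    by (intro linear_imp_differentiable_on) (simp add: bounded_linear.linear bounded_linear_vec_nth)
  have "partial i (\<lambda>q::real^'a. q $ j) = (\<lambda>_. if i = j then 1 else 0)" for i
    by (rule ext) (rule partial_coord)
  then have "diff_upto n S (\<lambda>q. q $ j)" for n
    using d by (cases n) (auto simp: diff_upto_const)
  then show ?thesis by (simp add: smooth_on_iff_diff_upto)
qed

lemmas smooth_intros = smooth_on_const smooth_on_add smooth_on_mult smooth_on_minus smooth_on_diff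
  smooth_on_sum smooth_on_prod smooth_on_power smooth_on_inverse smooth_on_divide smooth_on_coord
  smooth_on_partial

text \<open>The mean value theorem is applied twice: along \<open>i\<close> to the difference of
  \<open>f\<close> at the levels \<open>h\<close> and 0 in direction \<open>j\<close>, then along
  \<open>j\<close> to \<open>partial i f\<close>.\<close>

lemma mixed_difference_mean_value:
  fixes f :: "real^'m::finite \<Rightarrow> real"
  assumes "smooth_on S f" "open S" "0 < h"
    and sq: "\<And>s t. 0 \<le> s \<Longrightarrow> s \<le> h \<Longrightarrow> 0 \<le> t \<Longrightarrow> t \<le> h \<Longrightarrow> p + s *\<^sub>R axis i 1 + t *\<^sub>R axis j 1 \<in> S"
  shows "\<exists>\<xi> \<eta>. 0 < \<xi> \<and> \<xi> < h \<and> 0 < \<eta> \<and> \<eta> < h \<and>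
    f (p + h *\<^sub>R axis i 1 + h *\<^sub>R axis j 1) - f (p + h *\<^sub>R axis i 1) - (f (p + h *\<^sub>R axis j 1) - f p)
      = h * h * partial j (partial i f) (p + \<xi> *\<^sub>R axis i 1 + \<eta> *\<^sub>R axis j 1)"
proof -
  have df: "f differentiable (at q)" "partial i f differentiable (at q)" if "q \<in> S" for q
    using smooth_on_differentiable[OF assms(1,2) that]
      smooth_on_differentiable[OF smooth_on_partial[OF assms(1)] assms(2) that] by auto
  define \<phi> where "\<phi> s = f (p + h *\<^sub>R axis j 1 + s *\<^sub>R axis i 1) - f (p + s *\<^sub>R axis i 1)" for s
  have "(\<phi> has_real_derivative partial i f (p + h *\<^sub>R axis j 1 + s *\<^sub>R axis i 1) - partial i f (p
    + s *\<^sub>R axis i 1)) (at s)"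
    if "0 \<le> s" "s \<le> h" for s
    unfolding \<phi>_def using sq[of s h] sq[of s 0] that assms(3)
    by (intro DERIV_diff has_real_derivative_partial df) (auto simp: add_ac)
  from MVT2[OF assms(3) this] obtain \<xi> where \<xi>: "0 < \<xi>" "\<xi> < h"
    "\<phi> h - \<phi> 0 = (h - 0) * (partial i f (p + h *\<^sub>R axis j 1 + \<xi> *\<^sub>R axis i 1) - partial i f (p
      + \<xi> *\<^sub>R axis i 1))"
    by blast
  have "((\<lambda>t. partial i f (p + \<xi> *\<^sub>R axis i 1 + t *\<^sub>R axis j 1)) has_real_derivative
      partial j (partial i f) (p + \<xi> *\<^sub>R axis i 1 + t *\<^sub>R axis j 1)) (at t)"
    if "0 \<le> t" "t \<le> h" for t
    using sq[of \<xi> t] that \<xi> by (intro has_real_derivative_partial df) auto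
  from MVT2[OF assms(3) this] obtain \<eta> where \<eta>: "0 < \<eta>" "\<eta> < h"
    "partial i f (p + \<xi> *\<^sub>R axis i 1 + h *\<^sub>R axis j 1) - partial i f (p + \<xi> *\<^sub>R axis i 1
      + 0 *\<^sub>R axis j 1)
      = (h - 0) * partial j (partial i f) (p + \<xi> *\<^sub>R axis i 1 + \<eta> *\<^sub>R axis j 1)"
    by blast
  show ?thesis
    using \<xi> \<eta> by (intro exI[of _ \<xi>] exI[of _ \<eta>]) (auto simp: \<phi>_def add_ac)
qed

text \<open>Schwarz's theorem: the second difference over a small square is symmetric in the two
  directions, so its two mean value forms give equal mixed derivatives at two points near
  \<open>p\<close>, and continuity at \<open>p\<close> concludes.\<close>

lemma partial_commute:
  fixes f :: "real^'m::finite \<Rightarrow> real"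
  assumes "smooth_on S f" "open S" "p \<in> S"
  shows "partial i (partial j f) p = partial j (partial i f) p"
proof (rule ccontr)
  assume ne: "partial i (partial j f) p \<noteq> partial j (partial i f) p"
  define e where "e = \<bar>partial i (partial j f) p - partial j (partial i f) p\<bar> / 2"
  have e: "e > 0" using ne by (simp add: e_def)
  have c: "continuous_on S (partial i (partial j f))" "continuous_on S (partial j (partial i f))"
    using assms(1) by (auto intro!: smooth_on_continuous_on smooth_on_partial)
  then have "isCont (partial i (partial j f)) p" "isCont (partial j (partial i f)) p"
    using assms(2,3) continuous_on_eq_continuous_at by blast+
  then obtain d1 d2 where d: "d1 > 0" "d2 > 0"
    "\<And>q. dist q p < d1 \<Longrightarrow> \<bar>partial i (partial j f) q - partial i (partial j f) p\<bar> < e"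
    "\<And>q. dist q p < d2 \<Longrightarrow> \<bar>partial j (partial i f) q - partial j (partial i f) p\<bar> < e"
    unfolding continuous_at_eps_delta dist_real_def using e by metis
  obtain d3 where d3: "d3 > 0" "ball p d3 \<subseteq> S"
    using assms(2,3) open_contains_ball by blast
  \<comment> \<open>Points of a square of side \<open>h\<close> are within \<open>2 * h\<close> of
    \<open>p\<close>; the divisor 4 keeps this below all three radii.\<close>
  define h where "h = min d1 (min d2 d3) / 4"
  have h: "h > 0" "2 * h < d1" "2 * h < d2" "2 * h < d3" using d d3 by (auto simp: h_def)
  have dd: "dist (p + s *\<^sub>R axis k 1 + t *\<^sub>R axis l 1) p \<le> 2 * h"
    if "0 \<le> s" "s \<le> h" "0 \<le> t" "t \<le> h" for s t :: real and k l
  proof -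
    have "dist (p + s *\<^sub>R axis k 1 + t *\<^sub>R axis l 1) p = norm (s *\<^sub>R axis k 1 + t *\<^sub>R axis l (1::real))"
      by (simp add: dist_norm add.assoc)
    also have "\<dots> \<le> norm (s *\<^sub>R axis k (1::real)) + norm (t *\<^sub>R axis l (1::real))"
      by (rule norm_triangle_ineq)
    also have "\<dots> = s + t" using that by (simp add: norm_axis_1)
    finally show ?thesis using that by simp
  qed
  have sq: "p + s *\<^sub>R axis k 1 + t *\<^sub>R axis l 1 \<in> S"
    if "0 \<le> s" "s \<le> h" "0 \<le> t" "t \<le> h" for s t k l
    using dd[OF that, of k l] d3 h by (auto simp: subset_iff dist_commute)
  obtain a b where ab: "0 < a" "a < h" "0 < b" "b < h"
    "f (p + h *\<^sub>R axis i 1 + h *\<^sub>R axis j 1) - f (p + h *\<^sub>R axis i 1) - (f (p + h *\<^sub>R axis j 1) - f p)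
      = h * h * partial j (partial i f) (p + a *\<^sub>R axis i 1 + b *\<^sub>R axis j 1)"
    using mixed_difference_mean_value[OF assms(1,2) h(1) sq, of i j] by auto
  obtain a' b' where ab': "0 < a'" "a' < h" "0 < b'" "b' < h"
    "f (p + h *\<^sub>R axis j 1 + h *\<^sub>R axis i 1) - f (p + h *\<^sub>R axis j 1) - (f (p + h *\<^sub>R axis i 1) - f p)
      = h * h * partial i (partial j f) (p + a' *\<^sub>R axis j 1 + b' *\<^sub>R axis i 1)"
    using mixed_difference_mean_value[OF assms(1,2) h(1) sq, of j i] by auto
  have "p + h *\<^sub>R axis j 1 + h *\<^sub>R axis i 1 = p + h *\<^sub>R axis i 1 + h *\<^sub>R axis j 1" by (simp add: add_ac)
  then have "partial i (partial j f) (p + a' *\<^sub>R axis j 1 + b' *\<^sub>R axis i 1)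
      = partial j (partial i f) (p + a *\<^sub>R axis i 1 + b *\<^sub>R axis j 1)"
    using ab(5) ab'(5) h(1) by (simp add: algebra_simps)
  moreover have "\<bar>partial i (partial j f) (p + a' *\<^sub>R axis j 1 + b' *\<^sub>R axis i 1)
    - partial i (partial j f) p\<bar> < e"
    using dd[of a' b' j i] ab' h by (intro d(3)) auto
  moreover have "\<bar>partial j (partial i f) (p + a *\<^sub>R axis i 1 + b *\<^sub>R axis j 1)
    - partial j (partial i f) p\<bar> < e"
    using dd[of a b i j] ab h by (intro d(4)) auto
  ultimately show False unfolding e_def by (auto simp: abs_if field_simps split: if_splits)
qed

section \<open>Inverse matrices and their smooth dependence on parameters\<close>

lemma invertible_inverses:
  assumes "invertible (A :: real^'m::finite^'m)"
  shows "A ** matrix_inv A = mat 1" "matrix_inv A ** A = mat 1"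
proof -
  have "\<exists>B. A ** B = mat 1 \<and> B ** A = mat 1" using assms by (auto simp: invertible_def)
  from someI_ex[OF this] show "A ** matrix_inv A = mat 1" "matrix_inv A ** A = mat 1"
    unfolding matrix_inv_def by auto
qed

lemma matrix_inv_eqI:
  assumes "A ** B = mat 1" shows "matrix_inv (A :: real^'m::finite^'m) = B"
proof -
  have "B ** A = mat 1" using assms matrix_left_right_inverse by blast
  then have "invertible A" using assms by (auto simp: invertible_def)
  then have "matrix_inv A = matrix_inv A ** (A ** B)" using assms by simp
  also have "\<dots> = B" using invertible_inverses[OF \<open>invertible A\<close>] by (simp add: matrix_mul_assoc)
  finally show ?thesis .
qed

text \<open>Cramer's rule exhibits the entries of the inverse as quotients of polynomials in the
  entries, hence as smooth functions; \<open>matrix_inv\<close> by itself is only a choice.\<close>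

lemma matrix_inv_cramer:
  assumes "invertible (A :: real^'m::finite^'m)"
  shows "matrix_inv A $ k $ l = det (\<chi> i j. if j = k then axis l 1 $ i else A $ i $ j) / det A"
proof -
  have d: "det A \<noteq> 0" using assms invertible_det_nz by blast
  have "A *v (matrix_inv A *v axis l 1) = axis l 1"
    using invertible_inverses[OF assms] by (simp add: matrix_vector_mul_assoc)
  then have "matrix_inv A *v axis l 1 = (\<chi> k. det (\<chi> i j. if j
    = k then axis l 1 $ i else A $ i $ j) / det A)"
    using cramer[OF d] by blast
  then have "(matrix_inv A *v axis l 1) $ k = det (\<chi> i j. if j
    = k then axis l 1 $ i else A $ i $ j) / det A"
    by simp
  moreover have "(matrix_inv A *v axis l 1) $ k = matrix_inv A $ k $ l"
    by (simp add: matrix_vector_mult_basis column_def)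
  ultimately show ?thesis by simp
qed

lemma smooth_on_det:
  assumes "open S" "\<And>i j. smooth_on S (\<lambda>q. A q $ i $ j)"
  shows "smooth_on S (\<lambda>q. det (A q :: real^'k::finite^'k))"
  unfolding det_def using assms by (intro smooth_intros) auto

lemma smooth_on_matrix_inv:
  fixes A :: "real^'m::finite \<Rightarrow> real^'k::finite^'k"
  assumes "open S" "\<And>i j. smooth_on S (\<lambda>q. A q $ i $ j)" "\<And>q. q \<in> S \<Longrightarrow> invertible (A q)"
  shows "smooth_on S (\<lambda>q. matrix_inv (A q) $ k $ l)"
proof (rule smooth_on_cong[OF assms(1)])
  show "det (\<chi> i j. if j = k then axis l 1 $ i else A q $ i $ j) / det (A q) = matrix_inv (A q) $ k $ l"
    if "q \<in> S" for q using matrix_inv_cramer[OF assms(3)[OF that]] by simp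
  have "smooth_on S (\<lambda>q. if j = k then axis l 1 $ i else A q $ i $ j)" for i j
    using assms(2) by (cases "j = k") auto
  then show "smooth_on S (\<lambda>q. det (\<chi> i j. if j = k then axis l 1 $ i else A q $ i $ j) / det (A q))"
    using assms(1,2) invertible_det_nz[THEN iffD1, OF assms(3)]
      by (intro smooth_on_divide smooth_on_det) auto
qed

lemma matrix_inv_contract:
  assumes "invertible (A :: real^'m::finite^'m)"
  shows "(\<Sum>l\<in>UNIV. matrix_inv A $ i $ l * A $ l $ j) = (if i = j then 1 else 0)"
    "(\<Sum>l\<in>UNIV. A $ i $ l * matrix_inv A $ l $ j) = (if i = j then 1 else 0)"
  using invertible_inverses[OF assms]
  by (auto simp: matrix_matrix_mult_def mat_def vec_eq_iff)

section \<open>Ambient coordinates\<close>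

lemma sum_amb_coord:
  "(\<Sum>i\<in>(UNIV :: 'm::finite amb_coord set). f i) = f Ct + f Crho + (\<Sum>a\<in>UNIV. f (Cm a))"
proof -
  have U: "(UNIV :: 'm amb_coord set) = insert Ct (insert Crho (range Cm))"
    using amb_coord.exhaust by auto
  have "(\<Sum>i\<in>range Cm. f i) = (\<Sum>a\<in>UNIV. f (Cm a))"
    by (subst sum.reindex) (auto simp: inj_on_def)
  then show ?thesis by (subst U) (subst sum.insert; auto simp: algebra_simps)+
qed

lemma sum_pp_coord:
  "(\<Sum>i\<in>(UNIV :: 'n::finite pp_coord set). f i) = f Cu + f Cv + (\<Sum>a\<in>UNIV. f (Cx a))"
proof -
  have U: "(UNIV :: 'n pp_coord set) = insert Cu (insert Cv (range Cx))"
    using pp_coord.exhaust by auto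
  have "(\<Sum>i\<in>range Cx. f i) = (\<Sum>a\<in>UNIV. f (Cx a))"
    by (subst sum.reindex) (auto simp: inj_on_def)
  then show ?thesis by (subst U) (subst sum.insert; auto simp: algebra_simps)+
qed

lemma amb_point_nth [simp]:
  "amb_point t x \<rho> $ Ct = t" "amb_point t x \<rho> $ Crho = \<rho>" "amb_point t x \<rho> $ Cm a = x $ a"
  by (auto simp: amb_point_def)

lemma base_point_amb_point [simp]: "base_point (amb_point t x \<rho>) = x"
  by (simp add: base_point_def vec_eq_iff)

lemma amb_point_base_point [simp]: "amb_point (P $ Ct) (base_point P) (P $ Crho) = P"
  by (auto simp: vec_eq_iff amb_point_def base_point_def split: amb_coord.split)

lemma base_point_line [simp]:
  "base_point (P + s *\<^sub>R axis (Cm a) 1) = base_point P + s *\<^sub>R axis a 1"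
  "base_point (P + s *\<^sub>R axis Ct 1) = base_point P"
  "base_point (P + s *\<^sub>R axis Crho 1) = base_point P"
  by (auto simp: base_point_def vec_eq_iff axis_def)

lemma amb_point_line:
  "amb_point t x \<rho> + s *\<^sub>R axis (Cm a) 1 = amb_point t (x + s *\<^sub>R axis a 1) \<rho>"
  "amb_point t x \<rho> + s *\<^sub>R axis Ct 1 = amb_point (t + s) x \<rho>"
  "amb_point t x \<rho> + s *\<^sub>R axis Crho 1 = amb_point t x (\<rho> + s)"
  by (auto simp: amb_point_def vec_eq_iff axis_def split: amb_coord.split)

lemma bounded_linear_base_point: "bounded_linear base_point"
proof -
  have "linear (base_point :: real^('m amb_coord) \<Rightarrow> real^'m)"
    by (intro linearI) (auto simp: base_point_def vec_eq_iff)
  then show ?thesis by (simp add: linear_conv_bounded_linear)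
qed

lemma continuous_on_base_point [continuous_intros]: "continuous_on S base_point"
  using bounded_linear_base_point linear_continuous_on by blast

lemma continuous_on_amb_point [continuous_intros]:
  assumes "continuous_on S t" "continuous_on S x" "continuous_on S r"
  shows "continuous_on S (\<lambda>y. amb_point (t y) (x y) (r y))"
  unfolding amb_point_def
proof (rule continuous_on_vec_lambda)
  fix i :: "'b amb_coord"
  show "continuous_on S (\<lambda>y. case i of Ct \<Rightarrow> t y | Cm a \<Rightarrow> x y $ a | Crho \<Rightarrow> r y)"
    using assms by (cases i) (auto intro!: continuous_intros)
qed

lemma open_base_point_vimage: "open M \<Longrightarrow> open {P. base_point P \<in> M}"
  using open_vimage[of M base_point] continuous_on_base_point[of UNIV] by (simp add: vimage_def)

lemma open_amb_domain: assumes "open M" shows "open (amb_domain M \<epsilon>)"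
proof -
  have "amb_domain M \<epsilon> = {P. 0 < P $ Ct} \<inter> {P. base_point P \<in> M} \<inter> {P. \<bar>P $ Crho\<bar> < \<epsilon>}"
    by (auto simp: amb_domain_def)
  moreover have "open {P :: real^('a amb_coord). 0 < P $ Ct}"
    "open {P :: real^('a amb_coord). \<bar>P $ Crho\<bar> < \<epsilon>}"
    by (intro open_Collect_less continuous_intros)+
  ultimately show ?thesis using open_base_point_vimage[OF assms] by auto
qed

lemma open_amb_domain_rho: assumes "open M" shows "open (amb_domain M \<epsilon> \<inter> {P. P $ Crho \<noteq> 0})"
  by (intro open_Int open_amb_domain assms open_Collect_neq continuous_intros)

lemma partial_base_point:
  "partial (Cm a) (\<lambda>P. f (base_point P)) = (\<lambda>P. partial a f (base_point P))"
  "partial Ct (\<lambda>P. f (base_point P)) = (\<lambda>_. 0)"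
  "partial Crho (\<lambda>P. f (base_point P)) = (\<lambda>_. 0)"
  by (auto simp: partial_def)

lemma smooth_on_base_point:
  assumes "open M" "smooth_on M f"
  shows "smooth_on {P. base_point P \<in> M} (\<lambda>P. f (base_point P))"
proof -
  have d: "(\<lambda>P. f (base_point P)) differentiable_on {P. base_point P \<in> M}"
    if "f differentiable_on M" for f :: "real^'a \<Rightarrow> real"
    unfolding differentiable_on_eq_differentiable_at[OF open_base_point_vimage[OF assms(1)]]
  proof (intro ballI)
    fix P assume "P \<in> {P. base_point P \<in> M}"
    with that assms(1) have "f differentiable (at (base_point P))"
      by (simp add: differentiable_on_eq_differentiable_at)
    from differentiable_chain_at[OF bounded_linear_imp_differentiable[OF bounded_linear_base_point]
      this]
    show "(\<lambda>P. f (base_point P)) differentiable (at P)" by (simp add: o_def)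
  qed
  have "diff_upto n {P. base_point P \<in> M} (\<lambda>P. f (base_point P))" if "diff_upto n M f" for n
    using that
  proof (induction n arbitrary: f)
    case (Suc n)
    have "diff_upto n {P. base_point P \<in> M} (partial i (\<lambda>P. f (base_point P)))" for i
      using Suc by (cases i) (auto simp: partial_base_point diff_upto_const)
    then show ?case using Suc.prems d by simp
  qed (use d in simp)
  then show ?thesis using assms(2) by (simp add: smooth_on_iff_diff_upto)
qed

lemma partial_amb_point:
  "partial a (\<lambda>x. F (amb_point t x \<rho>)) = (\<lambda>x. partial (Cm a) F (amb_point t x \<rho>))"
  by (auto simp: partial_def amb_point_line)

lemma has_real_derivative_rho:
  assumes "F differentiable (at (amb_point t x \<rho>))"
  shows "((\<lambda>r. F (amb_point t x r)) has_real_derivative partial Crho F (amb_point t x \<rho>)) (at \<rho>)"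
  using has_real_derivative_partial[of F "amb_point t x 0" \<rho> Crho] assms by (simp add: amb_point_line)

lemma amb_point_differentiable: "(\<lambda>x. amb_point t x \<rho>) differentiable (at x)"
proof -
  have "linear (\<lambda>x :: real^'a. amb_point 0 x 0)"
    by (intro linearI) (auto simp: amb_point_def vec_eq_iff split: amb_coord.split)
  then have "(\<lambda>x :: real^'a. amb_point t 0 \<rho> + amb_point 0 x 0) differentiable (at x)"
    by (intro differentiable_add differentiable_const linear_imp_differentiable)
  moreover have "(\<lambda>x :: real^'a. amb_point t 0 \<rho> + amb_point 0 x 0) = (\<lambda>x. amb_point t x \<rho>)"
    by (auto simp: amb_point_def vec_eq_iff split: amb_coord.split)
  ultimately show ?thesis by (rule subst[rotated])
qed

lemma smooth_on_amb_point:
  assumes "open D" "smooth_on D F" "\<And>x. x \<in> M \<Longrightarrow> amb_point t x \<rho> \<in> D" "open M"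
  shows "smooth_on M (\<lambda>x. F (amb_point t x \<rho>))"
proof -
  have d: "(\<lambda>x. F (amb_point t x \<rho>)) differentiable_on M"
    if "F differentiable_on D" for F :: "real^('a amb_coord) \<Rightarrow> real"
    unfolding differentiable_on_eq_differentiable_at[OF assms(4)]
  proof (intro ballI)
    fix x assume "x \<in> M"
    with that assms(1,3) have "F differentiable (at (amb_point t x \<rho>))"
      by (simp add: differentiable_on_eq_differentiable_at)
    from differentiable_chain_at[OF amb_point_differentiable this]
    show "(\<lambda>x. F (amb_point t x \<rho>)) differentiable (at x)" by (simp add: o_def)
  qed
  have "diff_upto n M (\<lambda>x. F (amb_point t x \<rho>))" if "diff_upto n D F" for n
    using that
  proof (induction n arbitrary: F)
    case (Suc n)
    then show ?case using d by (simp add: partial_amb_point)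
  qed (use d in simp)
  then show ?thesis using assms(2) by (simp add: smooth_on_iff_diff_upto)
qed

section \<open>Curvature of metrics in normal form\<close>

lemma partial_line_invariant:
  assumes "\<And>P s. F (P + s *\<^sub>R axis i 1) = F P"
  shows "partial j F (P + s *\<^sub>R axis i 1) = partial j F P"
proof -
  have "F (P + s *\<^sub>R axis i 1 + r *\<^sub>R axis j 1) = F (P + r *\<^sub>R axis j 1)" for r
    using assms[of "P + r *\<^sub>R axis j 1" s] by (simp add: add_ac)
  then show ?thesis by (simp add: partial_def)
qed

lemma partial_line_zero:
  assumes "\<And>P s. F (P + s *\<^sub>R axis i 1) = F P"
  shows "partial i F = (\<lambda>_. 0)"
  by (rule ext) (simp add: partial_def assms)

lemma if_zero_simps:
  "x * (if b then y else 0) = (if b then x * y else (0::real))"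
  "(if b then y else 0) * x = (if b then y * x else (0::real))"
  "(if b then y else 0) / x = (if b then y / x else (0::real))"
  "- (if b then y else 0) = (if b then - y else (0::real))"
  by auto

text \<open>The open set \<open>S\<close> is kept arbitrary because the same curvature formulas are
  needed on a full \<open>amb_domain\<close> and on its part \<rho> \<noteq> 0, where terms of
  half-integral order are smooth.\<close>

locale normal_form =
  fixes g :: "'m::finite metric" and h :: "real^'m \<Rightarrow> real \<Rightarrow> real^'m^'m"
    and S :: "(real^('m amb_coord)) set"
  assumes open_S: "open S"
    and t_pos: "P \<in> S \<Longrightarrow> 0 < P $ Ct"
    and smooth_G: "smooth_on S (\<lambda>P. (g (base_point P) + h (base_point P) (P $ Crho)) $ a $ b)"
    and symmetric_G: "P \<in> S \<Longrightarrow> transpose (g (base_point P) + h (base_point P) (P $ Crho))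
        = g (base_point P) + h (base_point P) (P $ Crho)"
    and invertible_G: "P \<in> S \<Longrightarrow> invertible (g (base_point P) + h (base_point P) (P $ Crho))"
begin

definition G :: "'m \<Rightarrow> 'm \<Rightarrow> real^('m amb_coord) \<Rightarrow> real" where
  "G a b P = (g (base_point P) + h (base_point P) (P $ Crho)) $ a $ b"

definition Ginv :: "'m \<Rightarrow> 'm \<Rightarrow> real^('m amb_coord) \<Rightarrow> real" where
  "Ginv a b P = matrix_inv (g (base_point P) + h (base_point P) (P $ Crho)) $ a $ b"

text \<open>The endomorphism G^(-1) G', the prime being the derivative in \<rho>. Its trace is tr
  G', and products with it form the quadratic terms of the Ricci tensor.\<close>

definition W :: "'m \<Rightarrow> 'm \<Rightarrow> real^('m amb_coord) \<Rightarrow> real" where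
  "W a b P = (\<Sum>c\<in>UNIV. Ginv a c P * partial Crho (G c b) P)"

definition Gam :: "'m \<Rightarrow> 'm \<Rightarrow> 'm \<Rightarrow> real^('m amb_coord) \<Rightarrow> real" where
  "Gam c a b P = (\<Sum>d\<in>UNIV. Ginv c d P *
     (partial (Cm a) (G b d) P + partial (Cm b) (G a d) P - partial (Cm d) (G a b) P)) / 2"

text \<open>The Ricci tensor of the slice metric on the base at fixed \<rho>: only tangential
  derivatives occur.\<close>

definition base_ricci :: "'m \<Rightarrow> 'm \<Rightarrow> real^('m amb_coord) \<Rightarrow> real" where
  "base_ricci a b P = (\<Sum>c\<in>UNIV. partial (Cm c) (Gam c a b) P - partial (Cm b) (Gam c a c) P
     + (\<Sum>d\<in>UNIV. Gam c c d P * Gam d a b P - Gam c b d P * Gam d a c P))"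

text \<open>The Christoffel symbols of \<open>amb g h\<close> in closed form, by
  \<open>christoffel_amb\<close>. Each case returns a function of the point, so that
  \<open>partial\<close> can be evaluated by rewriting.\<close>

definition chr :: "'m amb_coord \<Rightarrow> 'm amb_coord \<Rightarrow> 'm amb_coord \<Rightarrow> real^('m amb_coord) \<Rightarrow> real" where
  "chr k i j = (case k of
      Ct \<Rightarrow> (case (i, j) of (Cm a, Cm b) \<Rightarrow> (\<lambda>P. - (P $ Ct * partial Crho (G a b) P / 2)) | _ \<Rightarrow> (\<lambda>_. 0))
    | Crho \<Rightarrow> (case (i, j) of (Cm a, Cm b) \<Rightarrow> (\<lambda>P. P $ Crho * partial Crho (G a b) P - G a b P)
        | (Ct, Crho) \<Rightarrow> (\<lambda>P. inverse (P $ Ct)) | (Crho, Ct) \<Rightarrow> (\<lambda>P. inverse (P $ Ct)) | _ \<Rightarrow> (\<lambda>_. 0))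
    | Cm c \<Rightarrow> (case (i, j) of (Cm a, Cm b) \<Rightarrow> Gam c a b
        | (Ct, Cm b) \<Rightarrow> (\<lambda>P. if c = b then inverse (P $ Ct) else 0)
        | (Cm b, Ct) \<Rightarrow> (\<lambda>P. if c = b then inverse (P $ Ct) else 0)
        | (Crho, Cm b) \<Rightarrow> (\<lambda>P. W c b P / 2) | (Cm b, Crho) \<Rightarrow> (\<lambda>P. W c b P / 2)
        | _ \<Rightarrow> (\<lambda>_. 0)))"

lemma smooth_on_G: "smooth_on S (G a b)"
  using smooth_G by (simp add: G_def[abs_def])

lemma smooth_on_Ginv: "smooth_on S (Ginv a b)"
  unfolding Ginv_def[abs_def] by (intro smooth_on_matrix_inv open_S invertible_G smooth_G)

lemma smooth_on_W: "smooth_on S (W a b)"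
  unfolding W_def[abs_def] by (intro smooth_intros open_S smooth_on_G smooth_on_Ginv)

lemma smooth_on_Gam: "smooth_on S (Gam a b c)"
  unfolding Gam_def[abs_def] by (intro smooth_intros open_S smooth_on_G smooth_on_Ginv) auto

lemma G_sym: "P \<in> S \<Longrightarrow> G a b P = G b a P"
  using arg_cong[OF symmetric_G, of P "\<lambda>X. X $ b $ a"] by (simp add: G_def transpose_def)

lemma partial_G_sym: "P \<in> S \<Longrightarrow> partial i (G a b) P = partial i (G b a) P"
  by (rule partial_cong[OF open_S]) (auto intro: G_sym)

lemma Gam_sym: "P \<in> S \<Longrightarrow> Gam c a b P = Gam c b a P"
  by (simp add: Gam_def partial_G_sym[of P _ a b] add.commute)

lemma contract:
  assumes "P \<in> S"
  shows "(\<Sum>c\<in>UNIV. Ginv a c P * G c b P) = (if a = b then 1 else 0)"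
    "(\<Sum>c\<in>UNIV. G a c P * Ginv c b P) = (if a = b then 1 else 0)"
  using matrix_inv_contract[OF invertible_G[OF assms]] by (simp_all add: G_def Ginv_def)

text \<open>Lowering the index of G^(-1) G' recovers G'. This turns the summand -G of
  \<open>chr Crho (Cm a) (Cm b)\<close>, once contracted with \<open>W\<close>, into a first-order
  term.\<close>

lemma G_W:
  assumes "P \<in> S"
  shows "(\<Sum>c\<in>UNIV. G b c P * W c a P) = partial Crho (G b a) P"
proof -
  have "(\<Sum>c\<in>UNIV. G b c P * W c a P)
      = (\<Sum>c\<in>UNIV. \<Sum>d\<in>UNIV. G b c P * Ginv c d P * partial Crho (G d a) P)"
    by (simp add: W_def sum_distrib_left mult.assoc)
  also have "\<dots> = (\<Sum>d\<in>UNIV. (\<Sum>c\<in>UNIV. G b c P * Ginv c d P) * partial Crho (G d a) P)"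
    by (subst sum.swap) (simp add: sum_distrib_right)
  finally show ?thesis by (simp add: contract[OF assms] if_distrib[of "\<lambda>x. x * _"] cong: if_cong)
qed

lemma t_invariant:
  "G a b (P + s *\<^sub>R axis Ct 1) = G a b P" "Ginv a b (P + s *\<^sub>R axis Ct 1) = Ginv a b P"
proof -
  have "(P + s *\<^sub>R axis Ct 1) $ Crho = P $ Crho" by (simp add: axis_def del: vector_add_component)
    (simp add: axis_def)
  then show "G a b (P + s *\<^sub>R axis Ct 1) = G a b P" "Ginv a b (P + s *\<^sub>R axis Ct 1) = Ginv a b P"
    by (simp_all only: G_def Ginv_def base_point_line)
qed

lemma t_invariant':
  "partial i (G a b) (P + s *\<^sub>R axis Ct 1) = partial i (G a b) P"
  "W a b (P + s *\<^sub>R axis Ct 1) = W a b P" "Gam c a b (P + s *\<^sub>R axis Ct 1) = Gam c a b P"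
  by (simp_all add: W_def Gam_def t_invariant partial_line_invariant)

lemma partial_Ct:
  "partial Ct (G a b) = (\<lambda>_. 0)" "partial Ct (partial i (G a b)) = (\<lambda>_. 0)"
  "partial Ct (W a b) = (\<lambda>_. 0)" "partial Ct (Gam c a b) = (\<lambda>_. 0)"
  by (intro partial_line_zero t_invariant t_invariant')+

lemma amb_nth:
  "amb g h P $ Ct $ Ct = 2 * P $ Crho" "amb g h P $ Ct $ Crho = P $ Ct" "amb g h P $ Crho $ Ct = P $ Ct"
  "amb g h P $ Cm a $ Cm b = (P $ Ct)\<^sup>2 * G a b P"
  "amb g h P $ Crho $ Crho = 0" "amb g h P $ Ct $ Cm b = 0" "amb g h P $ Cm b $ Ct = 0"
  "amb g h P $ Crho $ Cm b = 0" "amb g h P $ Cm b $ Crho = 0"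
  by (auto simp: amb_def G_def)

text \<open>The block with rows (2 \<rho>, t) and (t, 0) in the coordinates t and \<rho> decouples
  from the tangential block t^2 G, so each is inverted separately.\<close>

definition amb_inv :: "real^('m amb_coord) \<Rightarrow> real^('m amb_coord)^('m amb_coord)" where
  "amb_inv P = (\<chi> i j. case (i, j) of
       (Crho, Crho) \<Rightarrow> - 2 * P $ Crho / (P $ Ct)\<^sup>2
     | (Ct, Crho) \<Rightarrow> inverse (P $ Ct)
     | (Crho, Ct) \<Rightarrow> inverse (P $ Ct)
     | (Cm a, Cm b) \<Rightarrow> Ginv a b P / (P $ Ct)\<^sup>2
     | _ \<Rightarrow> 0)"

lemma matrix_inv_amb:
  assumes "P \<in> S" shows "matrix_inv (amb g h P) = amb_inv P"
proof (rule matrix_inv_eqI)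
  have t: "P $ Ct \<noteq> 0" using t_pos[OF assms] by simp
  have "(amb g h P ** amb_inv P) $ i $ j = mat 1 $ i $ j" for i j
    using t contract(2)[OF assms]
    by (cases i; cases j)
      (auto simp: matrix_matrix_mult_def mat_def sum_amb_coord amb_nth amb_inv_def field_simps
        power2_eq_square)
  then show "amb g h P ** amb_inv P = mat 1" by (simp add: vec_eq_iff)
qed

lemma differentiable_G: "P \<in> S \<Longrightarrow> G a b differentiable (at P)"
  by (rule smooth_on_differentiable[OF smooth_on_G open_S])

lemma differentiable_dG: "P \<in> S \<Longrightarrow> partial i (G a b) differentiable (at P)"
  by (rule smooth_on_differentiable[OF smooth_on_partial[OF smooth_on_G] open_S])

lemma differentiable_W: "P \<in> S \<Longrightarrow> W a b differentiable (at P)"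
  by (rule smooth_on_differentiable[OF smooth_on_W open_S])

lemma differentiable_coord: "(\<lambda>q :: real^'k::finite. q $ i) differentiable (at P)"
  by (rule smooth_on_differentiable[OF smooth_on_coord open_UNIV]) simp

lemma partial_amb:
  assumes "P \<in> S"
  shows "partial k (\<lambda>q. amb g h q $ i $ j) P = (case (i, j) of
       (Ct, Ct) \<Rightarrow> (if k = Crho then 2 else 0)
     | (Ct, Crho) \<Rightarrow> (if k = Ct then 1 else 0)
     | (Crho, Ct) \<Rightarrow> (if k = Ct then 1 else 0)
     | (Cm a, Cm b) \<Rightarrow> (if k = Ct then 2 * P $ Ct * G a b P else (P $ Ct)\<^sup>2 * partial k (G a b) P)
     | _ \<Rightarrow> 0)"
proof -
  have "partial k (\<lambda>q. (q $ Ct * q $ Ct) * G a b q) P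
      = (if k = Ct then 2 * P $ Ct * G a b P else (P $ Ct)\<^sup>2 * partial k (G a b) P)" for a b
    using assms partial_Ct
    by (auto simp: partial_mult partial_coord differentiable_coord differentiable_G
        differentiable_mult power2_eq_square)
  then show ?thesis
    by (cases i; cases j)
      (auto simp: amb_nth partial_cmult[OF differentiable_coord] partial_coord power2_eq_square)
qed

lemma christoffel_amb:
  assumes P: "P \<in> S"
  shows "christoffel (amb g h) k i j P = chr k i j P"
proof -
  have t: "P $ Ct \<noteq> 0" using t_pos[OF assms] by simp
  have 1: "(\<Sum>d\<in>UNIV. Ginv c d P / (P $ Ct)\<^sup>2 * ((P $ Ct)\<^sup>2 * x d))
    = (\<Sum>d\<in>UNIV. Ginv c d P * x d)" for c x
    using t by (intro sum.cong) auto
  have 2: "(\<Sum>d\<in>UNIV. Ginv c d P / (P $ Ct)\<^sup>2 * (2 * P $ Ct * G b d P)) / 2 = (if c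
    = b then inverse (P $ Ct) else 0)" for c b
  proof -
    have "(\<Sum>d\<in>UNIV. Ginv c d P / (P $ Ct)\<^sup>2 * (2 * P $ Ct * G b d P))
        = (\<Sum>d\<in>UNIV. (2 / P $ Ct) * (Ginv c d P * G d b P))"
      using t by (intro sum.cong) (auto simp: field_simps power2_eq_square G_sym[OF P, of b])
    also have "\<dots> = (2 / P $ Ct) * (if c = b then 1 else 0)"
      by (simp only: sum_distrib_left[symmetric] contract[OF P])
    finally show ?thesis by (simp add: field_simps)
  qed
  show ?thesis
  proof (cases k)
    case Ct
    then show ?thesis using t P
      by (cases i; cases j)
        (auto simp: christoffel_def matrix_inv_amb partial_amb chr_def sum_amb_coord amb_inv_def
          field_simps power2_eq_square)
  next
    case Crho
    then show ?thesis using t P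
      by (cases i; cases j)
        (auto simp: christoffel_def matrix_inv_amb partial_amb chr_def sum_amb_coord amb_inv_def
          field_simps power2_eq_square)
  next
    case (Cm c)
    have 3: "(\<Sum>d\<in>UNIV. Ginv c d P / (P $ Ct)\<^sup>2 * ((P $ Ct)\<^sup>2 * partial Crho (G b d) P)) / 2
      = W c b P / 2" for b
      unfolding 1 by (simp add: W_def partial_G_sym[OF P, of _ b])
    have 4: "(\<Sum>d\<in>UNIV. Ginv c d P / (P $ Ct)\<^sup>2 *
         ((P $ Ct)\<^sup>2 * partial (Cm a) (G b d) P + (P $ Ct)\<^sup>2 * partial (Cm b) (G a d) P
           - (P $ Ct)\<^sup>2 * partial (Cm d) (G a b) P)) / 2
        = Gam c a b P" for a b
      unfolding distrib_left[symmetric] right_diff_distrib[symmetric] 1 by (simp add: Gam_def)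
    note [simp] = christoffel_def matrix_inv_amb[OF P] partial_amb[OF P] chr_def sum_amb_coord
      amb_inv_def
    show ?thesis using Cm 2 3 4 by (cases i; cases j) simp_all
  qed
qed

lemma ricci_amb:
  assumes "P \<in> S"
  shows "ricci (amb g h) P $ i $ j = (\<Sum>k\<in>UNIV.
      partial k (chr k i j) P - partial j (chr k i k) P
      + (\<Sum>l\<in>UNIV. chr k k l P * chr l i j P - chr k j l P * chr l i k P))"
proof -
  have "partial k (christoffel (amb g h) k' i' j') P = partial k (chr k' i' j') P" for k k' i' j'
    by (rule partial_cong[OF open_S assms christoffel_amb])
  then show ?thesis unfolding ricci_def using christoffel_amb[OF assms] by simp
qed

lemma partial_inverse_t:
  assumes "P \<in> S"
  shows "partial k (\<lambda>P. inverse (P $ Ct)) P = (if k = Ct then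
    - inverse (P $ Ct) * inverse (P $ Ct) else 0)"
  using t_pos[OF assms] by (simp add: partial_inverse[OF differentiable_coord] partial_coord)

lemma partial_chr:
  assumes "P \<in> S"
  shows "partial Ct (\<lambda>P. - (P $ Ct * partial Crho (G a b) P / 2)) P = - (partial Crho (G a b) P / 2)"
    "partial Crho (\<lambda>P. P $ Crho * partial Crho (G a b) P - G a b P) P
      = P $ Crho * partial Crho (partial Crho (G a b)) P"
    "partial i (\<lambda>P. W c d P / 2) P = partial i (W c d) P / 2"
    "partial k (\<lambda>P. if c = d then inverse (P $ Ct) else 0) P
      = (if c = d \<and> k = Ct then - (inverse (P $ Ct) * inverse (P $ Ct)) else 0)"
proof -
  note [simp] = differentiable_coord differentiable_dG[OF assms] differentiable_G[OF assms]
    differentiable_W[OF assms]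
  have "partial Ct (\<lambda>P. (-1/2) * (P $ Ct * partial Crho (G a b) P)) P = (-1/2) * partial Crho (G a b) P"
    by (subst partial_cmult) (auto simp: partial_mult partial_coord partial_Ct intro!:
      differentiable_mult)
  then show "partial Ct (\<lambda>P. - (P $ Ct * partial Crho (G a b) P / 2)) P
    = - (partial Crho (G a b) P / 2)"
    by simp
  show "partial Crho (\<lambda>P. P $ Crho * partial Crho (G a b) P - G a b P) P
    = P $ Crho * partial Crho (partial Crho (G a b)) P"
    by (subst partial_diff) (auto simp: partial_mult partial_coord intro!: differentiable_mult)
  show "partial i (\<lambda>P. W c d P / 2) P = partial i (W c d) P / 2"
    using partial_cmult[of "W c d" P i "1/2"] by simp
  show "partial k (\<lambda>P. if c = d then inverse (P $ Ct) else 0) P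
      = (if c = d \<and> k = Ct then - (inverse (P $ Ct) * inverse (P $ Ct)) else 0)"
    using partial_inverse_t[OF assms] by (cases "c = d") simp_all
qed

lemmas ricci_simps = sum_amb_coord chr_def partial_chr partial_inverse_t
  sum.distrib sum_subtractf partial_Ct if_zero_simps sum_negf

text \<open>Geometrically, the Euler field t d/dt has the identity as covariant derivative, so the
  curvature annihilates it. In coordinates the nonzero symbols with a lower index \<open>Ct\<close>
  all equal 1/t and their contributions cancel.\<close>

lemma ricci_Ct:
  assumes P: "P \<in> S"
  shows "ricci (amb g h) P $ Ct $ i = 0" "ricci (amb g h) P $ i $ Ct = 0"
proof -
  show "ricci (amb g h) P $ Ct $ i = 0"
    by (cases i) (simp_all add: P ricci_amb ricci_simps Gam_sym[OF P] mult.commute cong: if_cong)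
  show "ricci (amb g h) P $ i $ Ct = 0"
    by (cases i) (simp_all add: P ricci_amb ricci_simps Gam_sym[OF P] mult.commute cong: if_cong)
qed

lemma ricci_Crho_Crho:
  assumes P: "P \<in> S"
  shows "ricci (amb g h) P $ Crho $ Crho =
    - (\<Sum>c\<in>UNIV. partial Crho (W c c) P / 2) - (\<Sum>c\<in>UNIV. \<Sum>d\<in>UNIV. W c d P * W d c P / 4)"
  by (simp add: P ricci_amb ricci_simps)

text \<open>Symmetry of \<open>ricci\<close> is not visible from its definition, so the mixed
  component is computed in both orders.\<close>

lemma ricci_Cm_Crho:
  assumes P: "P \<in> S"
  shows "ricci (amb g h) P $ Cm a $ Crho =
    (\<Sum>c\<in>UNIV. partial (Cm c) (W c a) P / 2 - partial Crho (Gam c a c) P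
      + (\<Sum>d\<in>UNIV. Gam c c d P * W d a P / 2 - W c d P * Gam d a c P / 2))"
  by (simp add: P ricci_amb ricci_simps)

lemma ricci_Crho_Cm:
  assumes P: "P \<in> S"
  shows "ricci (amb g h) P $ Crho $ Cm a =
    (\<Sum>c\<in>UNIV. partial (Cm c) (W c a) P / 2 - partial (Cm a) (W c c) P / 2
      + (\<Sum>d\<in>UNIV. Gam c c d P * W d a P / 2 - Gam c a d P * W d c P / 2))"
  by (simp add: P ricci_amb ricci_simps)

text \<open>The equation of the overview with its quadratic terms spelled out. The dimension enters
  through the trace n/t of \<open>chr (Cm c) (Cm c) Ct\<close>.\<close>

lemma ricci_Cm_Cm:
  assumes P: "P \<in> S"
  shows "ricci (amb g h) P $ Cm a $ Cm b =
    P $ Crho * partial Crho (partial Crho (G a b)) P + (1 - real CARD('m) / 2) * partial Crho (G a b) P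
    - (\<Sum>c\<in>UNIV. W c c P) * G a b P / 2
    + P $ Crho / 2 * ((\<Sum>c\<in>UNIV. W c c P) * partial Crho (G a b) P
       - (\<Sum>c\<in>UNIV. partial Crho (G b c) P * W c a P) - (\<Sum>c\<in>UNIV. W c b P * partial Crho (G a c) P))
    + base_ricci a b P"
proof -
  have 1: "(\<Sum>c\<in>UNIV. (P $ Crho * partial Crho (G b c) P - G b c P) * W c a P / 2)
     = (P $ Crho * (\<Sum>c\<in>UNIV. partial Crho (G b c) P * W c a P) - partial Crho (G a b) P) / 2" for a b
  proof -
    have "(\<Sum>c\<in>UNIV. (P $ Crho * partial Crho (G b c) P - G b c P) * W c a P / 2)
        = (P $ Crho * (\<Sum>c\<in>UNIV. partial Crho (G b c) P * W c a P) - (\<Sum>c\<in>UNIV. G b c P * W c a P)) / 2"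
      by (simp add: sum_subtractf sum_distrib_left sum_divide_distrib left_diff_distrib
        diff_divide_distrib mult.assoc)
    then show ?thesis using G_W[OF P, of b a] partial_G_sym[OF P, of _ b a] by simp
  qed
  have 2: "(\<Sum>c\<in>UNIV. W c b P * (P $ Crho * partial Crho (G a c) P - G a c P) / 2)
     = (P $ Crho * (\<Sum>c\<in>UNIV. W c b P * partial Crho (G a c) P) - partial Crho (G a b) P) / 2"
    using 1[of a b] partial_G_sym[OF P, of _ b a] by (simp add: mult.commute)
  have 3: "(\<Sum>c\<in>UNIV. W c c P * x / 2) = (\<Sum>c\<in>UNIV. W c c P) * x / 2" for x
    by (simp add: sum_distrib_right sum_divide_distrib)
  \<comment> \<open>Bookkeeping for the coefficient of G': -1/2 from differentiating
    \<open>chr Ct\<close>, -(n+1)/2 from the trace (n+1)/t of the symbols with a lower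
    \<open>Ct\<close>, +1 from the two halves written last, and +1 from facts 1 and 2 together. The
    sum is 1 - n/2.\<close>
  have "ricci (amb g h) P $ Cm a $ Cm b
    = - (partial Crho (G a b) P / 2) + P $ Crho * partial Crho (partial Crho (G a b)) P
      - (real CARD('m) + 1) * partial Crho (G a b) P / 2
      + (\<Sum>c\<in>UNIV. W c c P * (P $ Crho * partial Crho (G a b) P - G a b P) / 2)
      - (\<Sum>c\<in>UNIV. (P $ Crho * partial Crho (G b c) P - G b c P) * W c a P / 2)
      - (\<Sum>c\<in>UNIV. W c b P * (P $ Crho * partial Crho (G a c) P - G a c P) / 2)
      + partial Crho (G a b) P / 2 + partial Crho (G a b) P / 2 + base_ricci a b P"
    using t_pos[OF P]
    by (simp add: P ricci_amb ricci_simps base_ricci_def partial_G_sym[OF P, of _ b a] cong: if_cong)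
      (simp add: field_simps)
  then show ?thesis unfolding 1 2 3 by (simp add: field_simps)
qed

end

section \<open>The ambient curvature of pp-waves\<close>

text \<open>Since \<open>du2\<close> is null, adding \<open>z\<close> times it only replaces the
  potential H by H + z: the uu entry of the inverse stays 0 and just the vv entry changes.\<close>

lemma pp_wave_inverse:
  "(pp_wave H p + z *\<^sub>R du2) ** (\<chi> a b. case (a, b) of (Cu, Cv) \<Rightarrow> 1 | (Cv, Cu) \<Rightarrow> 1 | (Cv, Cv) \<Rightarrow>
    - (H p + z)
      | (Cx i, Cx j) \<Rightarrow> (if i = j then 1 else 0) | _ \<Rightarrow> 0) = mat 1"
proof -
  have "((pp_wave H p + z *\<^sub>R du2) ** (\<chi> a b. case (a, b) of (Cu, Cv) \<Rightarrow> 1 | (Cv, Cu) \<Rightarrow> 1 |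
    (Cv, Cv) \<Rightarrow> - (H p + z)
      | (Cx i, Cx j) \<Rightarrow> (if i = j then 1 else 0) | _ \<Rightarrow> 0)) $ a $ b = mat 1 $ a $ b" for a b
    by (cases a; cases b)
      (auto simp: matrix_matrix_mult_def mat_def sum_pp_coord pp_wave_def du2_def if_zero_simps
        cong: if_cong)
  then show ?thesis by (simp add: vec_eq_iff)
qed

lemma invertible_pp_wave: "invertible (pp_wave H p + z *\<^sub>R du2)"
  using pp_wave_inverse[of H p z] matrix_left_right_inverse unfolding invertible_def by blast

lemma matrix_inv_pp_wave:
  "matrix_inv (pp_wave H p + z *\<^sub>R du2) $ a $ b = (case (a, b) of (Cu, Cv) \<Rightarrow> 1 | (Cv, Cu) \<Rightarrow> 1
      | (Cv, Cv) \<Rightarrow> - (H p + z) | (Cx i, Cx j) \<Rightarrow> (if i = j then 1 else 0) | _ \<Rightarrow> 0)"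
  unfolding matrix_inv_eqI[OF pp_wave_inverse] by simp

lemma transpose_pp_wave: "transpose (pp_wave H p + z *\<^sub>R du2) = pp_wave H p + z *\<^sub>R du2"
proof -
  have "transpose (pp_wave H p + z *\<^sub>R du2) $ a $ b = (pp_wave H p + z *\<^sub>R du2) $ a $ b" for a b
    by (cases a; cases b) (auto simp: transpose_def pp_wave_def du2_def)
  then show ?thesis by (simp add: vec_eq_iff)
qed

text \<open>\<open>indep_v\<close> for an arbitrary index, so that it also expresses independence of
  \<open>Cm Cv\<close> in ambient coordinates. Points agreeing off \<open>v\<close> still do so
  after a common translation, hence the property passes to partial derivatives.\<close>

definition invariant_on :: "'m \<Rightarrow> (real^'m::finite) set \<Rightarrow> (real^'m \<Rightarrow> real) \<Rightarrow> bool" where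
  "invariant_on v S f \<longleftrightarrow> (\<forall>p\<in>S. \<forall>q\<in>S. (\<forall>i. i \<noteq> v \<longrightarrow> p $ i = q $ i) \<longrightarrow> f p = f q)"

lemma invariant_on_partial:
  assumes "open S" "invariant_on v S f"
  shows "invariant_on v S (partial i f)"
  unfolding invariant_on_def
proof (intro ballI impI)
  fix p q assume pq: "p \<in> S" "q \<in> S" "\<forall>i. i \<noteq> v \<longrightarrow> p $ i = q $ i"
  have "eventually (\<lambda>s. p + s *\<^sub>R axis i 1 \<in> S \<and> q + s *\<^sub>R axis i 1 \<in> S) (nhds 0)"
    using eventually_line[OF assms(1) pq(1)] eventually_line[OF assms(1) pq(2)]
      by (rule eventually_conj)
  then have "eventually (\<lambda>s. f (p + s *\<^sub>R axis i 1) = f (q + s *\<^sub>R axis i 1)) (nhds 0)"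
    by eventually_elim (use assms(2) pq(3) in \<open>auto simp: invariant_on_def\<close>)
  then show "partial i f p = partial i f q" unfolding partial_def by (rule deriv_cong_ev) simp
qed

lemma invariant_on_partial_zero:
  assumes "open S" "invariant_on v S f" "p \<in> S"
  shows "partial v f p = 0"
proof (rule partial_zero_of_constant)
  show "eventually (\<lambda>s. f (p + s *\<^sub>R axis v 1) = f p) (nhds 0)"
    using eventually_line[OF assms(1,3), of v]
  proof eventually_elim
    case (elim s)
    have "(p + s *\<^sub>R axis v 1) $ i = p $ i" if "i \<noteq> v" for i using that by (simp add: axis_def)
    then show ?case using assms(2,3) elim unfolding invariant_on_def by blast
  qed
qed

locale pp_normal_form =
  fixes H :: "real^('n::finite pp_coord) \<Rightarrow> real" and \<phi> :: "real^('n pp_coord) \<Rightarrow> real \<Rightarrow> real"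
    and S :: "(real^('n pp_coord amb_coord)) set"
  assumes open_S: "open S"
    and t_pos: "P \<in> S \<Longrightarrow> 0 < P $ Ct"
    and smooth_F: "smooth_on S (\<lambda>P. H (base_point P) + \<phi> (base_point P) (P $ Crho))"
    and invariant_F: "invariant_on (Cm Cv) S (\<lambda>P. H (base_point P) + \<phi> (base_point P) (P $ Crho))"
begin

definition F :: "real^('n pp_coord amb_coord) \<Rightarrow> real" where
  "F P = H (base_point P) + \<phi> (base_point P) (P $ Crho)"

sublocale normal_form "pp_wave H" "\<lambda>x r. \<phi> x r *\<^sub>R du2" S
proof
  show "smooth_on S (\<lambda>P. (pp_wave H (base_point P) + \<phi> (base_point P)
    (P $ Crho) *\<^sub>R du2) $ a $ b)" for a b
    using smooth_F by (cases a; cases b) (auto simp: pp_wave_def du2_def)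
qed (use open_S t_pos transpose_pp_wave invertible_pp_wave in auto)

lemma G_eq: "G a b = (if a = Cu \<and> b = Cu then F else
    (\<lambda>_. if a = Cu \<and> b = Cv \<or> a = Cv \<and> b = Cu \<or> a \<noteq> Cu \<and> a \<noteq> Cv \<and> a = b then 1 else 0))"
proof
  fix P
  have "G a b P = (pp_wave H (base_point P) + \<phi> (base_point P) (P $ Crho) *\<^sub>R du2) $ a $ b"
    by (rule G_def)
  then show "G a b P = (if a = Cu \<and> b = Cu then F else
      (\<lambda>_. if a = Cu \<and> b = Cv \<or> a = Cv \<and> b = Cu \<or> a \<noteq> Cu \<and> a \<noteq> Cv \<and> a = b then 1 else 0)) P"
    by (cases a; cases b) (auto simp: F_def pp_wave_def du2_def)
qed

lemma partial_G: "partial k (G a b) = (if a = Cu \<and> b = Cu then partial k F else (\<lambda>_. 0))"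
  by (simp add: G_eq)

lemma Ginv_eq: "Ginv a b P = (case (a, b) of (Cu, Cv) \<Rightarrow> 1 | (Cv, Cu) \<Rightarrow> 1
      | (Cv, Cv) \<Rightarrow> - F P | (Cx i, Cx j) \<Rightarrow> (if i = j then 1 else 0) | _ \<Rightarrow> 0)"
  unfolding Ginv_def matrix_inv_pp_wave F_def by simp

text \<open>At most one entry, off the diagonal, is nonzero, so \<open>W\<close> is nilpotent and
  trace free. For this reason all traces and quadratic terms of the Ricci formulas
  disappear.\<close>

lemma W_eq: "W a b = (if a = Cv \<and> b = Cu then partial Crho F else (\<lambda>_. 0))"
  by (cases a; cases b) (auto simp: W_def partial_G Ginv_eq sum_pp_coord fun_eq_iff)

lemma invariant: "invariant_on (Cm Cv) S F"
  using invariant_F by (simp add: F_def[abs_def])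

lemma smooth: "smooth_on S F"
  using smooth_F by (simp add: F_def[abs_def])

lemma partial_v: assumes "P \<in> S" shows "partial (Cm Cv) F P = 0" "partial (Cm Cv) (partial i F) P = 0"
  using invariant_on_partial_zero[OF open_S] invariant_on_partial[OF open_S] invariant assms by blast+

text \<open>The symbols after dropping the derivative of \<open>F\<close> in v, which is known to
  vanish on \<open>S\<close> only; hence \<open>Gam_eq\<close> is restricted to
  \<open>S\<close>.\<close>

definition gam :: "'n pp_coord \<Rightarrow> 'n pp_coord \<Rightarrow> 'n pp_coord \<Rightarrow> real^('n pp_coord amb_coord) \<Rightarrow> real" where
  "gam c a b = (case c of Cu \<Rightarrow> (\<lambda>_. 0)
    | Cv \<Rightarrow> (case (a, b) of (Cu, Cu) \<Rightarrow> (\<lambda>P. partial (Cm Cu) F P / 2)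
        | (Cu, Cx i) \<Rightarrow> (\<lambda>P. partial (Cm (Cx i)) F P / 2)
        | (Cx i, Cu) \<Rightarrow> (\<lambda>P. partial (Cm (Cx i)) F P / 2) | _ \<Rightarrow> (\<lambda>_. 0))
    | Cx i \<Rightarrow> (case (a, b) of (Cu, Cu) \<Rightarrow> (\<lambda>P. - (partial (Cm (Cx i)) F P / 2)) | _ \<Rightarrow> (\<lambda>_. 0)))"

lemma Gam_eq: "P \<in> S \<Longrightarrow> Gam c a b P = gam c a b P"
  by (cases c; cases a; cases b)
    (auto simp: Gam_def gam_def partial_G Ginv_eq sum_pp_coord partial_v if_zero_simps cong: if_cong)

lemma partial_Gam: "P \<in> S \<Longrightarrow> partial i (Gam c a b) P = partial i (gam c a b) P"
  by (rule partial_cong[OF open_S]) (auto intro: Gam_eq)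

lemma partial_half:
  assumes "P \<in> S"
  shows "partial i (\<lambda>q. partial j F q / 2) P = partial i (partial j F) P / 2"
    "partial i (\<lambda>q. - (partial j F q / 2)) P = - (partial i (partial j F) P / 2)"
proof -
  note d = smooth_on_differentiable[OF smooth_on_partial[OF smooth] open_S assms, of j]
  show "partial i (\<lambda>q. partial j F q / 2) P = partial i (partial j F) P / 2"
    using partial_cmult[OF d, of i "1/2"] by simp
  show "partial i (\<lambda>q. - (partial j F q / 2)) P = - (partial i (partial j F) P / 2)"
    using partial_cmult[OF d, of i "-1/2"] by simp
qed

lemma base_ricci_eq:
  assumes "P \<in> S"
  shows "base_ricci a b P = (if a = Cu \<and> b = Cu
    then - (\<Sum>i\<in>UNIV. partial (Cm (Cx i)) (partial (Cm (Cx i)) F) P) / 2 else 0)"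
  unfolding base_ricci_def using assms
  by (cases a; cases b)
    (auto simp: sum_pp_coord Gam_eq partial_Gam gam_def partial_half partial_v sum_negf
      sum_divide_distrib cong: if_cong)

lemma ricci_pp:
  assumes P: "P \<in> S"
  shows "ricci (amb (pp_wave H) (\<lambda>x r. \<phi> x r *\<^sub>R du2)) P $ i $ j =
    (if i = Cm Cu \<and> j = Cm Cu then
      P $ Crho * partial Crho (partial Crho F) P + (1 - real CARD('n pp_coord) / 2) * partial Crho F P
      - (\<Sum>k\<in>UNIV. partial (Cm (Cx k)) (partial (Cm (Cx k)) F) P) / 2
     else 0)"
proof (cases i)
  case Ct then show ?thesis using ricci_Ct[OF P] by simp
next
  case i: Crho
  have "gam c a c = (\<lambda>_. 0)" for a c by (cases a; cases c) (auto simp: gam_def)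
  show ?thesis
  proof (cases j)
    case (Cm a)
    show ?thesis unfolding i Cm ricci_Crho_Cm[OF P] using P
      by (cases a) (auto simp: W_eq sum_pp_coord Gam_eq gam_def partial_v)
  qed (use i P ricci_Ct[OF P] in \<open>auto simp: ricci_Crho_Crho W_eq sum_pp_coord\<close>)
next
  case i: (Cm a)
  show ?thesis
  proof (cases j)
    case (Cm b)
    show ?thesis unfolding i Cm ricci_Cm_Cm[OF P] using P
      by (cases a; cases b) (auto simp: W_eq sum_pp_coord partial_G base_ricci_eq)
  next
    case Crho
    show ?thesis unfolding i Crho ricci_Cm_Crho[OF P] using P
      by (cases a) (auto simp: W_eq sum_pp_coord Gam_eq partial_Gam gam_def partial_v)
  qed (use i P ricci_Ct[OF P] in auto)
qed

end

section \<open>Termwise application of the Laplacian\<close>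

lemma smooth_on_laplacian: "open U \<Longrightarrow> smooth_on U f \<Longrightarrow> smooth_on U (laplacian f)"
  unfolding laplacian_def[abs_def] by (intro smooth_intros)

lemma laplacian_add:
  assumes "open U" "x \<in> U" "smooth_on U f" "smooth_on U g"
  shows "laplacian (\<lambda>y. f y + g y) x = laplacian f x + laplacian g x"
proof -
  note d = smooth_on_differentiable[OF _ assms(1)]
  have "partial (Cx i) (partial (Cx i) (\<lambda>y. f y + g y)) x
      = partial (Cx i) (partial (Cx i) f) x + partial (Cx i) (partial (Cx i) g) x" for i
  proof -
    have "partial (Cx i) (\<lambda>y. f y + g y) y = partial (Cx i) f y + partial (Cx i) g y" if "y \<in> U" for y
      using assms(3,4) that by (intro partial_add d) auto
    then have "partial (Cx i) (partial (Cx i) (\<lambda>y. f y + g y)) x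
        = partial (Cx i) (\<lambda>y. partial (Cx i) f y + partial (Cx i) g y) x"
      by (rule partial_cong[OF assms(1,2)])
    also have "\<dots> = partial (Cx i) (partial (Cx i) f) x + partial (Cx i) (partial (Cx i) g) x"
      using assms by (intro partial_add d smooth_on_partial) auto
    finally show ?thesis .
  qed
  then show ?thesis by (simp add: laplacian_def sum.distrib)
qed

lemma laplacian_cmult:
  assumes "open U" "x \<in> U" "smooth_on U f"
  shows "laplacian (\<lambda>y. c * f y) x = c * laplacian f x"
proof -
  note d = smooth_on_differentiable[OF _ assms(1)]
  have "partial (Cx i) (partial (Cx i) (\<lambda>y. c * f y)) x = c * partial (Cx i) (partial (Cx i) f) x" for i
  proof -
    have "partial (Cx i) (\<lambda>y. c * f y) y = c * partial (Cx i) f y" if "y \<in> U" for y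
      using assms(3) that by (intro partial_cmult d) auto
    then have "partial (Cx i) (partial (Cx i) (\<lambda>y. c * f y)) x
      = partial (Cx i) (\<lambda>y. c * partial (Cx i) f y) x"
      by (rule partial_cong[OF assms(1,2)])
    also have "\<dots> = c * partial (Cx i) (partial (Cx i) f) x"
      using assms by (intro partial_cmult d smooth_on_partial) auto
    finally show ?thesis .
  qed
  then show ?thesis by (simp add: laplacian_def sum_distrib_left)
qed

lemma laplacian_zero [simp]: "laplacian (\<lambda>_. 0) = (\<lambda>_. 0)"
  by (simp add: laplacian_def fun_eq_iff)

lemma laplacian_sum:
  assumes "open U" "x \<in> U" "\<And>k. k \<in> A \<Longrightarrow> smooth_on U (f k)"
  shows "laplacian (\<lambda>y. \<Sum>k\<in>A. f k y) x = (\<Sum>k\<in>A. laplacian (f k) x)"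
  using assms(3)
proof (induction A rule: infinite_finite_induct)
  case (insert a A)
  then have "smooth_on U (\<lambda>y. \<Sum>k\<in>A. f k y)" by (intro smooth_on_sum assms(1)) auto
  with insert show ?case by (simp add: laplacian_add[OF assms(1,2)])
qed simp_all

section \<open>A maximum principle for the flat Laplacian\<close>

lemma second_derivative_le_zero:
  fixes f :: "real \<Rightarrow> real"
  assumes "d > 0" "\<And>s. \<bar>s\<bar> < d \<Longrightarrow> (f has_real_derivative f' s) (at s)"
    "(f' has_real_derivative L) (at 0)" "\<And>s. \<bar>s\<bar> < d \<Longrightarrow> f s \<le> f 0"
  shows "L \<le> 0"
proof (rule ccontr)
  assume "\<not> L \<le> 0"
  then have "0 < L" by simp
  have f'0: "f' 0 = 0"
    using DERIV_local_max[OF assms(2)[of 0] assms(1)] assms(1,4) by simp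
  obtain e where e: "e > 0" "\<And>s. 0 < s \<Longrightarrow> s < e \<Longrightarrow> f' 0 < f' s"
    using DERIV_pos_inc_right[OF assms(3) \<open>0 < L\<close>] by auto
  define s where "s = min d e / 2"
  have s: "0 < s" "s < d" "s < e" using assms(1) e(1) by (auto simp: s_def)
  obtain z where z: "0 < z" "z < s" "f s - f 0 = (s - 0) * f' z"
    using MVT2[of 0 s f f'] s assms(2) by auto
  then have "f s - f 0 > 0" using e(2)[of z] s f'0 by simp
  then show False using assms(4)[of s] s by simp
qed

text \<open>Compare \<open>w\<close> with the paraboloid \<open>\<alpha> |x - x\<^sub>0|\<^sup>2\<close>: the difference has positive Laplacian, so its
  maximum over the ball is attained on the boundary.\<close>

lemma laplacian_maximum_principle:
  fixes w :: "real^('n::finite pp_coord) \<Rightarrow> real"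
  assumes "open U" "smooth_on U w" "cball x0 r \<subseteq> U" "0 < r" "0 < \<delta>"
    "\<And>x. x \<in> cball x0 r \<Longrightarrow> \<delta> \<le> laplacian w x" "\<And>x. x \<in> cball x0 r \<Longrightarrow> \<bar>w x\<bar> \<le> \<eta>"
  shows "\<delta> / (4 * CARD('n)) * r\<^sup>2 \<le> 2 * \<eta>"
proof -
  \<comment> \<open>\<open>CARD('n)\<close> is n - 2, the number of directions in \<Delta>. The
    paraboloid uses all n coordinates, but its Laplacian is 2 \<alpha> (n - 2) = \<delta>/2, which
    stays below the lower bound \<delta>.\<close>
  define \<alpha> where "\<alpha> = \<delta> / (4 * CARD('n))"
  define z where "z x = w x - \<alpha> * ((x - x0) \<bullet> (x - x0))" for x
  have "continuous_on (cball x0 r) w"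
    using assms(2,3) continuous_on_subset smooth_on_continuous_on by blast
  then have "continuous_on (cball x0 r) z"
    unfolding z_def by (intro continuous_intros)
  then obtain y where y: "y \<in> cball x0 r" "\<And>x. x \<in> cball x0 r \<Longrightarrow> z x \<le> z y"
    using continuous_attains_sup[of "cball x0 r" z] assms(4) by (auto simp: not_less)
  have "dist x0 y = r"
  proof (rule ccontr)
    assume "dist x0 y \<noteq> r"
    then have yb: "dist x0 y < r" using y(1) by simp
    have le: "partial (Cx i) (partial (Cx i) w) y \<le> 2 * \<alpha>" for i
    proof -
      define e where "e = (axis (Cx i) 1 :: real^('n pp_coord))"
      have mem: "y + s *\<^sub>R e \<in> cball x0 r" if "\<bar>s\<bar> < r - dist x0 y" for s
      proof -
        have "dist x0 (y + s *\<^sub>R e) \<le> dist x0 y + dist y (y + s *\<^sub>R e)" by (rule dist_triangle)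
        also have "dist y (y + s *\<^sub>R e) = \<bar>s\<bar>" by (simp add: dist_norm e_def norm_axis_1)
        finally show ?thesis using that by simp
      qed
      have zs: "(\<lambda>s. z (y + s *\<^sub>R e)) = (\<lambda>s. w (y + s *\<^sub>R e)
          - \<alpha> * ((y - x0) \<bullet> (y - x0) + 2 * s * ((y - x0) \<bullet> e) + s * s * (e \<bullet> e)))"
        by (rule ext) (simp add: z_def algebra_simps inner_commute)
      have ee: "e \<bullet> e = 1" by (simp add: e_def)
      note d = smooth_on_differentiable[OF _ assms(1)]
      have "partial (Cx i) (partial (Cx i) w) y - 2 * \<alpha> \<le> 0"
      proof (rule second_derivative_le_zero)
        show "0 < r - dist x0 y" using yb by simp
        fix s assume s: "\<bar>s\<bar> < r - dist x0 y"
        have "((\<lambda>s. w (y + s *\<^sub>R e)) has_real_derivative partial (Cx i) w (y + s *\<^sub>R e)) (at s)"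
          unfolding e_def using mem[OF s] assms(2,3) e_def by (intro has_real_derivative_partial d) auto
        moreover have "((\<lambda>s. \<alpha> * (a + 2 * s * b + s * s * (e \<bullet> e))) has_real_derivative \<alpha> * (2 * b
          + 2 * s)) (at s)" for a b
          unfolding ee by (auto intro!: derivative_eq_intros simp: algebra_simps)
        ultimately show "((\<lambda>s. z (y + s *\<^sub>R e)) has_real_derivative
            partial (Cx i) w (y + s *\<^sub>R e) - \<alpha> * (2 * ((y - x0) \<bullet> e) + 2 * s)) (at s)"
          unfolding zs by (rule DERIV_diff)
        show "z (y + s *\<^sub>R e) \<le> z (y + 0 *\<^sub>R e)" using y(2)[OF mem[OF s]] by simp
      next
        have "((\<lambda>s. partial (Cx i) w (y + s *\<^sub>R e)) has_real_derivative partial (Cx i) (partial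
          (Cx i) w) y) (at 0)"
          unfolding e_def using y(1) assms(2,3)
          by (intro has_real_derivative_partial_0 d smooth_on_partial) auto
        moreover have "((\<lambda>s. \<alpha> * (2 * b + 2 * s)) has_real_derivative 2 * \<alpha>) (at 0)" for b
          by (auto intro!: derivative_eq_intros)
        ultimately show "((\<lambda>s. partial (Cx i) w (y + s *\<^sub>R e) - \<alpha> * (2 * ((y - x0) \<bullet> e) + 2 * s))
            has_real_derivative partial (Cx i) (partial (Cx i) w) y - 2 * \<alpha>) (at 0)"
          by (rule DERIV_diff)
      qed
      then show ?thesis by simp
    qed
    have "laplacian w y \<le> (\<Sum>i\<in>(UNIV::'n set). 2 * \<alpha>)"
      unfolding laplacian_def by (intro sum_mono le)
    also have "\<dots> = \<delta> / 2" by (simp add: \<alpha>_def)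
    finally show False using assms(5) assms(6)[OF y(1)] by simp
  qed
  then have "(y - x0) \<bullet> (y - x0) = r\<^sup>2" by (simp add: dot_square_norm dist_norm norm_minus_commute)
  moreover have "z x0 \<le> z y" using y(2)[of x0] assms(4) by simp
  ultimately have "\<alpha> * r\<^sup>2 \<le> w y - w x0" by (simp add: z_def)
  also have "\<dots> \<le> 2 * \<eta>" using assms(7)[OF y(1)] assms(7)[of x0] assms(4) by simp
  finally show ?thesis by (simp add: \<alpha>_def)
qed

text \<open>If \<Delta> s exceeded T at a point, then for large N the function s -
  \<open>sN N\<close> would have Laplacian at least \<delta> on a fixed ball while being arbitrarily
  small there, against the maximum principle.\<close>

lemma laplacian_uniform_limit_le:
  fixes s :: "real^('n::finite pp_coord) \<Rightarrow> real"
  assumes "open U" "smooth_on U s" "\<And>N. smooth_on U (sN N)" "x0 \<in> U"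
    "uniform_limit U sN s sequentially" "uniform_limit U (\<lambda>N. laplacian (sN N)) T sequentially"
    "continuous_on U T"
  shows "laplacian s x0 \<le> T x0"
proof (rule ccontr)
  assume "\<not> laplacian s x0 \<le> T x0"
  \<comment> \<open>The gap 3 \<delta> shrinks to 2 \<delta> on a small ball, and to \<delta> once T
    is replaced by the Laplacian of \<open>sN N\<close>.\<close>
  define \<delta> where "\<delta> = (laplacian s x0 - T x0) / 3"
  have \<delta>: "0 < \<delta>" "2 * \<delta> < laplacian s x0 - T x0"
    using \<open>\<not> laplacian s x0 \<le> T x0\<close> by (auto simp: \<delta>_def)
  have "continuous_on U (\<lambda>x. laplacian s x - T x)"
    by (intro continuous_on_diff assms smooth_on_continuous_on smooth_on_laplacian)
  then have "open (U \<inter> (\<lambda>x. laplacian s x - T x) -` {2 * \<delta><..})"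
    by (rule continuous_open_preimage) (auto simp: assms(1))
  moreover have "x0 \<in> U \<inter> (\<lambda>x. laplacian s x - T x) -` {2 * \<delta><..}" using \<delta> assms(4) by simp
  ultimately obtain r where r: "0 < r" "cball x0 r \<subseteq> U \<inter> (\<lambda>x. laplacian s x - T x) -` {2 * \<delta><..}"
    using open_contains_cball by blast
  define \<eta> where "\<eta> = \<delta> / (4 * CARD('n)) * r\<^sup>2 / 4"
  have \<eta>: "0 < \<eta>" using \<delta> r by (simp add: \<eta>_def)
  have "eventually (\<lambda>N. (\<forall>x\<in>U. dist (sN N x) (s x) < \<eta>) \<and> (\<forall>x\<in>U. dist (laplacian (sN N) x)
    (T x) < \<delta>)) sequentially"
    by (intro eventually_conj uniform_limitD assms \<eta> \<delta>)
  then obtain N where N: "\<And>x. x \<in> U \<Longrightarrow> dist (sN N x) (s x) < \<eta>"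
      "\<And>x. x \<in> U \<Longrightarrow> dist (laplacian (sN N) x) (T x) < \<delta>"
    unfolding eventually_sequentially by blast
  define w where "w x = s x + (-1) * sN N x" for x
  have sm: "smooth_on U (\<lambda>x. (-1) * sN N x)" by (intro smooth_on_mult assms smooth_on_const)
  have "smooth_on U w" unfolding w_def by (intro smooth_on_add assms sm)
  moreover have "\<delta> \<le> laplacian w x" if "x \<in> cball x0 r" for x
  proof -
    have x: "x \<in> U" "laplacian s x - T x > 2 * \<delta>" using that r by auto
    have "laplacian w x = laplacian s x - laplacian (sN N) x"
      unfolding w_def using laplacian_add[OF assms(1) x(1) assms(2) sm]
        laplacian_cmult[OF assms(1) x(1) assms(3), of "-1" N] by simp
    then show ?thesis using x N(2)[OF x(1)] by (simp add: dist_real_def)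
  qed
  moreover have "\<bar>w x\<bar> \<le> \<eta>" if "x \<in> cball x0 r" for x
    using N(1)[of x] that r by (auto simp: w_def dist_real_def)
  ultimately have "\<delta> / (4 * CARD('n)) * r\<^sup>2 \<le> 2 * \<eta>"
    using r \<delta> by (intro laplacian_maximum_principle[OF assms(1), of w x0]) auto
  then show False using \<eta> by (simp add: \<eta>_def)
qed

lemma laplacian_uniform_limit:
  fixes s :: "real^('n::finite pp_coord) \<Rightarrow> real"
  assumes "open U" "smooth_on U s" "\<And>N. smooth_on U (sN N)" "x0 \<in> U"
    "uniform_limit U sN s sequentially" "uniform_limit U (\<lambda>N. laplacian (sN N)) T sequentially"
    "continuous_on U T"
  shows "laplacian s x0 = T x0"
proof (rule antisym)
  show "laplacian s x0 \<le> T x0" by (rule laplacian_uniform_limit_le[OF assms])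
  have m: "laplacian (\<lambda>x. - f x) x = - laplacian f x" if "smooth_on U f" "x \<in> U" for f x
    using laplacian_cmult[OF assms(1) that(2,1), of "-1"] by simp
  have "uniform_limit U (\<lambda>N. laplacian (\<lambda>x. - sN N x)) (\<lambda>x. - T x) sequentially
      \<longleftrightarrow> uniform_limit U (\<lambda>N x. - laplacian (sN N) x) (\<lambda>x. - T x) sequentially"
    by (rule uniform_limit_cong') (auto simp: m assms(3))
  then have "laplacian (\<lambda>x. - s x) x0 \<le> - T x0"
    using assms by (intro laplacian_uniform_limit_le[OF assms(1), of _ "\<lambda>N x. - sN N x"])
      (auto intro!: smooth_on_minus uniform_limit_intros continuous_intros)
  then show "T x0 \<le> laplacian s x0" using m[OF assms(2,4)] by simp
qed

text \<open>The terms of a convergent series are bounded, so the closed sets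
  \<open>A (real j)\<close> exhaust a closed ball. If none contained a ball, their complements would
  be open and dense in it, and Baire's theorem would produce a point outside all of them.\<close>

lemma baire_uniform_bound:
  fixes c :: "nat \<Rightarrow> 'a::euclidean_space \<Rightarrow> real"
  assumes "open U" "U \<noteq> {}" "\<And>k. continuous_on U (c k)" "0 \<le> r"
    "\<And>x. x \<in> U \<Longrightarrow> summable (\<lambda>k. c k x * r ^ k)"
  obtains x0 R C where "0 < R" "ball x0 R \<subseteq> U" "\<And>x k. x \<in> ball x0 R \<Longrightarrow> \<bar>c k x * r ^ k\<bar> \<le> C"
proof (rule ccontr)
  assume neg: "\<not> thesis"
  obtain x1 R1 where R1: "0 < R1" "cball x1 R1 \<subseteq> U"
    using assms(1,2) open_contains_cball by (metis ex_in_conv)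
  define A where "A C = {x \<in> cball x1 R1. \<forall>k. \<bar>c k x * r ^ k\<bar> \<le> C}" for C
  have "cball x1 R1 \<subseteq> closure (\<Inter>(range (\<lambda>j::nat. cball x1 R1 - A (real j))))"
  proof (rule Baire)
    fix T assume "T \<in> range (\<lambda>j::nat. cball x1 R1 - A (real j))"
    then obtain j :: nat where T: "T = cball x1 R1 - A (real j)" by blast
    have "A (real j) = cball x1 R1 \<inter> (\<Inter>k. {x \<in> cball x1 R1. \<bar>c k x * r ^ k\<bar> \<le> real j})"
      by (auto simp: A_def)
    moreover have "closed {x \<in> cball x1 R1. \<bar>c k x * r ^ k\<bar> \<le> real j}" for k
      using continuous_on_subset[OF assms(3) R1(2)]
      by (intro continuous_on_closed_Collect_le continuous_intros) auto
    ultimately have "closed (A (real j))" by (metis (no_types, lifting) closed_INT closed_Int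
      closed_cball)
    then have 1: "openin (top_of_set (cball x1 R1)) T" unfolding T
      using openin_open_Int[of "- A (real j)" "cball x1 R1"] by (simp add: Diff_eq open_Compl)
    have 2: "cball x1 R1 \<subseteq> closure T"
    proof
      fix x assume x: "x \<in> cball x1 R1"
      show "x \<in> closure T"
      proof (rule ccontr)
        assume "x \<notin> closure T"
        then obtain d where d: "0 < d" "ball x d \<inter> T = {}"
          by (metis closure_approachable disjoint_iff dist_commute mem_ball)
        \<comment> \<open>\<open>x\<close> may lie on the boundary sphere, so a nearby point
          \<open>y\<close> of the open ball is taken, around which a ball fits into both
          sets.\<close>
        have "x \<in> closure (ball x1 R1)" using x R1 by (simp add: closure_ball)
        then obtain y where "y \<in> ball x1 R1" "dist y x < d"
          using d(1) closure_approachable by blast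
        then have "y \<in> ball x1 R1 \<inter> ball x d" by (simp add: dist_commute)
        then obtain R where R: "0 < R" "ball y R \<subseteq> ball x1 R1 \<inter> ball x d"
          by (metis open_Int open_ball open_contains_ball)
        have "ball y R \<subseteq> cball x1 R1" using R(2) ball_subset_cball by blast
        then have "ball y R \<subseteq> A (real j)" using d(2) R(2) unfolding T by blast
        then have "\<bar>c k z * r ^ k\<bar> \<le> real j" if "z \<in> ball y R" for z k using that unfolding A_def
          by blast
        moreover have "ball y R \<subseteq> U" using \<open>ball y R \<subseteq> cball x1 R1\<close> R1(2) by blast
        ultimately show False using neg that[OF R(1), of y "real j"] by blast
      qed
    qed
    show "openin (top_of_set (cball x1 R1)) T \<and> cball x1 R1 \<subseteq> closure T" using 1 2 by blast
  qed auto
  moreover have "\<Inter>(range (\<lambda>j::nat. cball x1 R1 - A (real j))) = {}"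
  proof (rule ccontr)
    assume "\<Inter>(range (\<lambda>j::nat. cball x1 R1 - A (real j))) \<noteq> {}"
    then obtain x where "x \<in> \<Inter>(range (\<lambda>j::nat. cball x1 R1 - A (real j)))" by blast
    then have x: "x \<in> cball x1 R1 - A (real j)" for j by blast
    from x[of 0] have "x \<in> U" using R1 by blast
    then have "summable (\<lambda>k. c k x * r ^ k)" by (rule assms(5))
    then obtain K where K: "\<And>k. \<bar>c k x * r ^ k\<bar> \<le> K"
      using summable_imp_Bseq[of "\<lambda>k. c k x * r ^ k"] unfolding Bseq_def real_norm_def by blast
    obtain j :: nat where "K \<le> real j" using real_arch_simple by blast
    then have "x \<in> A (real j)" using x K unfolding A_def by (auto intro: order_trans)
    then show False using x by blast
  qed
  ultimately have "cball x1 R1 \<subseteq> closure {}" by (simp only:)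
  then show False using R1(1) by simp
qed

text \<open>Differentiating the geometric series twice gives the coefficients (k+1)(k+2), which
  dominate the quadratic factor up to the constant 2 + |b|.\<close>

lemma summable_quadratic_geometric:
  fixes q b :: real
  assumes "\<bar>q\<bar> < 1"
  shows "summable (\<lambda>k. \<bar>(real k + 1) * (2 * real k + 2 + b)\<bar> * \<bar>q\<bar> ^ k)"
proof (rule summable_comparison_test')
  have "summable (\<lambda>k. 1 * z ^ k)" if "norm z < 1" for z :: real using that
    by (simp add: summable_geometric)
  from termdiff_converges[OF _ this] have "summable (\<lambda>k. diffs (\<lambda>_. 1) k * z ^ k)"
    if "norm z < 1" for z :: real
    using that by blast
  from termdiff_converges[OF _ this] assms
  have "summable (\<lambda>k. diffs (diffs (\<lambda>_. 1)) k * \<bar>q\<bar> ^ k)" by simp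
  from summable_mult[OF this, of "2 + \<bar>b\<bar>"]
  show "summable (\<lambda>k. (2 + \<bar>b\<bar>) * ((real k + 1) * (real k + 2)) * \<bar>q\<bar> ^ k)"
    by (simp add: diffs_def algebra_simps)
  fix k :: nat
  have "\<bar>2 * real k + 2 + b\<bar> \<le> (2 + \<bar>b\<bar>) * (real k + 2)"
  proof -
    have "\<bar>b\<bar> * 1 \<le> \<bar>b\<bar> * (real k + 2)" by (intro mult_left_mono) auto
    moreover have "\<bar>2 * real k + 2 + b\<bar> \<le> 2 * (real k + 2) + \<bar>b\<bar> * 1" by (simp add: abs_if)
    ultimately show ?thesis unfolding distrib_right by linarith
  qed
  then have "(real k + 1) * \<bar>2 * real k + 2 + b\<bar> \<le> (real k + 1) * ((2 + \<bar>b\<bar>) * (real k + 2))"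
    by (rule mult_left_mono) simp
  then have "\<bar>(real k + 1) * (2 * real k + 2 + b)\<bar> \<le> (2 + \<bar>b\<bar>) * ((real k + 1) * (real k + 2))"
    unfolding abs_mult by (simp add: mult.left_commute)
  then have "\<bar>(real k + 1) * (2 * real k + 2 + b)\<bar> * \<bar>q\<bar> ^ k
    \<le> (2 + \<bar>b\<bar>) * ((real k + 1) * (real k + 2)) * \<bar>q\<bar> ^ k"
    by (intro mult_right_mono) auto
  then show "norm (\<bar>(real k + 1) * (2 * real k + 2 + b)\<bar> * \<bar>q\<bar> ^ k)
      \<le> (2 + \<bar>b\<bar>) * ((real k + 1) * (real k + 2)) * \<bar>q\<bar> ^ k" by simp
qed

text \<open>The set where the two sides differ is open, both being continuous; if it were nonempty,
  it would contain a ball with uniform bounds on the terms, where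
  \<open>laplacian_uniform_limit\<close> gives equality. Continuity of the right-hand side does not
  follow from pointwise convergence; in the application it comes from the \<rho>-derivatives of the
  smooth sum.\<close>

lemma laplacian_power_series:
  fixes c :: "nat \<Rightarrow> real^('n::finite pp_coord) \<Rightarrow> real"
  assumes M: "open M" and sm: "\<And>k. smooth_on M (c k)"
    and rec: "\<And>k x. x \<in> M \<Longrightarrow> laplacian (c k) x = (real k + 1) * (2 * real k + 2 + b) * c (Suc k) x"
    and summ: "\<And>x r. x \<in> M \<Longrightarrow> \<bar>r\<bar> < \<epsilon> \<Longrightarrow> summable (\<lambda>k. c k x * r ^ k)"
    and \<rho>: "\<bar>\<rho>\<bar> < \<epsilon>"
    and s: "smooth_on M (\<lambda>x. \<Sum>k. c k x * \<rho> ^ k)"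
    and T: "continuous_on M (\<lambda>x. \<Sum>k. (real k + 1) * (2 * real k + 2 + b) * c (Suc k) x * \<rho> ^ k)"
    and x: "x \<in> M"
  shows "laplacian (\<lambda>x. \<Sum>k. c k x * \<rho> ^ k) x
    = (\<Sum>k. (real k + 1) * (2 * real k + 2 + b) * c (Suc k) x * \<rho> ^ k)"
proof -
  define a where "a k = (real k + 1) * (2 * real k + 2 + b)" for k
  define s where "s x = (\<Sum>k. c k x * \<rho> ^ k)" for x
  define T where "T x = (\<Sum>k. a k * c (Suc k) x * \<rho> ^ k)" for x
  have ss: "smooth_on M s" unfolding s_def by (rule s)
  have cT: "continuous_on M T" unfolding T_def a_def by (rule T)
  define U where "U = M \<inter> (\<lambda>x. laplacian s x - T x) -` (- {0})"
  have "continuous_on M (\<lambda>x. laplacian s x - T x)"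
    by (intro continuous_on_diff smooth_on_continuous_on smooth_on_laplacian M ss cT)
  then have U: "open U" unfolding U_def by (rule continuous_open_preimage) (auto simp: M)
  have "U = {}"
  proof (rule ccontr)
    assume ne: "U \<noteq> {}"
    \<comment> \<open>The bounds are taken at a radius strictly between |\<rho>| and \<epsilon>,
      which leaves a ratio q < 1 for the majorants.\<close>
    define r where "r = (\<bar>\<rho>\<bar> + \<epsilon>) / 2"
    have r: "\<bar>\<rho>\<bar> < r" "r < \<epsilon>" "0 < r" using \<rho> by (auto simp: r_def)
    have UM: "U \<subseteq> M" by (auto simp: U_def)
    have cU: "continuous_on U (c k)" for k using sm smooth_on_continuous_on continuous_on_subset UM
      by blast
    have sU: "summable (\<lambda>k. c k x * r ^ k)" if "x \<in> U" for x using that UM r by (intro summ) auto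
    obtain x0 R C where B: "0 < R" "ball x0 R \<subseteq> U" "\<And>x k. x \<in> ball x0 R \<Longrightarrow> \<bar>c k x * r ^ k\<bar> \<le> C"
      by (rule baire_uniform_bound[OF U ne cU _ sU]) (use r(3) in auto)
    define B where "B = ball x0 R"
    have BM: "B \<subseteq> M" using B(2) UM by (auto simp: B_def)
    define q where "q = \<bar>\<rho>\<bar> / r"
    have q: "0 \<le> q" "q < 1" using r by (auto simp: q_def)
    have qr: "\<bar>\<rho>\<bar> = q * r" using r by (simp add: q_def)
    have b1: "\<bar>c k x * \<rho> ^ k\<bar> \<le> C * q ^ k" if "x \<in> B" for k x
    proof -
      have "\<bar>c k x * \<rho> ^ k\<bar> = \<bar>c k x * r ^ k\<bar> * q ^ k"
        using q r by (simp add: abs_mult power_abs qr power_mult_distrib)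
      also have "\<dots> \<le> C * q ^ k" using B(3)[of x k] that q by (intro mult_right_mono) (auto simp: B_def)
      finally show ?thesis .
    qed
    have b2: "\<bar>a k * c (Suc k) x * \<rho> ^ k\<bar> \<le> C / r * (\<bar>a k\<bar> * \<bar>q\<bar> ^ k)" if "x \<in> B" for k x
    proof -
      have "\<bar>a k * c (Suc k) x * \<rho> ^ k\<bar> = \<bar>c (Suc k) x * r ^ Suc k\<bar> * (\<bar>a k\<bar> * q ^ k / r)"
        using q r by (simp add: abs_mult power_abs qr power_mult_distrib)
      also have "\<dots> \<le> C * (\<bar>a k\<bar> * q ^ k / r)"
        using B(3)[of x "Suc k"] that q r by (intro mult_right_mono) (auto simp: B_def)
      finally show ?thesis using q by simp
    qed
    have u1: "uniform_limit B (\<lambda>N x. \<Sum>k<N. c k x * \<rho> ^ k) s sequentially"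
      unfolding s_def
    proof (rule Weierstrass_m_test)
      show "norm (c k x * \<rho> ^ k) \<le> C * q ^ k" if "x \<in> B" for k x using b1[OF that] by simp
      show "summable (\<lambda>k. C * q ^ k)" using q by (intro summable_mult summable_geometric) auto
    qed
    have u2: "uniform_limit B (\<lambda>N x. \<Sum>k<N. a k * c (Suc k) x * \<rho> ^ k) T sequentially"
      unfolding T_def
    proof (rule Weierstrass_m_test)
      show "norm (a k * c (Suc k) x * \<rho> ^ k) \<le> C / r * (\<bar>a k\<bar> * \<bar>q\<bar> ^ k)" if "x \<in> B" for k x
        using b2[OF that] by simp
      show "summable (\<lambda>k. C / r * (\<bar>a k\<bar> * \<bar>q\<bar> ^ k))"
        unfolding a_def using q by (intro summable_mult summable_quadratic_geometric) auto
    qed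
    have oB: "open B" by (simp add: B_def)
    have smB: "smooth_on B (\<lambda>x. \<rho> ^ k * c k x)" for k
      using sm BM by (intro smooth_on_mult oB smooth_on_const) (blast intro: smooth_on_subset)
    have lap: "laplacian (\<lambda>x. \<Sum>k<N. c k x * \<rho> ^ k) x = (\<Sum>k<N. a k * c (Suc k) x * \<rho> ^ k)"
      if "x \<in> B" for N x
    proof -
      have "laplacian (\<lambda>x. \<Sum>k<N. \<rho> ^ k * c k x) x = (\<Sum>k<N. laplacian (\<lambda>x. \<rho> ^ k * c k x) x)"
        by (rule laplacian_sum[OF oB that smB])
      also have "\<dots> = (\<Sum>k<N. a k * c (Suc k) x * \<rho> ^ k)"
        using that BM rec sm by (intro sum.cong) (auto simp: a_def laplacian_cmult[OF M])
      finally show ?thesis by (simp add: mult.commute)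
    qed
    have "laplacian s x0 = T x0"
    proof (rule laplacian_uniform_limit[OF oB])
      show "smooth_on B s" using ss BM smooth_on_subset by blast
      show "smooth_on B (\<lambda>x. \<Sum>k<N. c k x * \<rho> ^ k)" for N
        using smooth_on_sum[OF oB smB, of "\<lambda>k. k" "{..<N}"] by (simp add: mult.commute)
      show "x0 \<in> B" using B(1) by (simp add: B_def)
      show "uniform_limit B (\<lambda>N x. \<Sum>k<N. c k x * \<rho> ^ k) s sequentially" by (rule u1)
      have "uniform_limit B (\<lambda>N. laplacian (\<lambda>x. \<Sum>k<N. c k x * \<rho> ^ k)) T sequentially
        \<longleftrightarrow> uniform_limit B (\<lambda>N x. \<Sum>k<N. a k * c (Suc k) x * \<rho> ^ k) T sequentially"
        by (rule uniform_limit_cong') (auto simp: lap)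
      then show "uniform_limit B (\<lambda>N. laplacian (\<lambda>x. \<Sum>k<N. c k x * \<rho> ^ k)) T sequentially" using u2
        by simp
      show "continuous_on B T" using cT BM continuous_on_subset by blast
    qed
    moreover have "x0 \<in> U" using B(1,2) by auto
    ultimately show False by (simp add: U_def)
  qed
  then have "laplacian s x = T x" using x by (auto simp: U_def)
  then show ?thesis by (simp add: s_def[abs_def] T_def a_def)
qed

text \<open>In \<rho> alone a power series is differentiated term by term inside its interval of
  convergence; agreement of \<open>F\<close> with the series along one line with t and x fixed is
  what enters.\<close>

lemma partial_rho_power_series:
  fixes c :: "nat \<Rightarrow> real^'m::finite \<Rightarrow> real"
  assumes M: "open M" and x: "x \<in> M" and t: "0 < t" and \<rho>: "\<bar>\<rho>\<bar> < \<epsilon>"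
    and summ: "\<And>r. \<bar>r\<bar> < \<epsilon> \<Longrightarrow> summable (\<lambda>k. c k x * r ^ k)"
    and sm: "smooth_on (amb_domain M \<epsilon>) F"
    and F: "\<And>r. \<bar>r\<bar> < \<epsilon> \<Longrightarrow> F (amb_point t x r) = (\<Sum>k. c k x * r ^ k)"
  shows "partial Crho F (amb_point t x \<rho>) = (\<Sum>k. diffs (\<lambda>k. c k x) k * \<rho> ^ k)"
proof -
  have "amb_point t x \<rho> \<in> amb_domain M \<epsilon>" using x t \<rho> by (simp add: amb_domain_def)
  from has_real_derivative_rho[OF smooth_on_differentiable[OF sm open_amb_domain[OF M] this]]
  have 1: "((\<lambda>r. F (amb_point t x r)) has_real_derivative partial Crho F (amb_point t x \<rho>)) (at \<rho>)" .
  have "((\<lambda>r. \<Sum>k. c k x * r ^ k) has_real_derivative (\<Sum>k. diffs (\<lambda>k. c k x) k * \<rho> ^ k)) (at \<rho>)"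
    by (rule termdiffs_strong'[of \<epsilon>]) (use summ \<rho> in auto)
  then have "((\<lambda>r. F (amb_point t x r)) has_real_derivative (\<Sum>k. diffs (\<lambda>k. c k x) k * \<rho> ^ k)) (at \<rho>)"
  proof (rule DERIV_cong_ev[OF refl _ refl, THEN iffD1, rotated])
    have "eventually (\<lambda>r. r \<in> {-\<epsilon><..<\<epsilon>}) (nhds \<rho>)" using \<rho> by (intro eventually_nhds_in_open) auto
    then show "eventually (\<lambda>r. (\<Sum>k. c k x * r ^ k) = F (amb_point t x r)) (nhds \<rho>)"
      by eventually_elim (use F in auto)
  qed
  with 1 show ?thesis by (rule DERIV_unique)
qed

lemma power_series_ambient_equation:
  fixes c :: "nat \<Rightarrow> real^('n::finite pp_coord) \<Rightarrow> real"
  assumes M: "open M" and sm: "\<And>k. smooth_on M (c k)"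
    and rec: "\<And>k x. x \<in> M \<Longrightarrow> laplacian (c k) x = (real k + 1) * (2 * real k + 2 + b) * c (Suc k) x"
    and conv: "converges_smoothly M \<epsilon> c"
    and P: "P \<in> amb_domain M \<epsilon>"
  defines "F \<equiv> \<lambda>P. \<Sum>k. c k (base_point P) * (P $ Crho) ^ k"
  shows "2 * P $ Crho * partial Crho (partial Crho F) P + (2 + b) * partial Crho F P
    = (\<Sum>i\<in>UNIV. partial (Cm (Cx i)) (partial (Cm (Cx i)) F) P)"
proof -
  have summ: "\<And>x r. x \<in> M \<Longrightarrow> \<bar>r\<bar> < \<epsilon> \<Longrightarrow> summable (\<lambda>k. c k x * r ^ k)"
    and smF: "smooth_on (amb_domain M \<epsilon>) F"
    using conv by (auto simp: converges_smoothly_def F_def)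
  define t x \<rho> where "t = P $ Ct" and "x = base_point P" and "\<rho> = P $ Crho"
  have tx: "0 < t" "x \<in> M" "\<bar>\<rho>\<bar> < \<epsilon>" using P by (auto simp: amb_domain_def t_def x_def \<rho>_def)
  have PP: "P = amb_point t x \<rho>" by (simp add: t_def x_def \<rho>_def)
  note oD = open_amb_domain[OF M, of \<epsilon>]
  have d1: "partial Crho F (amb_point t y r) = (\<Sum>k. diffs (\<lambda>k. c k y) k * r ^ k)"
    if "y \<in> M" "\<bar>r\<bar> < \<epsilon>" for y r
    using partial_rho_power_series[where c = c and F = F, OF M that(1) tx(1) that(2) summ[OF
      that(1)] smF]
    by (simp add: F_def)
  have sd: "summable (\<lambda>k. diffs (\<lambda>k. c k y) k * r ^ k)" if "y \<in> M" "\<bar>r\<bar> < \<epsilon>" for y r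
    by (rule termdiff_converges[of r \<epsilon>]) (use summ that in auto)
  have d2: "partial Crho (partial Crho F) (amb_point t y r) = (\<Sum>k. diffs (diffs (\<lambda>k. c k y)) k * r ^ k)"
    if "y \<in> M" "\<bar>r\<bar> < \<epsilon>" for y r
    by (rule partial_rho_power_series[OF M that(1) tx(1) that(2), of "\<lambda>k y. diffs (\<lambda>k. c k y) k"])
      (use d1 sd that smF in \<open>auto intro: smooth_on_partial\<close>)
  have sdd: "summable (\<lambda>k. diffs (diffs (\<lambda>k. c k y)) k * r ^ k)" if "y \<in> M" "\<bar>r\<bar> < \<epsilon>" for y r
    by (rule termdiff_converges[of r \<epsilon>]) (use sd that in auto)
  \<comment> \<open>At fixed t and \<rho> this is the left-hand side as a function of x. It is
    continuous because F is smooth, and fact \<open>TT\<close> identifies it with the series of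
    Laplacians: the continuity required by \<open>laplacian_power_series\<close>.\<close>
  define T where "T y = 2 * \<rho> * partial Crho (partial Crho F) (amb_point t y \<rho>) + (2
    + b) * partial Crho F (amb_point t y \<rho>)" for y
  have TT: "T y = (\<Sum>k. (real k + 1) * (2 * real k + 2 + b) * c (Suc k) y * \<rho> ^ k)" if y: "y \<in> M" for y
  proof -
    define d where "d = diffs (\<lambda>k. c k y)"
    have "(\<lambda>k. diffs d k * \<rho> ^ k) sums partial Crho (partial Crho F) (amb_point t y \<rho>)"
      unfolding d2[OF y tx(3)] d_def by (intro summable_sums sdd y tx(3))
    from sums_mult[OF this, of \<rho>]
    have "(\<lambda>k. real (Suc k) * d (Suc k) * \<rho> ^ Suc k) sums (\<rho> * partial Crho (partial Crho F)
      (amb_point t y \<rho>))"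
      by (simp add: diffs_def mult_ac)
    then have 2: "(\<lambda>k. real k * d k * \<rho> ^ k) sums (\<rho> * partial Crho (partial Crho F) (amb_point t y \<rho>))"
      by (subst (asm) sums_Suc_iff) simp
    have 1: "(\<lambda>k. d k * \<rho> ^ k) sums partial Crho F (amb_point t y \<rho>)"
      unfolding d1[OF y tx(3)] d_def by (intro summable_sums sd y tx(3))
    have "(\<lambda>k. 2 * (real k * d k * \<rho> ^ k) + (2 + b) * (d k * \<rho> ^ k)) sums T y"
      using sums_add[OF sums_mult[OF 2, of 2] sums_mult[OF 1, of "2 + b"]]
        by (simp add: T_def mult.assoc)
    then have "(\<lambda>k. (real k + 1) * (2 * real k + 2 + b) * c (Suc k) y * \<rho> ^ k) sums T y"
      by (simp add: d_def diffs_def algebra_simps)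
    then show ?thesis by (rule sums_unique)
  qed
  have slice: "smooth_on M (\<lambda>y. f (amb_point t y \<rho>))" if "smooth_on (amb_domain M \<epsilon>) f" for f
    by (rule smooth_on_amb_point[OF oD that _ M]) (use tx in \<open>auto simp: amb_domain_def\<close>)
  have s: "smooth_on M (\<lambda>y. \<Sum>k. c k y * \<rho> ^ k)"
    using slice[OF smF] by (simp add: F_def)
  have "continuous_on M T"
    unfolding T_def
    by (intro continuous_intros smooth_on_continuous_on slice smooth_on_partial smF)
  then have cT: "continuous_on M (\<lambda>y. \<Sum>k. (real k + 1) * (2 * real k + 2 + b) * c (Suc k) y * \<rho> ^ k)"
    by (rule continuous_on_eq) (rule TT)
  have "laplacian (\<lambda>y. \<Sum>k. c k y * \<rho> ^ k) x = T x"
    unfolding TT[OF tx(2)]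
    by (rule laplacian_power_series[OF M sm rec summ tx(3) s cT tx(2)])
  moreover have "laplacian (\<lambda>y. \<Sum>k. c k y * \<rho> ^ k) x = laplacian (\<lambda>y. F (amb_point t y \<rho>)) x"
    by (simp add: F_def)
  moreover have "\<dots> = (\<Sum>i\<in>UNIV. partial (Cm (Cx i)) (partial (Cm (Cx i)) F) (amb_point t x \<rho>))"
    by (simp add: laplacian_def partial_amb_point)
  ultimately show ?thesis by (simp add: T_def PP)
qed

section \<open>Functions vanishing to finite order in \<open>\<rho>\<close>\<close>

abbreviation rho_deriv :: "nat \<Rightarrow> (real^('m::finite amb_coord) \<Rightarrow> real) \<Rightarrow> real^('m amb_coord) \<Rightarrow> real"
  where
  "rho_deriv k \<equiv> partial Crho ^^ k"

text \<open>Order of vanishing at \<rho> = 0, with smoothness built in: the \<rho>-derivatives of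
  order below \<open>k\<close> are zero there. The recursion through \<open>partial Crho f\<close>
  suits inductions by the Leibniz rule.\<close>

primrec vanishes :: "(real^('m::finite amb_coord)) set \<Rightarrow> nat \<Rightarrow>
  (real^('m amb_coord) \<Rightarrow> real) \<Rightarrow> bool" where
  "vanishes S 0 f = smooth_on S f"
| "vanishes S (Suc k) f = (smooth_on S f \<and> (\<forall>P\<in>S. P $ Crho = 0
  \<longrightarrow> f P = 0) \<and> vanishes S k (partial Crho f))"

lemma vanishes_smooth: "vanishes S k f \<Longrightarrow> smooth_on S f"
  by (cases k) auto

lemma vanishes_SucD: "vanishes S (Suc k) f \<Longrightarrow> vanishes S k f"
  by (induction k arbitrary: f) auto

lemma vanishes_iff:
  "vanishes S k f \<longleftrightarrow> smooth_on S f \<and> (\<forall>j<k. \<forall>P\<in>S. P $ Crho = 0 \<longrightarrow> rho_deriv j f P = 0)"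
proof (induction k arbitrary: f)
  case (Suc k)
  have "(\<forall>j<Suc k. \<forall>P\<in>S. P $ Crho = 0 \<longrightarrow> rho_deriv j f P = 0) \<longleftrightarrow>
    (\<forall>P\<in>S. P $ Crho = 0 \<longrightarrow> f P = 0) \<and> (\<forall>j<k. \<forall>P\<in>S. P $ Crho = 0 \<longrightarrow> rho_deriv j (partial Crho f) P = 0)"
    by (simp add: All_less_Suc2 funpow_Suc_right del: funpow.simps(2))
  then show ?case using Suc smooth_on_partial by auto
qed simp

lemma smooth_on_rho_deriv: "smooth_on S f \<Longrightarrow> smooth_on S (rho_deriv k f)"
  by (induction k) (auto intro: smooth_on_partial)

context
  fixes S :: "(real^('m::finite amb_coord)) set"
  assumes S: "open S"
begin

lemma rho_deriv_cong:
  "(\<And>Q. Q \<in> S \<Longrightarrow> f Q = g Q) \<Longrightarrow> P \<in> S \<Longrightarrow> rho_deriv k f P = rho_deriv k g P"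
proof (induction k arbitrary: P)
  case (Suc k)
  have "partial Crho (rho_deriv k f) P = partial Crho (rho_deriv k g) P"
    by (rule partial_cong[OF S Suc.prems(2) Suc.IH[OF Suc.prems(1)]])
  then show ?case by simp
qed simp

lemma vanishes_cong:
  assumes "\<And>Q. Q \<in> S \<Longrightarrow> f Q = g Q" "vanishes S k f"
  shows "vanishes S k g"
proof -
  have "smooth_on S g" by (rule smooth_on_cong[OF S assms(1) vanishes_smooth[OF assms(2)]])
  moreover have "rho_deriv j g P = rho_deriv j f P" if "P \<in> S" for j P
    by (rule rho_deriv_cong[OF _ that, symmetric]) (rule assms(1))
  ultimately show ?thesis using assms(2) unfolding vanishes_iff by simp
qed

lemma rho_deriv_add:
  assumes "smooth_on S f" "smooth_on S g" "P \<in> S"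
  shows "rho_deriv k (\<lambda>Q. f Q + g Q) P = rho_deriv k f P + rho_deriv k g P"
  using assms(3)
proof (induction k arbitrary: P)
  case (Suc k)
  have "partial Crho (rho_deriv k (\<lambda>Q. f Q + g Q)) P = partial Crho (\<lambda>Q. rho_deriv k f Q
    + rho_deriv k g Q) P"
    by (rule partial_cong[OF S Suc.prems Suc.IH])
  also have "\<dots> = partial Crho (rho_deriv k f) P + partial Crho (rho_deriv k g) P"
    by (intro partial_add smooth_on_differentiable[OF smooth_on_rho_deriv S] assms Suc.prems)
  finally show ?case by simp
qed simp

lemma rho_deriv_cmult:
  assumes "smooth_on S f" "P \<in> S"
  shows "rho_deriv k (\<lambda>Q. c * f Q) P = c * rho_deriv k f P"
  using assms(2)
proof (induction k arbitrary: P)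
  case (Suc k)
  have "partial Crho (rho_deriv k (\<lambda>Q. c * f Q)) P = partial Crho (\<lambda>Q. c * rho_deriv k f Q) P"
    by (rule partial_cong[OF S Suc.prems Suc.IH])
  also have "\<dots> = c * partial Crho (rho_deriv k f) P"
    by (intro partial_cmult smooth_on_differentiable[OF smooth_on_rho_deriv S] assms Suc.prems)
  finally show ?case by simp
qed simp

lemma rho_deriv_sum:
  assumes "\<And>a. a \<in> A \<Longrightarrow> smooth_on S (f a)" "P \<in> S"
  shows "rho_deriv k (\<lambda>Q. \<Sum>a\<in>A. f a Q) P = (\<Sum>a\<in>A. rho_deriv k (f a) P)"
  using assms(1)
proof (induction A rule: infinite_finite_induct)
  case (insert a A)
  then have "smooth_on S (\<lambda>y. \<Sum>k\<in>A. f k y)" by (intro smooth_on_sum S) auto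
  with insert show ?case by (simp add: rho_deriv_add[OF _ _ assms(2)])
qed (use rho_deriv_cmult[OF smooth_on_const assms(2), of k 0 0] in simp_all)

lemma vanishes_add: "vanishes S k f \<Longrightarrow> vanishes S k g \<Longrightarrow> vanishes S k (\<lambda>P. f P + g P)"
  by (auto simp: vanishes_iff rho_deriv_add intro: smooth_on_add S)

lemma vanishes_cmult: "vanishes S k f \<Longrightarrow> vanishes S k (\<lambda>P. c * f P)"
  by (auto simp: vanishes_iff rho_deriv_cmult intro: smooth_on_mult S)

lemma vanishes_diff: "vanishes S k f \<Longrightarrow> vanishes S k g \<Longrightarrow> vanishes S k (\<lambda>P. f P - g P)"
  using vanishes_add[of k f "\<lambda>P. (-1) * g P"] vanishes_cmult[of k g "-1"] by simp

lemma vanishes_zero: "vanishes S k (\<lambda>_. 0)"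
  by (induction k) auto

lemma vanishes_sum: "(\<And>a. a \<in> A \<Longrightarrow> vanishes S k (f a)) \<Longrightarrow> vanishes S k (\<lambda>P. \<Sum>a\<in>A. f a P)"
  by (induction A rule: infinite_finite_induct) (auto intro: vanishes_add vanishes_zero)

lemma vanishes_mult: "vanishes S k f \<Longrightarrow> smooth_on S g \<Longrightarrow> vanishes S k (\<lambda>P. f P * g P)"
proof (induction k arbitrary: f g)
  case (Suc k)
  have "vanishes S k (partial Crho (\<lambda>P. f P * g P))"
  proof (rule vanishes_cong)
    show "vanishes S k (\<lambda>P. partial Crho f P * g P + f P * partial Crho g P)"
      using Suc vanishes_SucD[OF Suc.prems(1)] by (intro vanishes_add Suc.IH smooth_on_partial) auto
    show "partial Crho f Q * g Q + f Q * partial Crho g Q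
      = partial Crho (\<lambda>P. f P * g P) Q" if "Q \<in> S" for Q
      using Suc.prems that
      by (intro partial_mult[symmetric] smooth_on_differentiable[OF _ S]) auto
  qed
  then show ?case using Suc.prems by (auto intro: smooth_on_mult S)
qed (auto intro: smooth_on_mult S)

text \<open>Derivatives in t and x lose no order: lines in these directions stay in \<rho> = 0, and
  such derivatives commute with the \<rho>-derivative.\<close>

lemma vanishes_partial:
  assumes "i \<noteq> Crho"
  shows "vanishes S k f \<Longrightarrow> vanishes S k (partial i f)"
proof (induction k arbitrary: f)
  case (Suc k)
  have "partial i f P = 0" if P: "P \<in> S" "P $ Crho = 0" for P
  proof (rule partial_zero_of_constant)
    show "eventually (\<lambda>s. f (P + s *\<^sub>R axis i 1) = f P) (nhds 0)"
      using eventually_line[OF S P(1), of i]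
    proof eventually_elim
      case (elim s)
      have "(P + s *\<^sub>R axis i 1) $ Crho = 0" using P(2) assms by (simp add: axis_def)
      with elim P Suc.prems show ?case by simp
    qed
  qed
  moreover have "vanishes S k (partial Crho (partial i f))"
  proof (rule vanishes_cong)
    show "vanishes S k (partial i (partial Crho f))" using Suc by simp
    show "partial i (partial Crho f) Q = partial Crho (partial i f) Q" if "Q \<in> S" for Q
      by (rule partial_commute[OF vanishes_smooth[OF Suc.prems] S that])
  qed
  ultimately show ?case using Suc.prems by (auto intro: smooth_on_partial)
qed (auto intro: smooth_on_partial)

lemma partial_rho_mult:
  assumes "smooth_on S f" "P \<in> S"
  shows "partial Crho (\<lambda>P. P $ Crho * f P) P = f P + P $ Crho * partial Crho f P"
  using partial_mult[OF smooth_on_differentiable[OF smooth_on_coord S assms(2)]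
      smooth_on_differentiable[OF assms(1) S assms(2)]]
  by (simp add: partial_coord)

text \<open>A factor \<rho> gains one order, which makes up for the order lost by the
  \<rho>-derivatives inside the quadratic terms of the Ricci tensor.\<close>

lemma vanishes_rho_mult: "vanishes S k f \<Longrightarrow> vanishes S (Suc k) (\<lambda>P. P $ Crho * f P)"
proof (induction k arbitrary: f)
  case 0
  then show ?case by (auto intro!: smooth_intros S)
next
  case (Suc k)
  have "vanishes S (Suc k) (partial Crho (\<lambda>P. P $ Crho * f P))"
  proof (rule vanishes_cong)
    show "vanishes S (Suc k) (\<lambda>P. f P + P $ Crho * partial Crho f P)"
      using Suc by (intro vanishes_add Suc.IH) auto
    show "f Q + Q $ Crho * partial Crho f Q = partial Crho (\<lambda>P. P $ Crho * f P) Q" if "Q \<in> S" for Q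
      using partial_rho_mult[OF vanishes_smooth[OF Suc.prems] that] by simp
  qed
  then show ?case using vanishes_smooth[OF Suc.prems]
    by (subst vanishes.simps) (auto intro!: smooth_intros S)
qed

lemma rho_deriv_rho_mult:
  assumes "smooth_on S f" "P \<in> S"
  shows "rho_deriv (Suc k) (\<lambda>P. P $ Crho * f P) P = P $ Crho * rho_deriv (Suc k) f P
    + real (Suc k) * rho_deriv k f P"
  using assms(2)
proof (induction k arbitrary: P)
  case 0
  then show ?case using partial_rho_mult[OF assms(1)] by simp
next
  case (Suc k)
  note sm = smooth_on_rho_deriv[OF assms(1)]
  have "partial Crho (rho_deriv (Suc k) (\<lambda>P. P $ Crho * f P)) P
      = partial Crho (\<lambda>P. P $ Crho * rho_deriv (Suc k) f P + real (Suc k) * rho_deriv k f P) P"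
    by (rule partial_cong[OF S Suc.prems Suc.IH])
  also have "\<dots> = partial Crho (\<lambda>P. P $ Crho * rho_deriv (Suc k) f P) P
    + partial Crho (\<lambda>P. real (Suc k) * rho_deriv k f P) P"
    by (intro partial_add smooth_on_differentiable[OF _ S] smooth_on_mult smooth_on_coord
      smooth_on_const sm S Suc.prems)
  also have "partial Crho (\<lambda>P. real (Suc k) * rho_deriv k f P) P = real (Suc k) * rho_deriv (Suc k) f P"
    using partial_cmult[OF smooth_on_differentiable[OF sm S Suc.prems], of Crho "real (Suc k)" k]
      by simp
  also have "partial Crho (\<lambda>P. P $ Crho * rho_deriv (Suc k) f P) P
      = rho_deriv (Suc k) f P + P $ Crho * rho_deriv (Suc (Suc k)) f P"
    using partial_rho_mult[OF sm Suc.prems, of "Suc k"] by simp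
  finally show ?case by (simp add: algebra_simps)
qed

text \<open>In the Leibniz expansion at \<rho> = 0 only the term with all derivatives on
  \<open>f\<close> survives.\<close>

lemma rho_deriv_mult:
  assumes "P \<in> S" "P $ Crho = 0"
  shows "vanishes S k f \<Longrightarrow> smooth_on S g \<Longrightarrow> rho_deriv k (\<lambda>P. f P * g P) P = rho_deriv k f P * g P"
proof (induction k arbitrary: f g)
  case (Suc k)
  have sm: "smooth_on S f" "smooth_on S (partial Crho f)" "smooth_on S (partial Crho g)"
    using Suc.prems by (auto intro: smooth_on_partial)
  have "rho_deriv (Suc k) (\<lambda>P. f P * g P) P = rho_deriv k (partial Crho (\<lambda>P. f P * g P)) P"
    by (simp add: funpow_swap1)
  also have "\<dots> = rho_deriv k (\<lambda>P. partial Crho f P * g P + f P * partial Crho g P) P"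
    using Suc.prems sm
    by (intro rho_deriv_cong partial_mult smooth_on_differentiable[OF _ S] assms) auto
  also have "\<dots> = rho_deriv k (\<lambda>P. partial Crho f P * g P) P
    + rho_deriv k (\<lambda>P. f P * partial Crho g P) P"
    using Suc.prems sm by (intro rho_deriv_add smooth_on_mult S assms) auto
  also have "rho_deriv k (\<lambda>P. f P * partial Crho g P) P = 0"
    using vanishes_mult[OF Suc.prems(1) sm(3)] assms unfolding vanishes_iff by blast
  also have "rho_deriv k (\<lambda>P. partial Crho f P * g P) P = rho_deriv (Suc k) f P * g P"
    using Suc by (simp add: funpow_swap1)
  finally show ?case by simp
qed simp

text \<open>Congruence modulo \<rho>^k. It respects sums, products and tangential derivatives, so
  that differences of whole curvature expressions need not be expanded; only
  \<open>partial Crho\<close> costs one order.\<close>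

definition eqv :: "nat \<Rightarrow> (real^('m amb_coord) \<Rightarrow> real) \<Rightarrow> (real^('m amb_coord) \<Rightarrow> real) \<Rightarrow> bool" where
  "eqv k f g \<longleftrightarrow> smooth_on S f \<and> smooth_on S g \<and> vanishes S k (\<lambda>P. f P - g P)"

lemma eqv_refl: "smooth_on S f \<Longrightarrow> eqv k f f"
  by (simp add: eqv_def vanishes_zero)

lemma eqv_add: "eqv k f f' \<Longrightarrow> eqv k g g' \<Longrightarrow> eqv k (\<lambda>P. f P + g P) (\<lambda>P. f' P + g' P)"
  using vanishes_add[of k "\<lambda>P. f P - f' P" "\<lambda>P. g P - g' P"]
  by (auto simp: eqv_def algebra_simps intro: smooth_on_add S)

lemma eqv_diff: "eqv k f f' \<Longrightarrow> eqv k g g' \<Longrightarrow> eqv k (\<lambda>P. f P - g P) (\<lambda>P. f' P - g' P)"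
  using vanishes_diff[of k "\<lambda>P. f P - f' P" "\<lambda>P. g P - g' P"]
  by (auto simp: eqv_def algebra_simps intro: smooth_on_diff S)

lemma eqv_mult:
  assumes "eqv k f f'" "eqv k g g'"
  shows "eqv k (\<lambda>P. f P * g P) (\<lambda>P. f' P * g' P)"
proof -
  have sm: "smooth_on S f" "smooth_on S f'" "smooth_on S g" "smooth_on S g'"
    and v: "vanishes S k (\<lambda>P. f P - f' P)" "vanishes S k (\<lambda>P. g P - g' P)"
    using assms by (auto simp: eqv_def)
  from vanishes_add[OF vanishes_mult[OF v(1) sm(3)] vanishes_mult[OF v(2) sm(2)]]
  have "vanishes S k (\<lambda>P. f P * g P - f' P * g' P)" by (simp add: algebra_simps)
  then show ?thesis using sm by (auto simp: eqv_def intro: smooth_on_mult S)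
qed

lemma eqv_sum:
  assumes "\<And>a. a \<in> A \<Longrightarrow> eqv k (f a) (f' a)"
  shows "eqv k (\<lambda>P. \<Sum>a\<in>A. f a P) (\<lambda>P. \<Sum>a\<in>A. f' a P)"
  using vanishes_sum[of A k "\<lambda>a P. f a P - f' a P"] assms
  by (auto simp: eqv_def sum_subtractf intro!: smooth_on_sum S)

lemma eqv_divide: "eqv k f f' \<Longrightarrow> eqv k (\<lambda>P. f P / c) (\<lambda>P. f' P / c)"
  using eqv_mult[OF _ eqv_refl[OF smooth_on_const], of k f f' "inverse c"] by (simp add: divide_inverse)

lemma vanishes_partial_diff:
  assumes "smooth_on S f" "smooth_on S g" "vanishes S k (partial i (\<lambda>P. f P - g P))"
  shows "vanishes S k (\<lambda>P. partial i f P - partial i g P)"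
  by (rule vanishes_cong[OF _ assms(3)])
    (intro partial_diff smooth_on_differentiable[OF _ S] assms)

lemma eqv_partial: "i \<noteq> Crho \<Longrightarrow> eqv k f g \<Longrightarrow> eqv k (partial i f) (partial i g)"
  unfolding eqv_def by (auto intro: smooth_on_partial vanishes_partial_diff vanishes_partial)

lemma eqv_partial_rho: "eqv (Suc k) f g \<Longrightarrow> eqv k (partial Crho f) (partial Crho g)"
  unfolding eqv_def by (auto intro: smooth_on_partial vanishes_partial_diff)

lemma eqv_Suc: "eqv (Suc k) f g \<Longrightarrow> eqv k f g"
  unfolding eqv_def using vanishes_SucD by blast

lemmas eqv_intros = eqv_add eqv_diff eqv_mult eqv_sum eqv_divide eqv_refl

end

section \<open>Comparison of two ambient metrics\<close>

context normal_form
begin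

definition Ric :: "'m \<Rightarrow> 'm \<Rightarrow> real^('m amb_coord) \<Rightarrow> real" where
  "Ric a b P = ricci (amb g h) P $ Cm a $ Cm b"

definition Ric_rho :: "real^('m amb_coord) \<Rightarrow> real" where
  "Ric_rho P = ricci (amb g h) P $ Crho $ Crho"

text \<open>The quadratic terms, which enter \<open>Ric\<close> with the factor \<rho>/2.\<close>

definition Q :: "'m \<Rightarrow> 'm \<Rightarrow> real^('m amb_coord) \<Rightarrow> real" where
  "Q a b P = (\<Sum>c\<in>UNIV. W c c P) * partial Crho (G a b) P
     - (\<Sum>c\<in>UNIV. partial Crho (G b c) P * W c a P) - (\<Sum>c\<in>UNIV. W c b P * partial Crho (G a c) P)"

lemma Ric_eq: "P \<in> S \<Longrightarrow> Ric a b P =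
    P $ Crho * partial Crho (partial Crho (G a b)) P + (1 - real CARD('m) / 2) * partial Crho (G a b) P
    - (\<Sum>c\<in>UNIV. W c c P) * G a b P / 2 + P $ Crho * Q a b P / 2 + base_ricci a b P"
  by (simp add: Ric_def Q_def ricci_Cm_Cm)

lemma smooth_on_Q: "smooth_on S (Q a b)"
  unfolding Q_def[abs_def] by (intro smooth_intros open_S smooth_on_W smooth_on_G)

lemma smooth_on_base_ricci: "smooth_on S (base_ricci a b)"
  unfolding base_ricci_def[abs_def] by (intro smooth_intros open_S smooth_on_Gam)

lemma smooth_on_Ric: "smooth_on S (Ric a b)"
proof (rule smooth_on_cong[OF open_S Ric_eq[symmetric]])
  show "smooth_on S (\<lambda>P. P $ Crho * partial Crho (partial Crho (G a b)) P
    + (1 - real CARD('m) / 2) * partial Crho (G a b) P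
    - (\<Sum>c\<in>UNIV. W c c P) * G a b P / 2 + P $ Crho * Q a b P / 2 + base_ricci a b P)"
    by (intro smooth_intros open_S smooth_on_W smooth_on_G smooth_on_Q smooth_on_base_ricci) simp_all
qed

lemma smooth_on_Ric_rho: "smooth_on S Ric_rho"
proof (rule smooth_on_cong[OF open_S])
  show "- (\<Sum>c\<in>UNIV. partial Crho (W c c) P / 2) - (\<Sum>c\<in>UNIV. \<Sum>d\<in>UNIV. W c d P * W d c P / 4) = Ric_rho P"
    if "P \<in> S" for P using ricci_Crho_Crho[OF that] by (simp add: Ric_rho_def)
  show "smooth_on S (\<lambda>P. - (\<Sum>c\<in>UNIV. partial Crho (W c c) P / 2)
    - (\<Sum>c\<in>UNIV. \<Sum>d\<in>UNIV. W c d P * W d c P / 4))"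
    by (intro smooth_intros open_S smooth_on_W) simp_all
qed

end

locale normal_form_pair = A: normal_form g h S + B: normal_form g h' S
  for g :: "'m::finite metric" and h h' S
begin

definition D :: "'m \<Rightarrow> 'm \<Rightarrow> real^('m amb_coord) \<Rightarrow> real" where
  "D a b P = A.G a b P - B.G a b P"

lemmas oS = A.open_S
lemmas smooths = A.smooth_on_G B.smooth_on_G A.smooth_on_Ginv B.smooth_on_Ginv A.smooth_on_W
  B.smooth_on_W
  A.smooth_on_Gam B.smooth_on_Gam A.smooth_on_Q B.smooth_on_Q A.smooth_on_base_ricci
    B.smooth_on_base_ricci
  A.smooth_on_Ric B.smooth_on_Ric A.smooth_on_Ric_rho B.smooth_on_Ric_rho

lemma smooth_on_D: "smooth_on S (D a b)"
  unfolding D_def[abs_def] by (intro smooth_intros oS smooths)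

lemma partial_D: "P \<in> S \<Longrightarrow> partial i (D a b) P = partial i (A.G a b) P - partial i (B.G a b) P"
  unfolding D_def[abs_def] by (intro partial_diff smooth_on_differentiable[OF _ oS] smooths)

lemma partial_partial_D:
  assumes "P \<in> S"
  shows "partial j (partial i (D a b)) P = partial j (partial i (A.G a b)) P
    - partial j (partial i (B.G a b)) P"
proof -
  have "partial j (partial i (D a b)) P = partial j (\<lambda>P. partial i (A.G a b) P
    - partial i (B.G a b) P) P"
    by (rule partial_cong[OF oS assms]) (rule partial_D)
  also have "\<dots> = partial j (partial i (A.G a b)) P - partial j (partial i (B.G a b)) P"
    by (intro partial_diff smooth_on_differentiable[OF _ oS] smooth_on_partial smooths assms)
  finally show ?thesis .
qed

section \<open>Two metrics that agree modulo \<rho>^(j+1)\<close>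

context
  fixes j :: nat
  assumes v: "eqv S (Suc j) (A.G a b) (B.G a b)"
begin

lemma vD: "vanishes S (Suc j) (D a b)"
  using v unfolding eqv_def[OF oS] D_def[abs_def] by simp

lemma vdD: "vanishes S j (partial Crho (D a b))"
  using vD by simp

text \<open>From A^(-1) - B^(-1) = - A^(-1) (A - B) B^(-1), where A - B is \<open>D\<close>.\<close>

lemma eqv_Ginv: "eqv S (Suc j) (A.Ginv a b) (B.Ginv a b)"
proof -
  have "vanishes S (Suc j) (\<lambda>P. \<Sum>c\<in>UNIV. \<Sum>d\<in>UNIV. D c d P * (- A.Ginv a c P * B.Ginv d b P))"
    by (intro vanishes_sum vanishes_mult oS vD smooth_intros smooths)
  moreover have "(\<Sum>c\<in>UNIV. \<Sum>d\<in>UNIV. D c d P * (- A.Ginv a c P * B.Ginv d b P))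
    = A.Ginv a b P - B.Ginv a b P"
    if P: "P \<in> S" for P
  proof -
    have "(\<Sum>c\<in>UNIV. \<Sum>d\<in>UNIV. D c d P * (- A.Ginv a c P * B.Ginv d b P))
        = (\<Sum>c\<in>UNIV. \<Sum>d\<in>UNIV. A.Ginv a c P * (B.G c d P * B.Ginv d b P))
          - (\<Sum>c\<in>UNIV. \<Sum>d\<in>UNIV. A.Ginv a c P * A.G c d P * B.Ginv d b P)"
      by (simp add: D_def algebra_simps sum_subtractf)
    also have "(\<Sum>c\<in>UNIV. \<Sum>d\<in>UNIV. A.Ginv a c P * A.G c d P * B.Ginv d b P) = B.Ginv a b P"
      by (subst sum.swap) (simp add: sum_distrib_right[symmetric] A.contract[OF P] if_zero_simps)
    also have "(\<Sum>c\<in>UNIV. \<Sum>d\<in>UNIV. A.Ginv a c P * (B.G c d P * B.Ginv d b P)) = A.Ginv a b P"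
      by (simp add: sum_distrib_left[symmetric] B.contract[OF P] if_zero_simps)
    finally show ?thesis .
  qed
  ultimately have "vanishes S (Suc j) (\<lambda>P. A.Ginv a b P - B.Ginv a b P)"
    by (rule vanishes_cong[OF oS, rotated])
  then show ?thesis by (simp add: eqv_def[OF oS] smooths)
qed

lemma eqv_W: "eqv S j (A.W a b) (B.W a b)"
  unfolding A.W_def[abs_def] B.W_def[abs_def]
  by (intro eqv_sum eqv_mult oS eqv_Suc[OF oS eqv_Ginv] eqv_partial_rho v)

text \<open>\<open>eqv_W\<close> loses one order, too much for reading off a coefficient of order
  \<open>j\<close>. The refinement isolates A^(-1) D'; the remainder (A^(-1) - B^(-1)) B' contains
  no derivative of \<open>D\<close> and keeps the full order.\<close>

lemma vanishes_W_diff: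
  "vanishes S (Suc j) (\<lambda>P. A.W a b P - B.W a b P - (\<Sum>c\<in>UNIV. partial Crho (D c b) P * A.Ginv a c P))"
proof (rule vanishes_cong[OF oS])
  show "vanishes S (Suc j) (\<lambda>P. \<Sum>c\<in>UNIV. (A.Ginv a c P - B.Ginv a c P) * partial Crho (B.G c b) P)"
    using eqv_Ginv unfolding eqv_def[OF oS]
    by (intro vanishes_sum vanishes_mult oS smooth_intros smooths) auto
  show "(\<Sum>c\<in>UNIV. (A.Ginv a c P - B.Ginv a c P) * partial Crho (B.G c b) P)
      = A.W a b P - B.W a b P - (\<Sum>c\<in>UNIV. partial Crho (D c b) P * A.Ginv a c P)" if "P \<in> S" for P
    by (simp add: A.W_def B.W_def partial_D[OF that] algebra_simps sum_subtractf)
qed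

lemma eqv_Gam: "eqv S (Suc j) (A.Gam c a b) (B.Gam c a b)"
  unfolding A.Gam_def[abs_def] B.Gam_def[abs_def]
  by (intro eqv_intros oS eqv_Ginv eqv_partial v) auto

lemma eqv_base_ricci: "eqv S (Suc j) (A.base_ricci a b) (B.base_ricci a b)"
  unfolding A.base_ricci_def[abs_def] B.base_ricci_def[abs_def]
  by (intro eqv_intros oS eqv_Gam eqv_partial) auto

lemma eqv_Q: "eqv S j (A.Q a b) (B.Q a b)"
  unfolding A.Q_def[abs_def] B.Q_def[abs_def]
  by (intro eqv_intros oS eqv_W eqv_partial_rho v)

text \<open>On \<rho> = 0 this is (j+1)! times the trace of the coefficient of \<rho>^(j+1) in the
  difference.\<close>

definition tau :: "real^('m amb_coord) \<Rightarrow> real" where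
  "tau P = (\<Sum>c\<in>UNIV. \<Sum>d\<in>UNIV. rho_deriv (Suc j) (D d c) P * A.Ginv c d P)"

lemma rho_deriv_trace:
  assumes P: "P \<in> S" "P $ Crho = 0" and f: "smooth_on S f"
  shows "rho_deriv j (\<lambda>P. (\<Sum>c\<in>UNIV. \<Sum>d\<in>UNIV. partial Crho (D d c) P * A.Ginv c d P) * f P) P
    = tau P * f P"
proof -
  have "vanishes S j (\<lambda>P. \<Sum>c\<in>UNIV. \<Sum>d\<in>UNIV. partial Crho (D d c) P * A.Ginv c d P)"
    by (intro vanishes_sum vanishes_mult vdD oS smooths)
  moreover have "rho_deriv j (\<lambda>P. \<Sum>c\<in>UNIV. \<Sum>d\<in>UNIV. partial Crho (D d c) P * A.Ginv c d P) P
      = (\<Sum>c\<in>UNIV. \<Sum>d\<in>UNIV. rho_deriv j (\<lambda>P. partial Crho (D d c) P * A.Ginv c d P) P)"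
    by (subst rho_deriv_sum[OF oS _ P(1)]; (intro sum.cong refl)?)
      (auto intro!: smooth_intros oS smooths smooth_on_D rho_deriv_sum[OF oS _ P(1)])
  moreover have "\<dots> = tau P"
    unfolding tau_def by (intro sum.cong refl)
      (simp add: rho_deriv_mult[OF oS P vdD A.smooth_on_Ginv] funpow_swap1)
  ultimately show ?thesis by (simp add: rho_deriv_mult[OF oS P _ f])
qed

text \<open>In \<open>Ric_eq\<close> three terms see the leading coefficient: \<rho> D'' contributes
  the factor j, the first-order term the factor 1 - n/2, and the trace of \<open>W\<close>
  contributes \<open>tau\<close>. All other terms agree modulo \<rho>^(j+1) and are collected in
  \<open>R\<close>.\<close>

lemma rho_deriv_Ric_diff:
  assumes P: "P \<in> S" "P $ Crho = 0"
  shows "rho_deriv j (A.Ric a b) P - rho_deriv j (B.Ric a b) P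
    = (real (Suc j) - real CARD('m) / 2) * rho_deriv (Suc j) (D a b) P - tau P * A.G a b P / 2"
proof -
  define E where "E P = P $ Crho * partial Crho (partial Crho (D a b)) P" for P
  define X where "X P = (\<Sum>c\<in>UNIV. \<Sum>d\<in>UNIV. partial Crho (D d c) P * A.Ginv c d P) * A.G a b P" for P
  define Z where "Z P = (1 - real CARD('m) / 2) * partial Crho (D a b) P" for P
  define R where "R P = (- 1 / 2) * (\<Sum>c\<in>UNIV. (A.W c c P - B.W c c P
    - (\<Sum>d\<in>UNIV. partial Crho (D d c) P * A.Ginv c d P)) * A.G a b P)
     + (- 1 / 2) * (D a b P * (\<Sum>c\<in>UNIV. B.W c c P)) + (1 / 2) * (P $ Crho * (A.Q a b P - B.Q a b P))
     + (A.base_ricci a b P - B.base_ricci a b P)" for P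
  have sm: "smooth_on S E" "smooth_on S X" "smooth_on S Z"
    unfolding E_def X_def Z_def by (intro smooth_intros oS smooths smooth_on_D)+
  have vR: "vanishes S (Suc j) R"
    unfolding R_def using eqv_Q eqv_base_ricci unfolding eqv_def[OF oS]
    by (intro vanishes_add vanishes_cmult vanishes_sum vanishes_mult oS vanishes_W_diff
      vanishes_rho_mult vD smooth_intros smooths) auto
  \<comment> \<open>Written with the scalar -1 so that the rules for sums and multiples under
    \<open>rho_deriv\<close> apply.\<close>
  have eq: "A.Ric a b P + (-1) * B.Ric a b P = E P + (Z P + ((-1/2) * X P + R P))" if "P \<in> S" for P
  proof -
    have "(\<Sum>c\<in>UNIV. (A.W c c P - B.W c c P - (\<Sum>d\<in>UNIV. partial Crho
      (D d c) P * A.Ginv c d P)) * A.G a b P)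
      = ((\<Sum>c\<in>UNIV. A.W c c P) - (\<Sum>c\<in>UNIV. B.W c c P) - (\<Sum>c\<in>UNIV. \<Sum>d\<in>UNIV. partial Crho
        (D d c) P * A.Ginv c d P)) * A.G a b P"
      by (simp only: sum_subtractf sum_distrib_right[symmetric])
    then show ?thesis
      unfolding A.Ric_eq[OF that] B.Ric_eq[OF that] E_def X_def Z_def R_def
        partial_D[OF that, of _ a b] partial_partial_D[OF that] D_def[of a b]
      by (simp add: field_simps)
  qed
  have "rho_deriv j (\<lambda>P. A.Ric a b P + (-1) * B.Ric a b P) P
      = rho_deriv j (\<lambda>P. E P + (Z P + ((-1/2) * X P + R P))) P"
    by (rule rho_deriv_cong[OF oS eq P(1)])
  moreover have "rho_deriv j (\<lambda>P. A.Ric a b P + (-1) * B.Ric a b P) P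
    = rho_deriv j (A.Ric a b) P - rho_deriv j (B.Ric a b) P"
    by (subst rho_deriv_add[OF oS _ _ P(1)])
      (auto simp: rho_deriv_cmult[OF oS B.smooth_on_Ric P(1), of j
        "-1", simplified] intro!: smooth_on_minus oS smooths)
  moreover have "rho_deriv j (\<lambda>P. E P + (Z P + ((-1/2) * X P + R P))) P
      = rho_deriv j E P + (rho_deriv j Z P + (rho_deriv j (\<lambda>P. (-1/2) * X P) P + rho_deriv j R P))"
  proof -
    note smR = vanishes_smooth[OF vR]
    have 1: "smooth_on S (\<lambda>P. (-1/2) * X P)" by (intro smooth_intros oS sm)
    have 2: "smooth_on S (\<lambda>P. (-1/2) * X P + R P)" by (intro smooth_on_add oS 1 smR)
    have 3: "smooth_on S (\<lambda>P. Z P + ((-1/2) * X P + R P))" by (intro smooth_on_add oS sm 2)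
    show ?thesis
      by (simp only: rho_deriv_add[OF oS sm(1) 3 P(1)] rho_deriv_add[OF oS sm(3) 2 P(1)]
        rho_deriv_add[OF oS 1 smR P(1)])
  qed
  moreover have "rho_deriv j R P = 0" using vR P unfolding vanishes_iff by blast
  moreover have "rho_deriv j (\<lambda>P. (-1/2) * X P) P = - (tau P * A.G a b P / 2)"
    unfolding rho_deriv_cmult[OF oS sm(2) P(1)] unfolding X_def
    using rho_deriv_trace[OF P A.smooth_on_G] by simp
  moreover have "rho_deriv j Z P = (1 - real CARD('m) / 2) * rho_deriv (Suc j) (D a b) P"
    unfolding Z_def rho_deriv_cmult[OF oS smooth_on_partial[OF smooth_on_D] P(1)]
      by (simp add: funpow_swap1)
  moreover have "rho_deriv j E P = real j * rho_deriv (Suc j) (D a b) P"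
  proof (cases j)
    case 0 then show ?thesis by (simp add: E_def P)
  next
    case (Suc i)
    then show ?thesis unfolding E_def
      using rho_deriv_rho_mult[OF oS _ P(1), of "partial Crho (partial Crho (D a b))" i] P(2)
      by (simp add: smooth_on_partial smooth_on_D funpow_swap1)
  qed
  ultimately show ?thesis by (simp add: algebra_simps)
qed

text \<open>The component equals -(tr W)'/2 - tr(W^2)/4. Its quadratic part agrees modulo \<rho>^j,
  so the derivative of order j - 1 sees only the trace, with a factor that is never zero.\<close>

lemma rho_deriv_Ric_rho_diff:
  assumes P: "P \<in> S" "P $ Crho = 0" and j: "j = Suc i"
  shows "rho_deriv i A.Ric_rho P - rho_deriv i B.Ric_rho P = - tau P / 2"
proof -
  define X where "X P = (\<Sum>c\<in>UNIV. A.W c c P - B.W c c P)" for P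
  define R where "R P = (\<Sum>c\<in>UNIV. \<Sum>d\<in>UNIV. A.W c d P * A.W d c P)
    - (\<Sum>c\<in>UNIV. \<Sum>d\<in>UNIV. B.W c d P * B.W d c P)" for P
  have smX: "smooth_on S X" unfolding X_def by (intro smooth_intros oS smooths)
  have "eqv S j (\<lambda>P. \<Sum>c\<in>UNIV. \<Sum>d\<in>UNIV. A.W c d P * A.W d c P)
    (\<lambda>P. \<Sum>c\<in>UNIV. \<Sum>d\<in>UNIV. B.W c d P * B.W d c P)"
    by (intro eqv_sum eqv_mult oS eqv_W)
  then have vR: "vanishes S j R" unfolding R_def[abs_def] eqv_def[OF oS] by simp
  have dX: "partial Crho X P = (\<Sum>c\<in>UNIV. partial Crho (A.W c c) P
    - partial Crho (B.W c c) P)" if "P \<in> S" for P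
    unfolding X_def[abs_def]
    by (subst partial_sum, (intro smooth_on_differentiable[OF _ oS that] smooth_intros oS smooths),
        intro sum.cong refl partial_diff smooth_on_differentiable[OF _ oS that] smooths)
  have eq: "A.Ric_rho P + (-1) * B.Ric_rho P = (-1/2) * partial Crho X P
    + (-1/4) * R P" if "P \<in> S" for P
    using A.ricci_Crho_Crho[OF that] B.ricci_Crho_Crho[OF that]
    by (simp add: A.Ric_rho_def B.Ric_rho_def dX[OF that] R_def sum_subtractf sum_divide_distrib
      diff_divide_distrib)
  have "rho_deriv i (\<lambda>P. A.Ric_rho P + (-1) * B.Ric_rho P) P
    = rho_deriv i (\<lambda>P. (-1/2) * partial Crho X P + (-1/4) * R P) P"
    by (rule rho_deriv_cong[OF oS eq P(1)])
  moreover have "rho_deriv i (\<lambda>P. A.Ric_rho P + (-1) * B.Ric_rho P) P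
    = rho_deriv i A.Ric_rho P - rho_deriv i B.Ric_rho P"
    by (subst rho_deriv_add[OF oS _ _ P(1)])
      (auto simp: rho_deriv_cmult[OF oS B.smooth_on_Ric_rho P(1), of i
        "-1", simplified] intro!: smooth_on_minus oS smooths)
  moreover have "rho_deriv i (\<lambda>P. (-1/2) * partial Crho X P + (-1/4) * R P) P
    = (-1/2) * rho_deriv j X P + (-1/4) * rho_deriv i R P"
  proof -
    note smR = vanishes_smooth[OF vR]
    have "smooth_on S (\<lambda>P. (-1/2) * partial Crho X P)" "smooth_on S (\<lambda>P. (-1/4) * R P)"
      by (intro smooth_intros oS smX smR)+
    note rho_deriv_add[OF oS this P(1)]
    moreover note rho_deriv_cmult[OF oS smooth_on_partial[OF smX] P(1), of i "-1/2" Crho]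
    moreover note rho_deriv_cmult[OF oS smR P(1), of i "-1/4"]
    moreover have "rho_deriv i (partial Crho X) = rho_deriv j X" by (simp add: j funpow_swap1)
    ultimately show ?thesis by (simp only:)
  qed
  moreover have "rho_deriv i R P = 0" using vR P unfolding vanishes_iff j by blast
  moreover have "rho_deriv j X P = tau P"
  proof -
    have "vanishes S (Suc j) (\<lambda>P. \<Sum>c\<in>UNIV. A.W c c P - B.W c c P
      - (\<Sum>d\<in>UNIV. partial Crho (D d c) P * A.Ginv c d P))"
      by (intro vanishes_sum oS vanishes_W_diff)
    then have "rho_deriv j (\<lambda>P. \<Sum>c\<in>UNIV. A.W c c P - B.W c c P
      - (\<Sum>d\<in>UNIV. partial Crho (D d c) P * A.Ginv c d P)) P = 0"
      using P unfolding vanishes_iff by blast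
    moreover have "rho_deriv j X P = rho_deriv j (\<lambda>P. (\<Sum>c\<in>UNIV. A.W c c P - B.W c c P
      - (\<Sum>d\<in>UNIV. partial Crho (D d c) P * A.Ginv c d P))
        + (\<Sum>c\<in>UNIV. \<Sum>d\<in>UNIV. partial Crho (D d c) P * A.Ginv c d P) * 1) P"
      by (rule rho_deriv_cong[OF oS _ P(1)]) (simp add: X_def sum_subtractf)
    moreover have "\<dots> = rho_deriv j (\<lambda>P. \<Sum>c\<in>UNIV. A.W c c P - B.W c c P
      - (\<Sum>d\<in>UNIV. partial Crho (D d c) P * A.Ginv c d P)) P
        + rho_deriv j (\<lambda>P. (\<Sum>c\<in>UNIV. \<Sum>d\<in>UNIV. partial Crho (D d c) P * A.Ginv c d P) * 1) P"
      by (intro rho_deriv_add[OF oS _ _ P(1)] smooth_intros oS smooths smooth_on_D)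
    ultimately show ?thesis using rho_deriv_trace[OF P smooth_on_const, of 1] by simp
  qed
  ultimately show ?thesis by simp
qed

lemma trace_eq:
  assumes P: "P \<in> S" and eq: "\<And>a b. z * rho_deriv (Suc j) (D a b) P = y * A.G a b P"
  shows "z * tau P = y * CARD('m)"
proof -
  have "z * tau P = (\<Sum>c\<in>UNIV. \<Sum>d\<in>UNIV. z * rho_deriv (Suc j) (D d c) P * A.Ginv c d P)"
    by (simp add: tau_def sum_distrib_left mult.assoc)
  also have "\<dots> = (\<Sum>c\<in>UNIV. y * (\<Sum>d\<in>UNIV. A.Ginv c d P * A.G d c P))"
    unfolding eq by (simp add: sum_distrib_left mult_ac)
  finally show ?thesis by (simp add: A.contract[OF P])
qed

text \<open>Let \<open>\<phi>\<close> be the coefficient of \<open>\<rho>\<^bsup>j+1\<^esup>\<close> in the difference of two metrics that agree to lower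
  order. To leading order the tangential Ricci tensors differ by a multiple of
  \<open>(j + 1 - n/2) \<phi> - (tr \<phi>) g / 2\<close>. Its trace determines \<open>tr \<phi>\<close> unless \<open>j + 1 = n\<close>, where the
  \<open>\<rho>\<rho>\<close>-component is used instead.\<close>

lemma eqv_step:
  assumes Ric: "\<And>P a b. P \<in> S \<Longrightarrow> P $ Crho = 0 \<Longrightarrow> rho_deriv j (A.Ric a b) P = rho_deriv j (B.Ric a b) P"
    and n: "2 * Suc j \<noteq> CARD('m)"
    and Ric_rho: "Suc j = CARD('m) \<Longrightarrow> \<exists>i. j = Suc i \<and>
      (\<forall>P\<in>S. P $ Crho = 0 \<longrightarrow> rho_deriv i A.Ric_rho P = rho_deriv i B.Ric_rho P)"
  shows "eqv S (Suc (Suc j)) (A.G a b) (B.G a b)"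
proof -
  have "rho_deriv (Suc j) (D a b) P = 0" if P: "P \<in> S" "P $ Crho = 0" for P
  proof -
    have eq: "(real (Suc j) - real CARD('m) / 2) * rho_deriv (Suc j) (D a b) P
      = tau P / 2 * A.G a b P" for a b
      using rho_deriv_Ric_diff[OF P, of a b] Ric[OF P] by simp
    have "tau P = 0"
    proof (cases "Suc j = CARD('m)")
      case True
      with Ric_rho obtain i where "j = Suc i" "rho_deriv i A.Ric_rho P = rho_deriv i B.Ric_rho P"
        using P by blast
      then show ?thesis using rho_deriv_Ric_rho_diff[OF P] by simp
    next
      case False
      from trace_eq[OF P(1) eq] have "(real (Suc j) - real CARD('m)) * tau P = 0"
        by (simp add: algebra_simps)
      with False show ?thesis by (metis eq_iff_diff_eq_0 mult_eq_0_iff of_nat_eq_iff)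
    qed
    with eq[of a b] have "(real (Suc j) - real CARD('m) / 2) * rho_deriv (Suc j) (D a b) P = 0" by simp
    moreover have "real (Suc j) - real CARD('m) / 2 \<noteq> 0"
    proof
      assume "real (Suc j) - real CARD('m) / 2 = 0"
      then have "real (2 * Suc j) = real CARD('m)" by simp
      with n show False by (simp only: of_nat_eq_iff)
    qed
    ultimately show ?thesis by simp
  qed
  then have "vanishes S (Suc (Suc j)) (D a b)"
    using vD[of a b] unfolding vanishes_iff by (simp only: less_Suc_eq[of _ "Suc j"]) blast
  then show ?thesis by (simp add: eqv_def[OF oS] D_def[abs_def] smooths)
qed

text \<open>At order \<open>n/2\<close> only the trace of \<open>\<phi>\<close> enters the tangential Ricci tensor.\<close>

lemma Ric_obstruction_eq:
  assumes P: "P \<in> S" "P $ Crho = 0" and n: "2 * Suc j = CARD('m)"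
    and tr: "(\<Sum>a\<in>UNIV. \<Sum>b\<in>UNIV. A.Ginv a b P * rho_deriv j (A.Ric a b) P) = 0"
      "(\<Sum>a\<in>UNIV. \<Sum>b\<in>UNIV. A.Ginv a b P * rho_deriv j (B.Ric a b) P) = 0"
  shows "rho_deriv j (A.Ric a b) P = rho_deriv j (B.Ric a b) P"
proof -
  have n': "real (Suc j) - real CARD('m) / 2 = 0" unfolding n[symmetric] by simp
  have eq: "rho_deriv j (A.Ric a b) P - rho_deriv j (B.Ric a b) P = - tau P / 2 * A.G a b P" for a b
    using rho_deriv_Ric_diff[OF P, of a b] unfolding n' by simp
  \<comment> \<open>Both traces vanish, so contracting \<open>eq\<close> with the inverse metric
    leaves 0 = -n \<open>tau P\<close> / 2.\<close>
  have "0 = (\<Sum>a\<in>UNIV. \<Sum>b\<in>UNIV. A.Ginv a b P * (rho_deriv j (A.Ric a b) P - rho_deriv j (B.Ric a b) P))"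
    using tr by (simp add: right_diff_distrib sum_subtractf)
  also have "\<dots> = (\<Sum>a\<in>UNIV. - tau P / 2 * (\<Sum>b\<in>UNIV. A.Ginv a b P * A.G b a P))"
    unfolding eq sum_distrib_left by (intro sum.cong refl) (simp add: A.G_sym[OF P(1)] mult_ac)
  finally have "tau P = 0" by (simp add: A.contract[OF P(1)])
  then show ?thesis using eq[of a b] by simp
qed

end

end

section \<open>Taylor coefficients\<close>

text \<open>Induction by l'Hospital's rule, replacing the family \<open>diff\<close> by its shift.
  The coefficient appears as a limit of quotients by r^k, the form in which the obstruction tensor
  is defined.\<close>

lemma tendsto_taylor_coefficient:
  fixes diff :: "nat \<Rightarrow> real \<Rightarrow> real"
  assumes "0 < \<epsilon>" "\<And>m r. \<bar>r\<bar> < \<epsilon> \<Longrightarrow> (diff m has_real_derivative diff (Suc m) r) (at r)"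
    "\<And>j. j < k \<Longrightarrow> diff j 0 = 0"
  shows "((\<lambda>r. diff 0 r / r ^ k) \<longlongrightarrow> diff k 0 / fact k) (at 0)"
  using assms(2,3)
proof (induction k arbitrary: diff)
  case 0
  have "isCont (diff 0) 0" using 0 assms(1) by (intro DERIV_isCont[of _ "diff 1 0"]) auto
  then show ?case by (simp add: isCont_def)
next
  case (Suc k)
  have near: "eventually (\<lambda>r. \<bar>r\<bar> < \<epsilon>) (at (0::real))"
    using assms(1) by (auto simp: eventually_at dist_real_def)
  have "isCont (diff 0) 0" using Suc.prems(1)[of 0 0] assms(1) by (auto intro: DERIV_isCont)
  then have c: "(diff 0 \<longlongrightarrow> 0) (at 0)" using Suc.prems(2)[of 0] by (simp add: isCont_def)
  show ?case
  proof (rule lhopital[OF c])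
    show "((\<lambda>r::real. r ^ Suc k) \<longlongrightarrow> 0) (at 0)" by (auto intro!: tendsto_eq_intros)
    have nz: "eventually (\<lambda>r::real. r \<noteq> 0) (at 0)" by (simp add: eventually_at_filter)
    show "eventually (\<lambda>r::real. r ^ Suc k \<noteq> 0) (at 0)" using nz by eventually_elim simp
    show "eventually (\<lambda>r::real. real (Suc k) * r ^ k \<noteq> 0) (at 0)" using nz by eventually_elim simp
    show "eventually (\<lambda>r. (diff 0 has_real_derivative diff 1 r) (at r)) (at 0)"
      using near by eventually_elim (use Suc.prems(1)[of _ 0] in auto)
    show "eventually (\<lambda>r. ((\<lambda>r. r ^ Suc k) has_real_derivative real (Suc k) * r ^ k) (at r)) (at 0)"
    proof (intro always_eventually allI)
      show "((\<lambda>r. r ^ Suc k) has_real_derivative real (Suc k) * r ^ k) (at r)" for r :: real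
        using DERIV_pow[of "Suc k" r] by simp
    qed
    have "((\<lambda>r. diff 1 r / r ^ k) \<longlongrightarrow> diff (Suc k) 0 / fact k) (at 0)"
      using Suc.IH[of "\<lambda>m. diff (Suc m)"] Suc.prems by simp
    from tendsto_divide[OF this tendsto_const, of "real (Suc k)"]
    show "((\<lambda>r. diff 1 r / (real (Suc k) * r ^ k)) \<longlongrightarrow> diff (Suc k) 0 / fact (Suc k)) (at 0)"
      by (simp add: mult_ac del: of_nat_Suc)
  qed
qed

lemma rho_deriv_limit:
  fixes R :: "real^('m::finite amb_coord) \<Rightarrow> real"
  assumes M: "open M" and "0 < \<epsilon>" and sm: "smooth_on (amb_domain M \<epsilon>) R" and x: "x \<in> M" "0 < t"
    and z: "\<And>j. j < k \<Longrightarrow> rho_deriv j R (amb_point t x 0) = 0"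
  shows "((\<lambda>r. R (amb_point t x r) / r ^ k) \<longlongrightarrow> rho_deriv k R (amb_point t x 0) / fact k) (at 0)"
proof -
  have "((\<lambda>r. rho_deriv 0 R (amb_point t x r) / r ^ k) \<longlongrightarrow> rho_deriv k R (amb_point t x 0) / fact k)
    (at 0)"
  proof (rule tendsto_taylor_coefficient[where diff = "\<lambda>j r. rho_deriv j R
    (amb_point t x r)", OF assms(2) _ z])
    fix m and r :: real assume "\<bar>r\<bar> < \<epsilon>"
    then have "amb_point t x r \<in> amb_domain M \<epsilon>" using x by (simp add: amb_domain_def)
    then show "((\<lambda>r. rho_deriv m R (amb_point t x r)) has_real_derivative rho_deriv (Suc m) R
      (amb_point t x r)) (at r)"
      using has_real_derivative_rho[OF smooth_on_differentiable[OF smooth_on_rho_deriv[OF sm]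
        open_amb_domain[OF M]]]
      by simp
  qed
  then show ?thesis by simp
qed

lemma filterlim_amb_point:
  "filterlim (\<lambda>r. amb_point t x r) (at (amb_point t x 0) within {P. P $ Crho \<noteq> 0}) (at (0::real))"
proof -
  have "continuous_on UNIV (\<lambda>r. amb_point t x r)" by (intro continuous_intros)
  then have "((\<lambda>r. amb_point t x r) \<longlongrightarrow> amb_point t x 0) (at 0)"
    by (simp add: continuous_on_def)
  moreover have "eventually (\<lambda>r. amb_point t x r \<in> {P. P $ Crho \<noteq> 0} \<and> amb_point t x r \<noteq> amb_point t
    x 0) (at (0::real))"
  proof -
    have "amb_point t x r \<noteq> amb_point t x 0" if "r \<noteq> 0" for r
      using that by (metis amb_point_nth(2))
    then show ?thesis by (simp add: eventually_at_filter)
  qed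
  ultimately show ?thesis by (simp add: filterlim_at)
qed

text \<open>Once the lower derivatives vanish, the j-th one is j! times the limit of R/\<rho>^j, and
  the bound C |\<rho>|^(k-j) forces this limit to be 0.\<close>

lemma rho_deriv_zero_of_bigo:
  fixes R :: "real^('m::finite amb_coord) \<Rightarrow> real"
  assumes M: "open M" and "0 < \<epsilon>" and sm: "smooth_on (amb_domain M \<epsilon>) R" and x: "x \<in> M" "0 < t"
    and O: "R \<in> O[at (amb_point t x 0) within {P. P $ Crho \<noteq> 0}](\<lambda>P. (P $ Crho) ^ k)"
  shows "j < k \<Longrightarrow> rho_deriv j R (amb_point t x 0) = 0"
proof (induction j rule: less_induct)
  case (less j)
  from O obtain C where C: "eventually (\<lambda>P. norm (R P) \<le> C * norm ((P $ Crho) ^ k)) (at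
    (amb_point t x 0) within {P. P $ Crho \<noteq> 0})"
    by (elim landau_o.bigE)
  from this filterlim_amb_point[of t x] have "eventually (\<lambda>r. norm (R (amb_point t x r))
    \<le> C * norm ((amb_point t x r $ Crho) ^ k)) (at 0)"
    by (rule eventually_compose_filterlim)
  then have C': "eventually (\<lambda>r. \<bar>R (amb_point t x r)\<bar> \<le> C * \<bar>r\<bar> ^ k) (at 0)" by (simp add: power_abs)
  have "((\<lambda>r. R (amb_point t x r) / r ^ j) \<longlongrightarrow> rho_deriv j R (amb_point t x 0) / fact j) (at 0)"
    using less by (intro rho_deriv_limit[OF M assms(2) sm x]) auto
  moreover have "((\<lambda>r. R (amb_point t x r) / r ^ j) \<longlongrightarrow> 0) (at 0)"
  proof (rule Lim_null_comparison)
    have "eventually (\<lambda>r::real. r \<noteq> 0) (at 0)" by (simp add: eventually_at_filter)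
    with C' show "eventually (\<lambda>r. norm (R (amb_point t x r) / r ^ j) \<le> C * \<bar>r\<bar> ^ (k - j)) (at 0)"
    proof eventually_elim
      case (elim r)
      have "\<bar>r\<bar> ^ k = \<bar>r\<bar> ^ (k - j) * \<bar>r\<bar> ^ j" using less.prems by (simp flip: power_add)
      with elim show ?case by (simp add: power_abs divide_le_eq mult.assoc)
    qed
    show "((\<lambda>r::real. C * \<bar>r\<bar> ^ (k - j)) \<longlongrightarrow> 0) (at 0)"
      using less.prems by (auto intro!: tendsto_eq_intros simp: power_0_left)
  qed
  ultimately have "rho_deriv j R (amb_point t x 0) / fact j = 0"
    by (rule tendsto_unique[OF at_neq_bot])
  then show ?case by simp
qed

section \<open>Real analytic functions of one variable\<close>

lemma has_fps_expansion_real_limit: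
  fixes f :: "real \<Rightarrow> real"
  assumes "f has_fps_expansion F"
  shows "((\<lambda>s. f s / s ^ subdegree F) \<longlongrightarrow> fps_nth F (subdegree F)) (at 0)"
proof -
  let ?n = "subdegree F"
  have r: "fps_conv_radius F > 0" and ev: "eventually (\<lambda>z. eval_fps F z = f z) (nhds 0)"
    using assms by (auto simp: has_fps_expansion_def)
  have "isCont (eval_fps (fps_shift ?n F)) 0"
    using r by (intro continuous_eval_fps) (simp_all add: zero_ereal_def)
  then have "(eval_fps (fps_shift ?n F) \<longlongrightarrow> fps_nth F ?n) (at 0)"
    by (simp add: isCont_def eval_fps_at_0)
  moreover have "eventually (\<lambda>s. eval_fps (fps_shift ?n F) s = f s / s ^ ?n) (at 0)"
  proof -
    have "eventually (\<lambda>s. s \<in> eball 0 (fps_conv_radius F)) (nhds (0::real))"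
      using r by (intro eventually_nhds_in_open) (auto simp: zero_ereal_def)
    then have "eventually (\<lambda>s. s \<in> eball 0 (fps_conv_radius F)) (at (0::real))"
      by (rule eventually_nhds_conv_at[THEN iffD1, THEN conjunct1])
    moreover have "eventually (\<lambda>z. eval_fps F z = f z) (at 0)"
      using ev by (rule eventually_nhds_conv_at[THEN iffD1, THEN conjunct1])
    moreover have "eventually (\<lambda>s::real. s \<noteq> 0) (at 0)" by (simp add: eventually_at_filter)
    ultimately show ?thesis by eventually_elim (simp add: eval_fps_shift)
  qed
  ultimately show ?thesis by (rule Lim_transform_eventually)
qed

text \<open>For a nonzero expansion the quotient by the power of the leading term tends to a nonzero
  limit, so zeros cannot accumulate at \<open>r\<close>.\<close>

lemma real_analytic_dichotomy:
  fixes f :: "real \<Rightarrow> real"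
  assumes "(\<lambda>s. f (r + s)) has_fps_expansion F"
  shows "F = 0 \<Longrightarrow> eventually (\<lambda>s. f s = 0) (nhds r)" "F \<noteq> 0 \<Longrightarrow> eventually (\<lambda>s. f s \<noteq> 0) (at r)"
proof -
  assume "F = 0"
  then have "eventually (\<lambda>s. f (r + s) = 0) (nhds 0)" using assms
    by (auto simp: has_fps_expansion_def elim: eventually_mono)
  then show "eventually (\<lambda>s. f s = 0) (nhds r)"
    unfolding filtermap_nhds_shift[of "- r" 0, simplified, symmetric]
      by (simp add: eventually_filtermap add.commute)
next
  assume "F \<noteq> 0"
  then have "eventually (\<lambda>s. f (r + s) / s ^ subdegree F \<noteq> 0) (at 0)"
    using has_fps_expansion_real_limit[OF assms]
    by (intro tendsto_imp_eventually_ne) auto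
  then have "eventually (\<lambda>s. f (s + r) \<noteq> 0) (at 0)"
    by eventually_elim (auto simp: add.commute)
  then show "eventually (\<lambda>s. f s \<noteq> 0) (at r)" by (simp add: eventually_at_to_0[of _ r])
qed

text \<open>The points near which \<open>f\<close> is zero, and those having a punctured
  neighbourhood without zeros, form disjoint open sets that cover the interval. Flatness at 0 forces
  the leading coefficient there to vanish, which puts 0 into the first set; connectedness does the
  rest.\<close>

lemma real_analytic_identity:
  fixes f :: "real \<Rightarrow> real"
  assumes an: "\<And>r. \<bar>r\<bar> < d \<Longrightarrow> \<exists>F. (\<lambda>s. f (r + s)) has_fps_expansion F"
    and flat: "\<And>k. ((\<lambda>r. f r / r ^ k) \<longlongrightarrow> 0) (at 0)" and r: "\<bar>r\<bar> < d"
  shows "f r = 0"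
proof -
  define U where "U = {r. eventually (\<lambda>s. f s = 0) (nhds r)}"
  define V where "V = {r. eventually (\<lambda>s. f s \<noteq> 0) (at r)}"
  have oU: "open U"
    unfolding open_subopen[of U]
  proof
    fix x assume "x \<in> U"
    then obtain T where "open T" "x \<in> T" "\<And>y. y \<in> T \<Longrightarrow> f y = 0" by (auto simp: U_def eventually_nhds)
    then show "\<exists>T. open T \<and> x \<in> T \<and> T \<subseteq> U" by (auto simp: U_def eventually_nhds)
  qed
  have oV: "open V"
    unfolding open_subopen[of V]
  proof
    fix x assume "x \<in> V"
    then obtain T where T: "open T" "x \<in> T" "\<And>y. y \<in> T \<Longrightarrow> y \<noteq> x \<Longrightarrow> f y \<noteq> 0"
      by (auto simp: V_def eventually_at_topological)
    have "y \<in> V" if "y \<in> T" for y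
    proof (cases "y = x")
      case False
      then have "open (T - {x})" "y \<in> T - {x}" using T that by auto
      then show ?thesis unfolding V_def eventually_at_topological using T(3) by blast
    qed (use T in \<open>auto simp: V_def eventually_at_topological\<close>)
    with T show "\<exists>T. open T \<and> x \<in> T \<and> T \<subseteq> V" by blast
  qed
  have disj: "U \<inter> V = {}"
  proof (rule ccontr)
    assume "U \<inter> V \<noteq> {}"
    then obtain x where "eventually (\<lambda>s. f s = 0) (nhds x)" "eventually (\<lambda>s. f s \<noteq> 0) (at x)"
      by (auto simp: U_def V_def)
    then have "eventually (\<lambda>s. f s = 0) (at x)" "eventually (\<lambda>s. f s \<noteq> 0) (at x)"
      using eventually_nhds_conv_at by blast+
    then have "eventually (\<lambda>s. False) (at x)" by eventually_elim simp
    then show False by simp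
  qed
  have cover: "{-d<..<d} \<subseteq> U \<union> V"
  proof
    fix x assume "x \<in> {-d<..<d}"
    then have "\<bar>x\<bar> < d" by auto
    then show "x \<in> U \<union> V" using an real_analytic_dichotomy unfolding U_def V_def by blast
  qed
  have 0: "0 \<in> U"
  proof -
    have "\<bar>0\<bar> < d" using r by simp
    then obtain F where F: "(\<lambda>s. f (0 + s)) has_fps_expansion F" using an by blast
    have "F = 0"
    proof (rule ccontr)
      assume "F \<noteq> 0"
      have "((\<lambda>s. f s / s ^ subdegree F) \<longlongrightarrow> fps_nth F (subdegree F)) (at 0)"
        using has_fps_expansion_real_limit[OF F] by simp
      with flat have "fps_nth F (subdegree F) = 0" by (rule tendsto_unique[OF at_neq_bot, rotated])
      with \<open>F \<noteq> 0\<close> show False by simp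
    qed
    then show ?thesis using real_analytic_dichotomy(1)[OF F] by (simp add: U_def)
  qed
  have "U \<inter> {-d<..<d} = {} \<or> V \<inter> {-d<..<d} = {}"
    using disj cover by (intro connectedD[OF _ oU oV]) auto
  moreover have "0 \<in> U \<inter> {-d<..<d}" using 0 r by auto
  ultimately have "V \<inter> {-d<..<d} = {}" by blast
  moreover have "r \<in> {-d<..<d}" using r by auto
  ultimately have "r \<in> U" using cover by blast
  then show ?thesis by (auto simp: U_def dest: eventually_nhds_x_imp_x)
qed

text \<open>\<open>analytic_in_rho\<close> asks for an expansion about every point of the interval,
  not only about 0. The real series is extended to a holomorphic function on a complex disc, which
  is re-expanded about \<open>r\<close>.\<close>

lemma power_series_has_fps_expansion:
  fixes a :: "nat \<Rightarrow> real"
  assumes summ: "\<And>r. \<bar>r\<bar> < \<epsilon> \<Longrightarrow> summable (\<lambda>k. a k * r ^ k)" and r: "\<bar>r\<bar> < \<epsilon>"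
  shows "\<exists>F. (\<lambda>s. \<Sum>k. a k * (r + s) ^ k) has_fps_expansion F"
proof -
  define f where "f z = (\<Sum>k. complex_of_real (a k) * z ^ k)" for z
  have sums: "(\<lambda>k. complex_of_real (a k) * (w - 0) ^ k) sums f w" if "w \<in> ball 0 \<epsilon>" for w
  proof -
    have "norm w < \<epsilon>" using that by simp
    then obtain x where x: "norm w < x" "x < \<epsilon>" using dense by blast
    then have x0: "0 < x" using norm_ge_zero[of w] by linarith
    have "summable (\<lambda>k. complex_of_real (a k * x ^ k))"
      using summ[of x] x x0 by (intro summable_of_real) auto
    then have "summable (\<lambda>k. complex_of_real (a k) * complex_of_real x ^ k)" by simp
    from powser_inside[OF this, of w] x x0 have "summable (\<lambda>k. complex_of_real (a k) * w ^ k)" by simp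
    then show ?thesis by (simp add: f_def summable_sums)
  qed
  have fr: "f (of_real x) = of_real (\<Sum>k. a k * x ^ k)" if "\<bar>x\<bar> < \<epsilon>" for x
    unfolding f_def using suminf_of_real[OF summ[OF that], symmetric] by simp
  have "f \<circ> (\<lambda>x. of_real r + x) holomorphic_on ball 0 (\<epsilon> - \<bar>r\<bar>)"
  proof (rule holomorphic_on_compose_gen[OF _ power_series_holomorphic[OF sums]])
    show "(\<lambda>x. complex_of_real r + x) ` ball 0 (\<epsilon> - \<bar>r\<bar>) \<subseteq> ball 0 \<epsilon>"
    proof (rule image_subsetI)
      fix x :: complex assume "x \<in> ball 0 (\<epsilon> - \<bar>r\<bar>)"
      then show "complex_of_real r + x \<in> ball 0 \<epsilon>" using norm_triangle_ineq[of
        "complex_of_real r" x] by simp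
    qed
  qed (auto intro: holomorphic_intros)
  then obtain F where F: "(\<lambda>x. f (of_real r + x)) has_fps_expansion F"
    using has_fps_expansion_fps_expansion[of "ball 0 (\<epsilon> - \<bar>r\<bar>)"] r by (force simp: o_def)
  \<comment> \<open>The complex coefficients are not known to be real; taking real parts preserves
    the sum because the function is real on the real axis.\<close>
  define G where "G = Abs_fps (\<lambda>n. Re (fps_nth F n))"
  have rF: "fps_conv_radius F > 0" and ev: "eventually (\<lambda>z. eval_fps F z = f (of_real r + z)) (nhds 0)"
    using F by (auto simp: has_fps_expansion_def)
  obtain \<rho> where \<rho>: "0 < ereal \<rho>" "ereal \<rho> < fps_conv_radius F" using rF ereal_dense2 by blast
  have G: "(\<lambda>n. fps_nth G n * s ^ n) sums Re (eval_fps F (of_real s))" if "\<bar>s\<bar> \<le> \<rho>" for s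
  proof -
    have "norm (complex_of_real s) < fps_conv_radius F"
      using that \<rho>(2) by (metis ereal_less_eq(3) norm_of_real order_le_less_trans)
    from sums_Re[OF sums_eval_fps[OF this]] show ?thesis by (simp add: G_def)
  qed
  have "fps_conv_radius G \<ge> ereal (norm \<rho>)"
    unfolding fps_conv_radius_def using G[of \<rho>] \<rho>(1) by (intro conv_radius_geI) (auto simp: sums_iff)
  then have "ereal \<rho> \<le> fps_conv_radius G" using \<rho>(1) by simp
  with \<rho>(1) have rG: "0 < fps_conv_radius G" by (rule less_le_trans)
  have ev': "eventually (\<lambda>s. eval_fps F (complex_of_real s)
    = f (of_real r + of_real s)) (nhds (0::real))"
  proof -
    have "filterlim complex_of_real (nhds (of_real 0)) (nhds 0)"
      by (intro tendsto_of_real filterlim_ident)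
    then show ?thesis using eventually_compose_filterlim[of _ "nhds 0" complex_of_real, OF ev] by simp
  qed
  have "eventually (\<lambda>s. s \<in> {-\<rho><..<\<rho>} \<inter> {-\<epsilon>-r<..<\<epsilon>-r}) (nhds (0::real))"
    using \<rho>(1) r by (intro eventually_nhds_in_open) auto
  with ev' have "eventually (\<lambda>s. eval_fps G s = (\<Sum>k. a k * (r + s) ^ k)) (nhds 0)"
  proof eventually_elim
    case (elim s)
    have "f (of_real r + of_real s) = of_real (\<Sum>k. a k * (r + s) ^ k)"
      using fr[of "r + s"] elim by auto
    moreover have "eval_fps G s = Re (eval_fps F (of_real s))"
      unfolding eval_fps_def[of G] using G[of s] elim by (auto simp: sums_iff)
    ultimately show ?case using elim by simp
  qed
  then show ?thesis using rG unfolding has_fps_expansion_def by blast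
qed

section \<open>The radial operator\<close>

text \<open>The Ricci tensor involves \<open>b = - n\<close>; conjugation by \<open>\<rho>\<^bsup>n/2\<^esup>\<close> turns it into \<open>b = n\<close>.\<close>

definition amb_op :: "real \<Rightarrow> (real^('n::finite pp_coord amb_coord) \<Rightarrow> real) \<Rightarrow> real^('n pp_coord
  amb_coord) \<Rightarrow> real" where
  "amb_op b F P = P $ Crho * partial Crho (partial Crho F) P + (1 + b / 2) * partial Crho F P
      - (\<Sum>i\<in>UNIV. partial (Cm (Cx i)) (partial (Cm (Cx i)) F) P) / 2"

context
  fixes S :: "(real^('n::finite pp_coord amb_coord)) set"
  assumes S: "open S"
begin

lemma partial_partial_cong:
  assumes "P \<in> S" "\<And>Q. Q \<in> S \<Longrightarrow> f Q = g Q"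
  shows "partial i (partial j f) P = partial i (partial j g) P"
  by (rule partial_cong[OF S assms(1) partial_cong[OF S _ assms(2)]])

lemma amb_op_cong:
  assumes "P \<in> S" "\<And>Q. Q \<in> S \<Longrightarrow> f Q = g Q"
  shows "amb_op b f P = amb_op b g P"
proof -
  have "partial Crho f P = partial Crho g P" by (rule partial_cong[OF S assms])
  moreover have "partial i (partial j f) P = partial i (partial j g) P" for i j
    by (rule partial_partial_cong[OF assms])
  ultimately show ?thesis by (simp add: amb_op_def)
qed

lemma partial_partial_add:
  assumes "P \<in> S" "smooth_on S f" "smooth_on S g"
  shows "partial i (partial j (\<lambda>Q. f Q + g Q)) P = partial i (partial j f) P
    + partial i (partial j g) P"
proof -
  note d = smooth_on_differentiable[OF _ S]
  have "partial i (partial j (\<lambda>Q. f Q + g Q)) P = partial i (\<lambda>Q. partial j f Q + partial j g Q) P"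
    by (rule partial_cong[OF S assms(1)]) (intro partial_add d assms)
  also have "\<dots> = partial i (partial j f) P + partial i (partial j g) P"
    by (intro partial_add d smooth_on_partial assms)
  finally show ?thesis .
qed

lemma amb_op_add:
  assumes "P \<in> S" "smooth_on S f" "smooth_on S g"
  shows "amb_op b (\<lambda>Q. f Q + g Q) P = amb_op b f P + amb_op b g P"
  using partial_add[OF smooth_on_differentiable[OF assms(2) S assms(1)] smooth_on_differentiable[OF
    assms(3) S assms(1)]]
  by (simp add: amb_op_def partial_partial_add[OF assms] sum.distrib algebra_simps add_divide_distrib)

lemma smooth_on_amb_op: "smooth_on S f \<Longrightarrow> smooth_on S (amb_op b f)"
  unfolding amb_op_def[abs_def] by (intro smooth_intros S) auto

end

lemma partial_of_rho:
  assumes "(f has_real_derivative D) (at (P $ Crho))"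
  shows "partial i (\<lambda>P. f (P $ Crho)) P = (if i = Crho then D else 0)"
proof (cases "i = Crho")
  case True
  have "((\<lambda>s. f (P $ Crho + s)) has_real_derivative D) (at 0)"
    using assms DERIV_shift[of f D 0 "P $ Crho"] by (simp add: add.commute)
  then show ?thesis using True by (intro partialI) (simp add: axis_def)
next
  case False
  have "(P + s *\<^sub>R axis i 1) $ Crho = P $ Crho" for s using False by (simp add: axis_def)
  then have "partial i (\<lambda>P. f (P $ Crho)) P = 0" unfolding partial_def by (simp only: deriv_const)
  then show ?thesis using False by simp
qed

lemma partial_rho_power:
  "partial i (\<lambda>P. (P $ Crho) ^ k) P = (if i = Crho then real k * (P $ Crho) ^ (k - 1) else 0)"
  by (rule partial_of_rho) (use DERIV_pow[of k "P $ Crho"] in simp)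

text \<open>k (k + b/2) is the indicial polynomial, with roots 0 and n/2 for b = -n. The truncated
  subtraction in \<open>k - 1\<close> does no harm, as the factor k is 0 for k = 0.\<close>

lemma amb_op_monomial:
  assumes M: "open M" and c: "smooth_on M c" and P: "base_point P \<in> M"
  shows "amb_op b (\<lambda>P. c (base_point P) * (P $ Crho) ^ k) P
    = real k * (real k + b / 2) * c (base_point P) * (P $ Crho) ^ (k - 1)
      - laplacian c (base_point P) * (P $ Crho) ^ k / 2"
proof -
  let ?S = "{P. base_point P \<in> M}"
  have S: "open ?S" by (rule open_base_point_vimage[OF M])
  have PS: "P \<in> ?S" using P by simp
  note d = smooth_on_differentiable[OF _ S]
  have dr: "partial Crho (\<lambda>P. c (base_point P) * (P $ Crho) ^ k) Q
    = c (base_point Q) * (real k * (Q $ Crho) ^ (k - 1))"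
    if "smooth_on M c" "Q \<in> ?S" for Q k c
    using partial_mult[OF d[OF smooth_on_base_point[OF M that(1)] that(2)] d[OF smooth_on_power[OF S
      smooth_on_coord] that(2)]]
    by (simp add: partial_base_point partial_rho_power)
  have dx: "partial (Cm a) (\<lambda>P. c (base_point P) * (P $ Crho) ^ k) Q
    = partial a c (base_point Q) * (Q $ Crho) ^ k"
    if "smooth_on M c" "Q \<in> ?S" for Q a k c
    using partial_mult[OF d[OF smooth_on_base_point[OF M that(1)] that(2)] d[OF smooth_on_power[OF S
      smooth_on_coord] that(2)]]
    by (simp add: partial_base_point partial_rho_power)
  have "partial Crho (partial Crho (\<lambda>P. c (base_point P) * (P $ Crho) ^ k)) P
      = partial Crho (\<lambda>P. (real k * c (base_point P)) * (P $ Crho) ^ (k - 1)) P"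
    by (rule partial_cong[OF S PS]) (simp add: dr[OF c])
  also have "\<dots> = real k * c (base_point P) * (real (k - 1) * (P $ Crho) ^ (k - 1 - 1))"
    by (rule dr[OF _ PS]) (intro smooth_intros M c)
  finally have 2: "partial Crho (partial Crho (\<lambda>P. c (base_point P) * (P $ Crho) ^ k)) P
      = real k * c (base_point P) * (real (k - 1) * (P $ Crho) ^ (k - 1 - 1))" .
  have 3: "partial (Cm a) (partial (Cm a) (\<lambda>P. c (base_point P) * (P $ Crho) ^ k)) P
      = partial a (partial a c) (base_point P) * (P $ Crho) ^ k" for a
  proof -
    have "partial (Cm a) (partial (Cm a) (\<lambda>P. c (base_point P) * (P $ Crho) ^ k)) P
        = partial (Cm a) (\<lambda>P. partial a c (base_point P) * (P $ Crho) ^ k) P"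
      by (rule partial_cong[OF S PS]) (simp add: dx[OF c])
    also have "\<dots> = partial a (partial a c) (base_point P) * (P $ Crho) ^ k"
      by (rule dx[OF smooth_on_partial[OF c] PS])
    finally show ?thesis .
  qed
  have 4: "P $ Crho * (real k * c (base_point P) * (real (k - 1) * (P $ Crho) ^ (k - 1 - 1)))
     = real k * (real k - 1) * c (base_point P) * (P $ Crho) ^ (k - 1)"
  proof (cases k)
    case (Suc l)
    then show ?thesis by (cases l) auto
  qed simp
  show ?thesis
    unfolding amb_op_def 2 3 4 dr[OF c PS] by (simp add: laplacian_def sum_distrib_left algebra_simps)
qed

text \<open>The recurrence makes the sum telescope: the Laplacian of each term cancels against the
  radial part of the next, and only the Laplacian of the last term remains.\<close>

lemma amb_op_polynomial:
  assumes M: "open M" and c: "\<And>k. smooth_on M (c k)" and P: "base_point P \<in> M"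
    and rec: "\<And>k x. k < N \<Longrightarrow> x \<in> M \<Longrightarrow> laplacian (c k) x = (real k + 1) * (2 * real k + 2
      + b) * c (Suc k) x"
  shows "amb_op b (\<lambda>P. \<Sum>k\<le>N. c k (base_point P) * (P $ Crho) ^ k) P
    = - laplacian (c N) (base_point P) * (P $ Crho) ^ N / 2"
  using rec
proof (induction N)
  case 0
  show ?case using amb_op_monomial[OF M c P, of b 0 0] by simp
next
  case (Suc N)
  note S = open_base_point_vimage[OF M]
  have sm: "smooth_on {P. base_point P \<in> M} (\<lambda>P. c k (base_point P) * (P $ Crho) ^ k)" for k
    by (intro smooth_intros S smooth_on_base_point M c)
  have "amb_op b (\<lambda>P. \<Sum>k\<le>Suc N. c k (base_point P) * (P $ Crho) ^ k) P
     = amb_op b (\<lambda>P. \<Sum>k\<le>N. c k (base_point P) * (P $ Crho) ^ k) P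
       + amb_op b (\<lambda>P. c (Suc N) (base_point P) * (P $ Crho) ^ Suc N) P"
    unfolding sum.atMost_Suc by (rule amb_op_add[OF S _ smooth_on_sum[OF S sm] sm]) (simp add: P)
  also have "amb_op b (\<lambda>P. \<Sum>k\<le>N. c k (base_point P) * (P $ Crho) ^ k) P
      = - ((real N + 1) * (2 * real N + 2 + b) * c (Suc N) (base_point P)) * (P $ Crho) ^ N / 2"
    using Suc.IH[OF Suc.prems] Suc.prems[of N, OF _ P] by simp
  also have "amb_op b (\<lambda>P. c (Suc N) (base_point P) * (P $ Crho) ^ Suc N) P
      = (real N + 1) * (real N + 1 + b / 2) * c (Suc N) (base_point P) * (P $ Crho) ^ N
        - laplacian (c (Suc N)) (base_point P) * (P $ Crho) ^ Suc N / 2"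
    using amb_op_monomial[OF M c P, of b "Suc N" "Suc N"] by (simp add: add.commute)
  finally show ?case by (simp add: field_simps)
qed

lemma amb_op_power_series:
  assumes "open M" "\<And>k. smooth_on M (c k)"
    "\<And>k x. x \<in> M \<Longrightarrow> laplacian (c k) x = (real k + 1) * (2 * real k + 2 + b) * c (Suc k) x"
    "converges_smoothly M \<epsilon> c" "P \<in> amb_domain M \<epsilon>"
  shows "amb_op b (\<lambda>P. \<Sum>k. c k (base_point P) * (P $ Crho) ^ k) P = 0"
  using power_series_ambient_equation[OF assms] by (simp add: amb_op_def field_simps)

text \<open>The derivative is written as a multiple of \<open>half_power n r\<close> itself, so that smoothness follows by
  induction on the order.\<close>

lemma half_power_derivative:
  assumes "r \<noteq> 0"
  shows "(half_power n has_real_derivative real n / 2 * (half_power n r * inverse r)) (at r)"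
proof (cases "even n")
  case True
  then obtain k where n: "n = 2 * k" by blast
  have "half_power n = (\<lambda>r. r ^ k)" by (auto simp: half_power_def n)
  moreover have "real n / 2 * (r ^ k * inverse r) = real k * r ^ (k - Suc 0)"
    using assms by (cases k) (auto simp: n)
  ultimately show ?thesis by (simp only: DERIV_pow)
next
  case False
  define a where "a = real n / 2"
  have hp: "half_power n r = \<bar>r\<bar> powr a" for r using False by (simp add: half_power_def a_def)
  have pos: "((\<lambda>r. r powr a) has_real_derivative a * (r powr a * inverse r)) (at r)" if "r > 0" for r
    using has_real_derivative_powr[OF that, of a] that by (simp add: powr_diff divide_inverse)
  have "((\<lambda>r. \<bar>r\<bar> powr a) has_real_derivative a * (\<bar>r\<bar> powr a * inverse r)) (at r)"
  proof (cases "r > 0")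
    case True
    have "eventually (\<lambda>s. s \<in> {0<..}) (nhds r)" using True by (intro eventually_nhds_in_open) auto
    then have "eventually (\<lambda>s. s powr a = \<bar>s\<bar> powr a) (nhds r)" by eventually_elim simp
    from DERIV_cong_ev[OF refl this refl, of "a * (r powr a * inverse r)"] pos[OF True] True show
      ?thesis by simp
  next
    case False
    then have r: "r < 0" using assms by simp
    have "eventually (\<lambda>s. s \<in> {..<0}) (nhds r)" using r by (intro eventually_nhds_in_open) auto
    then have ev: "eventually (\<lambda>s. (-s) powr a = \<bar>s\<bar> powr a) (nhds r)" by eventually_elim simp
    have "((\<lambda>s. (-s) powr a) has_real_derivative (a * ((-r) powr a * inverse (-r))) * (-1)) (at r)"
      using r by (intro DERIV_chain2[where g = uminus, OF pos]) (auto intro!: derivative_eq_intros)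
    then show ?thesis using DERIV_cong_ev[OF refl ev refl] r by simp
  qed
  then show ?thesis by (simp add: hp[abs_def] a_def)
qed

lemma partial_half_power:
  assumes "P $ Crho \<noteq> 0"
  shows "partial i (\<lambda>P. half_power n (P $ Crho)) P
    = (if i = Crho then real n / 2 else 0) * (half_power n (P $ Crho) * inverse (P $ Crho))"
  using partial_of_rho[OF half_power_derivative[OF assms], of i n] by simp

lemma smooth_on_half_power:
  assumes "open S" "\<And>P. P \<in> S \<Longrightarrow> P $ Crho \<noteq> 0"
  shows "smooth_on S (\<lambda>P :: real^('m::finite amb_coord). half_power n (P $ Crho))"
proof -
  have d: "(\<lambda>P :: real^('m amb_coord). half_power n (P $ Crho)) differentiable_on S"
    unfolding differentiable_on_eq_differentiable_at[OF assms(1)]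
  proof
    fix P assume "P \<in> S"
    have "(half_power n) differentiable (at (P $ Crho))"
      using half_power_derivative[OF assms(2)[OF \<open>P \<in> S\<close>], of n] real_differentiable_def by blast
    from differentiable_chain_at[OF bounded_linear_imp_differentiable[OF bounded_linear_vec_nth] this]
    show "(\<lambda>P :: real^('m amb_coord). half_power n (P $ Crho)) differentiable (at P)"
      by (simp add: o_def)
  qed
  have inv: "diff_upto k S (\<lambda>P. inverse (P $ Crho))" for k
    using smooth_on_inverse[OF assms(1) smooth_on_coord assms(2)]
      by (auto simp: smooth_on_iff_diff_upto)
  have "diff_upto k S (\<lambda>P. half_power n (P $ Crho))" for k
  proof (induction k)
    case (Suc k)
    show ?case
    proof (rule diff_uptoI[OF assms(1) d])
      show "partial i (\<lambda>P. half_power n (P $ Crho)) P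
          = (if i = Crho then real n / 2 else 0) * (half_power n (P $ Crho) * inverse (P $ Crho))"
            if "P \<in> S" for i P
        by (rule partial_half_power[OF assms(2)[OF that]])
      show "diff_upto k S (\<lambda>P. (if i = Crho then real n / 2 else 0) * (half_power n
        (P $ Crho) * inverse (P $ Crho)))" for i
        by (intro diff_upto_mult diff_upto_const Suc inv assms(1))
    qed
  qed (use d in simp)
  then show ?thesis by (simp add: smooth_on_iff_diff_upto)
qed

text \<open>With a = n/2, the terms without derivatives of \<open>f\<close> carry the factor a(a-1)
  + (1-a)a = 0, since n/2 is an indicial root. The first-order coefficient changes from 1 - a to 2a
  + 1 - a = 1 + a.\<close>

lemma amb_op_half_power:
  fixes f :: "real^('n::finite pp_coord amb_coord) \<Rightarrow> real"
  assumes S: "open S" and ne: "\<And>P. P \<in> S \<Longrightarrow> P $ Crho \<noteq> 0" and f: "smooth_on S f" and P: "P \<in> S"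
  shows "amb_op (- real n) (\<lambda>P. half_power n (P $ Crho) * f P) P
    = half_power n (P $ Crho) * amb_op (real n) f P"
proof -
  define w where "w = (\<lambda>P :: real^('n pp_coord amb_coord). half_power n (P $ Crho))"
  define y where "y = (\<lambda>P :: real^('n pp_coord amb_coord). inverse (P $ Crho))"
  define a where "a = real n / 2"
  have w: "smooth_on S w" unfolding w_def by (rule smooth_on_half_power[OF S ne])
  have y: "smooth_on S y" unfolding y_def by (intro smooth_on_inverse S smooth_on_coord ne)
  note d = smooth_on_differentiable[OF _ S]
  have dw: "partial Crho w Q = a * (w Q * y Q)" if "Q \<in> S" for Q
    using partial_half_power[OF ne[OF that], of Crho n] by (simp add: w_def y_def a_def)
  have dwf: "partial Crho (\<lambda>P. w P * f P) Q = w Q * (a * y Q * f Q + partial Crho f Q)"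
    if "Q \<in> S" "smooth_on S f" for Q f
    using partial_mult[OF d[OF w that(1)] d[OF that(2,1)], of Crho] dw[OF that(1)]
      by (simp add: algebra_simps)
  have dy: "partial Crho y P = - (y P * y P)"
    unfolding y_def using partial_inverse[OF d[OF smooth_on_coord P] ne[OF P], of Crho]
      by (simp add: partial_coord)
  have sm1: "smooth_on S (\<lambda>P. a * y P * f P + partial Crho f P)" by (intro smooth_intros S y f)
  have "partial Crho (partial Crho (\<lambda>P. w P * f P)) P = partial Crho (\<lambda>Q. w Q * (a * y Q * f Q
    + partial Crho f Q)) P"
    by (rule partial_cong[OF S P]) (rule dwf[OF _ f])
  also have "\<dots> = w P * (a * y P * (a * y P * f P + partial Crho f P)
    + partial Crho (\<lambda>Q. a * y Q * f Q + partial Crho f Q) P)"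
    by (rule dwf[OF P sm1])
  also have "partial Crho (\<lambda>Q. a * y Q * f Q + partial Crho f Q) P
    = partial Crho (\<lambda>Q. a * y Q * f Q) P + partial Crho (partial Crho f) P"
    by (rule partial_add) (intro d[OF _ P] smooth_intros S y f)+
  also have "partial Crho (\<lambda>Q. a * y Q * f Q) P = a * (- (y P * y P)) * f P
    + a * y P * partial Crho f P"
  proof -
    have "smooth_on S (\<lambda>Q. a * y Q)" by (intro smooth_intros S y)
    from partial_mult[OF d[OF this P] d[OF f P], of Crho] show ?thesis
      using partial_cmult[OF d[OF y P], of Crho a] dy by simp
  qed
  finally have 2: "partial Crho (partial Crho (\<lambda>P. w P * f P)) P
    = w P * (a * y P * (a * y P * f P + partial Crho f P) + (a * (- (y P * y P)) * f P
      + a * y P * partial Crho f P + partial Crho (partial Crho f) P))" .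
  have dx: "partial (Cm i) (\<lambda>P. w P * f P) Q = w Q * partial (Cm i) f Q"
    if "Q \<in> S" "smooth_on S f" for Q i f
    using partial_mult[OF d[OF w that(1)] d[OF that(2,1)], of
      "Cm i"] partial_half_power[OF ne[OF that(1)], of "Cm i" n]
    by (simp add: w_def)
  have 3: "partial (Cm i) (partial (Cm i) (\<lambda>P. w P * f P)) P
    = w P * partial (Cm i) (partial (Cm i) f) P" for i
  proof -
    have "partial (Cm i) (partial (Cm i) (\<lambda>P. w P * f P)) P
      = partial (Cm i) (\<lambda>P. w P * partial (Cm i) f P) P"
      by (rule partial_cong[OF S P]) (rule dx[OF _ f])
    also have "\<dots> = w P * partial (Cm i) (partial (Cm i) f) P" by (rule dx[OF P smooth_on_partial[OF f]])
    finally show ?thesis .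
  qed
  have yr: "P $ Crho * y P = 1" using ne[OF P] by (simp add: y_def)
  define F1 F2 where "F1 = partial Crho f P" and "F2 = partial Crho (partial Crho f) P"
  have "P $ Crho * (w P * (a * y P * (a * y P * f P + F1) + (a * (- (y P * y P)) * f P
    + a * y P * F1 + F2)))
     + (1 - a) * (w P * (a * y P * f P + F1))
     = w P * ((P $ Crho * y P) * (a * a * y P * f P + 2 * a * F1 - a * y P * f P) + P $ Crho * F2
        + (1 - a) * (a * y P * f P + F1))"
    by (simp add: algebra_simps)
  also have "\<dots> = w P * (P $ Crho * F2 + (1 + a) * F1)" unfolding yr by (simp add: algebra_simps)
  finally have "amb_op (- real n) (\<lambda>P. w P * f P) P = w P * amb_op (real n) f P"
    unfolding amb_op_def 2 3 dwf[OF P f] F1_def F2_def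
    by (simp add: a_def right_diff_distrib sum_distrib_left)
  then show ?thesis by (simp add: w_def)
qed

section \<open>The coefficients of the pp-wave ambient metric\<close>

text \<open>Common form of both families of coefficients, for b = -n and b = n. In contrast to
  \<open>coeff_H\<close> there is no cut-off and the index 0 is included, so that \<open>H\<close>
  becomes the constant term of its own series.\<close>

definition lap_coeff :: "real \<Rightarrow> (real^('n::finite pp_coord) \<Rightarrow> real) \<Rightarrow> nat \<Rightarrow> real^('n pp_coord) \<Rightarrow>
  real" where
  "lap_coeff b f k p = (laplacian ^^ k) f p / (fact k * (\<Prod>i=1..k. 2 * real i + b))"

lemma lap_coeff_0 [simp]: "lap_coeff b f 0 = f"
  by (simp add: lap_coeff_def fun_eq_iff)

lemma coeff_f_eq: "coeff_f f = lap_coeff (real CARD('n pp_coord))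
  (f :: real^('n::finite pp_coord) \<Rightarrow> real)"
  by (simp add: coeff_f_def lap_coeff_def fun_eq_iff)

lemma coeff_H_eq:
  "coeff_H H k p = (if 1 \<le> k \<and> enat k \<le> amb_order CARD('n pp_coord)
    then lap_coeff (- real CARD('n pp_coord)) (H :: real^('n::finite pp_coord) \<Rightarrow> real) k p else 0)"
  by (simp add: coeff_H_def lap_coeff_def)

lemma smooth_on_laplacian_power: "open M \<Longrightarrow> smooth_on M f \<Longrightarrow> smooth_on M ((laplacian ^^ k) f)"
  by (induction k) (auto intro: smooth_on_laplacian)

lemma smooth_on_lap_coeff:
  assumes "open M" "smooth_on M f" shows "smooth_on M (lap_coeff b f k)"
proof -
  have "lap_coeff b f k = (\<lambda>p. inverse (fact k * (\<Prod>i=1..k. 2 * real i + b)) * (laplacian ^^ k) f p)"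
    by (simp add: lap_coeff_def fun_eq_iff divide_inverse mult.commute)
  then show ?thesis using smooth_on_mult[OF assms(1) smooth_on_const smooth_on_laplacian_power[OF
    assms]] by simp
qed

lemma laplacian_lap_coeff_eq:
  assumes "open M" "smooth_on M f" "x \<in> M"
  shows "laplacian (lap_coeff b f k) x = (laplacian ^^ Suc k) f x / (fact k * (\<Prod>i=1..k. 2 * real i
    + b))"
proof -
  define C where "C = inverse (fact k * (\<Prod>i=1..k. 2 * real i + b))"
  have "lap_coeff b f k = (\<lambda>p. C * (laplacian ^^ k) f p)"
    by (simp add: lap_coeff_def fun_eq_iff divide_inverse mult.commute C_def)
  then have "laplacian (lap_coeff b f k) x = C * laplacian ((laplacian ^^ k) f) x"
    by (simp only: laplacian_cmult[OF assms(1,3) smooth_on_laplacian_power[OF assms(1,2)]])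
  then show ?thesis by (simp add: divide_inverse mult.commute C_def)
qed

text \<open>Passing from k to k+1 divides by (k+1)(2k+2+b). For b = -n the hypothesis fails
  precisely when n = 2k+2, the origin of the obstruction.\<close>

lemma laplacian_lap_coeff:
  assumes "open M" "smooth_on M f" "x \<in> M" and nz: "2 * real k + 2 + b \<noteq> 0"
  shows "laplacian (lap_coeff b f k) x = (real k + 1) * (2 * real k + 2 + b) * lap_coeff b f (Suc k) x"
proof -
  define y where "y = (real k + 1) * (2 * real k + 2 + b)"
  define X where "X = (fact k * (\<Prod>i=1..k. 2 * real i + b) :: real)"
  have "y \<noteq> 0" unfolding y_def by (rule no_zero_divisors[OF _ nz]) linarith
  have "fact (Suc k) * (\<Prod>i=1..Suc k. 2 * real i + b) = y * X"
    by (simp add: y_def X_def algebra_simps)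
  then have "lap_coeff b f (Suc k) x = (laplacian ^^ Suc k) f x / (y * X)"
    unfolding lap_coeff_def by (simp only:)
  then show ?thesis
    using \<open>y \<noteq> 0\<close> laplacian_lap_coeff_eq[OF assms(1-3), of b k]
      unfolding y_def[symmetric] X_def[symmetric] by simp
qed

lemma indep_v_iff: "indep_v M f \<longleftrightarrow> invariant_on Cv M f"
  by (simp add: indep_v_def invariant_on_def)

lemma invariant_on_laplacian: "open M \<Longrightarrow> invariant_on v M f \<Longrightarrow> invariant_on v M (laplacian f)"
  using invariant_on_partial[of M v] unfolding invariant_on_def[of v M "laplacian f"] laplacian_def
  by (intro ballI impI sum.cong refl) (metis (no_types, lifting) invariant_on_def)

lemma invariant_on_lap_coeff:
  assumes "open M" "invariant_on v M f" shows "invariant_on v M (lap_coeff b f k)"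
proof -
  have "invariant_on v M ((laplacian ^^ k) f)"
    by (induction k) (auto intro: invariant_on_laplacian assms)
  then show ?thesis unfolding invariant_on_def lap_coeff_def by metis
qed

lemma card_pp_ge: "3 \<le> CARD('n::finite pp_coord)"
proof -
  have "0 < CARD('n)" by (rule zero_less_card_finite)
  then show ?thesis unfolding card_pp_coord by linarith
qed

lemma half_power_0: "0 < n \<Longrightarrow> n \<noteq> 1 \<Longrightarrow> half_power n 0 = 0"
  by (auto simp: half_power_def power_0_left elim!: evenE)

lemma continuous_on_half_power: "0 < n \<Longrightarrow> continuous_on A (half_power n)"
  unfolding half_power_def[abs_def]
  by (cases "even n") (auto intro!: continuous_intros continuous_on_powr')

section \<open>Ambient metrics over pp-waves\<close>

lemma amb_pp_nth:
  "amb (pp_wave H) (\<lambda>x r. \<phi> x r *\<^sub>R du2) P $ i $ j = (case (i, j) of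
       (Ct, Ct) \<Rightarrow> 2 * P $ Crho
     | (Ct, Crho) \<Rightarrow> P $ Ct
     | (Crho, Ct) \<Rightarrow> P $ Ct
     | (Cm a, Cm b) \<Rightarrow> (P $ Ct)\<^sup>2 * (if a = Cu \<and> b = Cu then H (base_point P)
       + \<phi> (base_point P) (P $ Crho)
          else pp_wave (\<lambda>_. 0) 0 $ a $ b)
     | _ \<Rightarrow> 0)"
proof -
  have "(pp_wave H x + z *\<^sub>R du2) $ a $ b = (if a = Cu \<and> b
    = Cu then H x + z else pp_wave (\<lambda>_. 0) 0 $ a $ b)"
    for x z a b by (cases a; cases b) (auto simp: pp_wave_def du2_def)
  then show ?thesis
    by (cases i; cases j) (simp_all add: amb_def del: vector_add_component vector_scaleR_component)
qed

lemma smooth_on_amb_pp: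
  assumes "open S" "smooth_on S (\<lambda>P. H (base_point P) + \<phi> (base_point P) (P $ Crho))"
  shows "smooth_on S (\<lambda>P. amb (pp_wave H) (\<lambda>x r. \<phi> x r *\<^sub>R du2) P $ i $ j)"
proof -
  have "smooth_on S (\<lambda>P. if a = Cu \<and> b = Cu then H (base_point P) + \<phi> (base_point P) (P $ Crho)
          else pp_wave (\<lambda>_. 0) 0 $ a $ b)" for a b
    using assms(2) by (cases "a = Cu \<and> b = Cu") auto
  then show ?thesis unfolding amb_pp_nth
    by (cases i; cases j) (auto intro!: smooth_intros assms(1))
qed

lemma continuous_on_amb_pp:
  assumes "continuous_on S (\<lambda>P. H (base_point P) + \<phi> (base_point P) (P $ Crho))"
  shows "continuous_on S (amb (pp_wave H) (\<lambda>x r. \<phi> x r *\<^sub>R du2))"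
proof -
  have 1: "continuous_on S (\<lambda>P. if a = Cu \<and> b = Cu then H (base_point P) + \<phi> (base_point P) (P $ Crho)
          else pp_wave (\<lambda>_. 0) 0 $ a $ b)" for a b
    using assms by (cases "a = Cu \<and> b = Cu") auto
  have "continuous_on S (\<lambda>P. amb (pp_wave H) (\<lambda>x r. \<phi> x r *\<^sub>R du2) P $ i $ j)" for i j
    unfolding amb_pp_nth by (cases i; cases j) (auto intro!: continuous_intros 1)
  then have "continuous_on S (\<lambda>P. \<chi> i. \<chi> j. amb (pp_wave H) (\<lambda>x r. \<phi> x r *\<^sub>R du2) P $ i $ j)"
    by (intro continuous_on_vec_lambda)
  then show ?thesis by (simp add: vec_lambda_eta)
qed

text \<open>The closed form \<open>F\<close> replaces the potential on \<open>S\<close> only,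
  because the infinite sums are controlled only inside the domain.\<close>

lemma ricci_pp_wave:
  fixes H :: "real^('n::finite pp_coord) \<Rightarrow> real"
  assumes "open S" "\<And>P. P \<in> S \<Longrightarrow> 0 < P $ Ct" "smooth_on S F" "invariant_on (Cm Cv) S F"
    "\<And>P. P \<in> S \<Longrightarrow> H (base_point P) + \<phi> (base_point P) (P $ Crho) = F P" "P \<in> S"
  shows "ricci (amb (pp_wave H) (\<lambda>x r. \<phi> x r *\<^sub>R du2)) P $ i $ j
    = (if i = Cm Cu \<and> j = Cm Cu then amb_op (- real CARD('n pp_coord)) F P else 0)"
proof -
  interpret pp_normal_form H \<phi> S
  proof
    show "smooth_on S (\<lambda>P. H (base_point P) + \<phi> (base_point P) (P $ Crho))"
      by (rule smooth_on_cong[OF assms(1) assms(5)[symmetric] assms(3)])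
    show "invariant_on (Cm Cv) S (\<lambda>P. H (base_point P) + \<phi> (base_point P) (P $ Crho))"
      unfolding invariant_on_def
    proof (intro ballI impI)
      fix P Q assume PQ: "P \<in> S" "Q \<in> S" "\<forall>i. i \<noteq> Cm Cv \<longrightarrow> P $ i = Q $ i"
      then have "F P = F Q" using assms(4) unfolding invariant_on_def by blast
      then show "H (base_point P) + \<phi> (base_point P) (P $ Crho)
        = H (base_point Q) + \<phi> (base_point Q) (Q $ Crho)"
        by (simp only: assms(5)[OF PQ(1)] assms(5)[OF PQ(2)])
    qed
  qed (use assms(1,2) in auto)
  have "amb_op (- real CARD('n pp_coord)) (\<lambda>P. H (base_point P) + \<phi> (base_point P) (P $ Crho)) P
      = amb_op (- real CARD('n pp_coord)) F P"
    by (rule amb_op_cong[OF assms(1,6,5)])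
  then show ?thesis
    using ricci_pp[OF assms(6), of i j] by (simp add: amb_op_def F_def[abs_def])
qed

lemma amb_point_mem: "x \<in> M \<Longrightarrow> 0 < t \<Longrightarrow> \<bar>r\<bar> < \<epsilon> \<Longrightarrow> amb_point t x r \<in> amb_domain M \<epsilon>"
  by (simp add: amb_domain_def)

text \<open>A continuous factor \<open>u\<close> is bounded near each point of \<rho> = 0, and this
  gives a bound locally uniform in t and x.\<close>

lemma ricci_OI:
  assumes M: "open M" and "0 < \<epsilon>" and u: "continuous_on (amb_domain M \<epsilon>) u"
    and R: "\<And>P i j. P \<in> amb_domain M \<epsilon> \<Longrightarrow> P $ Crho \<noteq> 0 \<Longrightarrow>
      ricci A P $ i $ j = (if i = I \<and> j = J then u P * (P $ Crho) ^ k else 0)"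
  shows "ricci_O M A k"
  unfolding ricci_O_def
proof (intro allI impI ballI)
  fix t :: real and x i j assume t: "0 < t" and x: "x \<in> M"
  define p where "p = amb_point t x 0"
  have pD: "p \<in> amb_domain M \<epsilon>" unfolding p_def using t x assms(2) by (intro amb_point_mem) auto
  have "isCont u p" using u pD open_amb_domain[OF M] continuous_on_eq_continuous_at by blast
  then have "eventually (\<lambda>P. dist (u P) (u p) < 1) (at p)"
    unfolding isCont_def by (rule tendstoD) simp
  then have 1: "eventually (\<lambda>P. \<bar>u P\<bar> \<le> \<bar>u p\<bar> + 1) (at p within {P. P $ Crho \<noteq> 0})"
    unfolding eventually_at_filter by eventually_elim (auto simp: dist_real_def)
  have 2: "eventually (\<lambda>P. P \<in> amb_domain M \<epsilon> \<and> P $ Crho \<noteq> 0) (at p within {P. P $ Crho \<noteq> 0})"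
    using eventually_nhds_in_open[OF open_amb_domain[OF M] pD]
    by (auto simp: eventually_at_filter elim: eventually_mono)
  show "(\<lambda>P. ricci A P $ i $ j) \<in> O[at p within {P. P $ Crho \<noteq> 0}](\<lambda>P. (P $ Crho) ^ k)"
  proof (rule bigoI)
    show "eventually (\<lambda>P. norm (ricci A P $ i $ j) \<le> (\<bar>u p\<bar>
      + 1) * norm ((P $ Crho) ^ k)) (at p within {P. P $ Crho \<noteq> 0})"
      using 1 2 by eventually_elim (auto simp: R abs_mult intro!: mult_right_mono)
  qed
qed

text \<open>Conjugation by \<open>half_power\<close> is available only for \<rho> \<noteq> 0;
  continuity along a line in direction \<rho> carries the resulting equation over to \<rho> =
  0.\<close>

lemma zero_across_rho:
  assumes M: "open M" and u: "continuous_on (amb_domain M \<epsilon>) u"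
    and z: "\<And>P. P \<in> amb_domain M \<epsilon> \<Longrightarrow> P $ Crho \<noteq> 0 \<Longrightarrow> u P = (0::real)" and P: "P \<in> amb_domain M \<epsilon>"
  shows "u P = 0"
proof (cases "P $ Crho = 0")
  case True
  define t x where "t = P $ Ct" and "x = base_point P"
  have tx: "0 < t" "x \<in> M" "0 < \<epsilon>" using P by (auto simp: amb_domain_def t_def x_def)
  have Pe: "P = amb_point t x 0" using amb_point_base_point[of P] True by (simp add: t_def x_def)
  have "continuous_on {-\<epsilon><..<\<epsilon>} (\<lambda>r. u (amb_point t x r))"
    by (rule continuous_on_compose2[OF u]) (use tx in \<open>auto intro!: continuous_intros amb_point_mem\<close>)
  then have "isCont (\<lambda>r. u (amb_point t x r)) 0"
    using tx(3) by (auto simp: continuous_on_eq_continuous_at)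
  then have "((\<lambda>r. u (amb_point t x r)) \<longlongrightarrow> u P) (at 0)" by (simp add: isCont_def Pe)
  moreover have "((\<lambda>r. u (amb_point t x r)) \<longlongrightarrow> 0) (at 0)"
  proof (rule tendsto_eventually)
    have "eventually (\<lambda>r. r \<in> {-\<epsilon><..<\<epsilon>}) (nhds 0)" using tx(3) by (intro eventually_nhds_in_open) auto
    then show "eventually (\<lambda>r. u (amb_point t x r) = 0) (at 0)"
      unfolding eventually_at_filter by eventually_elim (use tx in \<open>auto intro!: z amb_point_mem\<close>)
  qed
  ultimately show ?thesis by (rule tendsto_unique[OF at_neq_bot])
qed (use z P in blast)

section \<open>The two series for given H and f\<close>

locale pp_data =
  fixes M :: "(real^('n::finite pp_coord)) set" and H f :: "real^('n pp_coord) \<Rightarrow> real" and n m :: nat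
  assumes n_def: "n = CARD('n pp_coord)" and m_def: "m = (n - 2) div 2"
    and M: "open M" and H: "smooth_on M H" and Hv: "indep_v M H"
    and f: "smooth_on M f" and fv: "indep_v M f"
begin

definition Hc :: "nat \<Rightarrow> real^('n pp_coord) \<Rightarrow> real" where "Hc = lap_coeff (- real n) H"
definition fc :: "nat \<Rightarrow> real^('n pp_coord) \<Rightarrow> real" where "fc = lap_coeff (real n) f"

lemma n_ge: "3 \<le> n"
  unfolding n_def by (rule card_pp_ge)

lemma coeff_f_fc: "coeff_f f = fc"
  unfolding coeff_f_eq n_def[symmetric] fc_def ..

lemma even_n: "even n \<Longrightarrow> n = 2 * m + 2"
  using n_ge by (auto simp: m_def elim!: evenE)

lemma smooth_on_Hc: "smooth_on M (Hc k)" and smooth_on_fc: "smooth_on M (fc k)"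
  unfolding Hc_def fc_def by (intro smooth_on_lap_coeff M H f)+

lemma Hc_rec:
  assumes "x \<in> M" "odd n \<or> k < m"
  shows "laplacian (Hc k) x = (real k + 1) * (2 * real k + 2 + - real n) * Hc (Suc k) x"
  unfolding Hc_def
proof (rule laplacian_lap_coeff[OF M H assms(1)])
  show "2 * real k + 2 + - real n \<noteq> 0"
  proof
    assume "2 * real k + 2 + - real n = 0"
    then have "real (2 * k + 2) = real n" by simp
    then have "2 * k + 2 = n" by (simp only: of_nat_eq_iff)
    then show False using assms(2) even_n by auto
  qed
qed

lemma fc_rec: "x \<in> M \<Longrightarrow> laplacian (fc k) x = (real k + 1) * (2 * real k + 2 + real n) * fc (Suc k) x"
  unfolding fc_def by (rule laplacian_lap_coeff[OF M f]) (auto simp: add_nonneg_eq_0_iff)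

lemma Hc_invariant: "p \<in> M \<Longrightarrow> q \<in> M \<Longrightarrow> (\<And>i. i \<noteq> Cv \<Longrightarrow> p $ i = q $ i) \<Longrightarrow> Hc k p = Hc k q"
  using invariant_on_lap_coeff[OF M Hv[unfolded indep_v_iff]] unfolding Hc_def invariant_on_def by blast

lemma fc_invariant: "p \<in> M \<Longrightarrow> q \<in> M \<Longrightarrow> (\<And>i. i \<noteq> Cv \<Longrightarrow> p $ i = q $ i) \<Longrightarrow> fc k p = fc k q"
  using invariant_on_lap_coeff[OF M fv[unfolded indep_v_iff]] unfolding fc_def invariant_on_def by blast

lemma invariant_onI:
  assumes "S \<subseteq> {P. base_point P \<in> M}"
    "\<And>P Q. P \<in> S \<Longrightarrow> Q \<in> S \<Longrightarrow> (\<And>k. Hc k (base_point P) = Hc k (base_point Q)) \<Longrightarrow>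
      (\<And>k. fc k (base_point P) = fc k (base_point Q)) \<Longrightarrow> P $ Crho = Q $ Crho \<Longrightarrow> F P = F Q"
  shows "invariant_on (Cm Cv) S F"
  unfolding invariant_on_def
proof (intro ballI impI)
  fix P Q assume PQ: "P \<in> S" "Q \<in> S" "\<forall>i. i \<noteq> Cm Cv \<longrightarrow> P $ i = Q $ i"
  then have "base_point P $ i = base_point Q $ i" if "i \<noteq> Cv" for i using that
    by (simp add: base_point_def)
  then have b: "base_point P \<in> M" "base_point Q \<in> M" "\<And>i. i \<noteq> Cv \<Longrightarrow> base_point P $ i = base_point Q $ i"
    using PQ(1,2) assms(1) by auto
  show "F P = F Q"
    by (rule assms(2)[OF PQ(1,2) Hc_invariant[OF b] fc_invariant[OF b]]) (use PQ(3) in auto)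
qed

text \<open>The coefficient of \<rho>^m in the uu-component of the Ricci tensor. For even n the
  recurrence breaks off at k = m and leaves the Laplacian of the last coefficient; for odd n nothing
  is left over.\<close>

definition err :: "real^('n pp_coord) \<Rightarrow> real" where
  "err x = (if odd n then 0 else - laplacian (Hc m) x / 2)"

lemma coeff_H_Hc: "coeff_H H k x = (if 1 \<le> k \<and> (odd n \<or> k \<le> m) then Hc k x else 0)"
  unfolding coeff_H_eq n_def[symmetric] by (auto simp: amb_order_def Hc_def m_def)

lemma H_sum:
  assumes "K \<le> N" "\<And>k. k \<le> N \<Longrightarrow> coeff_H H k x = (if 1 \<le> k \<and> k \<le> K then Hc k x else 0)"
  shows "H x + (\<Sum>k\<le>N. coeff_H H k x * r ^ k) = (\<Sum>k\<le>K. Hc k x * r ^ k)"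
proof -
  have "(\<Sum>k\<le>N. coeff_H H k x * r ^ k) = (\<Sum>k\<in>{1..K}. Hc k x * r ^ k)"
    by (rule sum.mono_neutral_cong_right) (use assms in auto)
  moreover have "{..K} = insert 0 {1..K}" by auto
  then have "(\<Sum>k\<le>K. Hc k x * r ^ k) = H x + (\<Sum>k\<in>{1..K}. Hc k x * r ^ k)"
    by (simp add: Hc_def)
  ultimately show ?thesis by simp
qed

lemma H_sum_even: "even n \<Longrightarrow> H x + (\<Sum>k. coeff_H H k x * r ^ k) = (\<Sum>k\<le>m. Hc k x * r ^ k)"
  using H_sum[of m m x r] suminf_finite[of "{..m}" "\<lambda>k. coeff_H H k x * r ^ k"]
    by (simp add: coeff_H_Hc)

definition poly_sum :: "(nat \<Rightarrow> real^('n pp_coord) \<Rightarrow> real) \<Rightarrow> nat \<Rightarrow> real^('n pp_coord amb_coord) \<Rightarrow>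
  real" where
  "poly_sum c K P = (\<Sum>k\<le>K. c k (base_point P) * (P $ Crho) ^ k)"

definition ser_sum :: "(nat \<Rightarrow> real^('n pp_coord) \<Rightarrow> real) \<Rightarrow> real^('n pp_coord amb_coord) \<Rightarrow> real" where
  "ser_sum c P = (\<Sum>k. c k (base_point P) * (P $ Crho) ^ k)"

definition hp :: "real^('n pp_coord amb_coord) \<Rightarrow> real" where "hp P = half_power n (P $ Crho)"

lemma smooth_on_poly_sum:
  assumes "\<And>k. smooth_on M (c k)" shows "smooth_on (amb_domain M \<epsilon>) (poly_sum c K)"
proof -
  have "smooth_on {P. base_point P \<in> M} (poly_sum c K)"
    unfolding poly_sum_def[abs_def]
    by (intro smooth_intros open_base_point_vimage M smooth_on_base_point assms)
  then show ?thesis by (rule smooth_on_subset) (auto simp: amb_domain_def)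
qed

abbreviation Dne :: "real \<Rightarrow> (real^('n pp_coord amb_coord)) set" where
  "Dne \<epsilon> \<equiv> amb_domain M \<epsilon> \<inter> {P. P $ Crho \<noteq> 0}"

lemma open_Dne: "open (Dne \<epsilon>)" by (rule open_amb_domain_rho[OF M])

lemma smooth_on_hp: "smooth_on (Dne \<epsilon>) hp"
  unfolding hp_def[abs_def] by (rule smooth_on_half_power[OF open_Dne]) auto

lemma continuous_on_hp: "continuous_on A hp"
  unfolding hp_def[abs_def]
  by (rule continuous_on_compose2[OF continuous_on_half_power[of n UNIV]])
    (use n_ge in \<open>auto intro!: continuous_intros\<close>)

lemma amb_op_hp: "smooth_on (Dne \<epsilon>) F \<Longrightarrow> P \<in> Dne \<epsilon> \<Longrightarrow> amb_op (- real n) (\<lambda>P. hp P * F P) P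
  = hp P * amb_op (real n) F P"
  unfolding hp_def by (rule amb_op_half_power[OF open_Dne]) auto

lemma continuous_on_base: "smooth_on M c \<Longrightarrow> continuous_on (amb_domain M \<epsilon>) (\<lambda>P. c (base_point P))"
  by (rule continuous_on_compose2[OF smooth_on_continuous_on])
    (auto intro!: continuous_intros simp: amb_domain_def)

text \<open>For odd n both sums are cut at \<open>N\<close>; for even n the first is complete at
  \<open>m\<close>. By telescoping, the Ricci tensor consists of a remainder with the factor
  \<rho>^K and one with the factor \<rho>^(n/2+N); the hypothesis for K < k removes the first when
  its order is too low.\<close>

lemma formal_ricci:
  assumes K: "K = (if odd n then N else m)" "odd n \<or> m \<le> N"
    and k: "K < k \<longrightarrow> (\<forall>x\<in>M. laplacian (Hc K) x = 0)" "k \<le> N"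
  shows "ricci_O M (amb (pp_wave H) (pp_h_trunc H f N)) k"
proof -
  define F where "F P = poly_sum Hc K P + hp P * poly_sum fc N P" for P
  define u where "u P = - laplacian (Hc K) (base_point P) / 2 * (P $ Crho) ^ (K - k)
      + hp P * (- laplacian (fc N) (base_point P) / 2) * (P $ Crho) ^ (N - k)" for P
  define \<phi> where "\<phi> x r = (\<Sum>k\<le>N. coeff_H H k x * r ^ k)
    + (\<Sum>k\<le>N. coeff_f f k x * (half_power n r * r ^ k))" for x r
  have h: "pp_h_trunc H f N = (\<lambda>x r. \<phi> x r *\<^sub>R du2)"
    by (rule ext)+ (simp only: pp_h_trunc_def \<phi>_def n_def[symmetric])
  have Feq: "H (base_point P) + \<phi> (base_point P) (P $ Crho) = F P" for P
  proof -
    have "H (base_point P) + (\<Sum>k\<le>N. coeff_H H k (base_point P) * (P $ Crho) ^ k) = poly_sum Hc K P"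
      unfolding poly_sum_def by (rule H_sum) (use K in \<open>auto simp: coeff_H_Hc\<close>)
    moreover have "(\<Sum>k\<le>N. coeff_f f k (base_point P) * (half_power n (P $ Crho) * (P $ Crho) ^ k))
      = hp P * poly_sum fc N P"
      by (simp add: hp_def poly_sum_def coeff_f_fc sum_distrib_left mult.left_commute)
    ultimately show ?thesis by (simp add: \<phi>_def F_def)
  qed
  have smP: "smooth_on (Dne 1) (poly_sum Hc K)" "smooth_on (Dne 1) (poly_sum fc N)"
    using smooth_on_poly_sum smooth_on_Hc smooth_on_fc by (blast intro: smooth_on_subset)+
  have smhp: "smooth_on (Dne 1) (\<lambda>P. hp P * poly_sum fc N P)"
    by (intro smooth_on_mult open_Dne smooth_on_hp smP)
  have smF: "smooth_on (Dne 1) F" unfolding F_def[abs_def] by (intro smooth_on_add open_Dne smP smhp)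
  have invF: "invariant_on (Cm Cv) (Dne 1) F"
    by (rule invariant_onI) (auto simp: F_def poly_sum_def hp_def amb_domain_def)
  show ?thesis
  \<comment> \<open>The sums are finite, so no radius of convergence intervenes and \<epsilon> = 1
    can be taken.\<close>
  proof (rule ricci_OI[OF M zero_less_one, where u = u and I = "Cm Cu" and J = "Cm Cu"])
    show "continuous_on (amb_domain M 1) u"
      unfolding u_def[abs_def]
      by (intro continuous_intros continuous_on_hp continuous_on_base smooth_on_laplacian M
        smooth_on_Hc smooth_on_fc) auto
    fix P :: "real^('n pp_coord amb_coord)" and i j
    assume "P \<in> amb_domain M 1" "P $ Crho \<noteq> 0"
    then have P: "P \<in> Dne 1" "base_point P \<in> M" by (auto simp: amb_domain_def)
    have "amb_op (- real n) F P = amb_op (- real n) (poly_sum Hc K) P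
      + amb_op (- real n) (\<lambda>P. hp P * poly_sum fc N P) P"
      unfolding F_def[abs_def] by (rule amb_op_add[OF open_Dne P(1) smP(1) smhp])
    also have "amb_op (- real n) (poly_sum Hc K) P = - laplacian (Hc K) (base_point P) *
      (P $ Crho) ^ K / 2"
      unfolding poly_sum_def[abs_def]
      by (rule amb_op_polynomial[OF M smooth_on_Hc P(2) Hc_rec]) (use K in auto)
    also have "\<dots> = - laplacian (Hc K) (base_point P) / 2 * (P $ Crho) ^ (K - k) * (P $ Crho) ^ k"
      using k(1) P(2) by (cases "K < k") (auto simp flip: power_add)
    also have "amb_op (- real n) (\<lambda>P. hp P * poly_sum fc N P) P
      = hp P * amb_op (real n) (poly_sum fc N) P"
      by (rule amb_op_hp[OF smP(2) P(1)])
    also have "amb_op (real n) (poly_sum fc N) P = - laplacian (fc N) (base_point P) *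
      (P $ Crho) ^ N / 2"
      unfolding poly_sum_def[abs_def] by (rule amb_op_polynomial[OF M smooth_on_fc P(2) fc_rec])
    also have "\<dots> = - laplacian (fc N) (base_point P) / 2 * (P $ Crho) ^ (N - k) * (P $ Crho) ^ k"
      using k(2) by (simp flip: power_add)
    finally have "amb_op (- real n) F P = u P * (P $ Crho) ^ k" by (simp add: u_def algebra_simps)
    then show "ricci (amb (pp_wave H) (pp_h_trunc H f N)) P $ i $ j
        = (if i = Cm Cu \<and> j = Cm Cu then u P * (P $ Crho) ^ k else 0)"
      unfolding h using ricci_pp_wave[OF open_Dne _ smF invF Feq P(1), of i j, folded n_def]
        by (auto simp: amb_domain_def)
  qed
qed

lemma formal_ricci_O_pp: "formal_ricci_O M (pp_wave H) (pp_h_trunc H f) (amb_order n)"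
  unfolding formal_ricci_O_def
proof (intro allI impI)
  fix k assume k: "enat k \<le> amb_order n"
  show "\<forall>\<^sub>F N in sequentially. ricci_O M (amb (pp_wave H) (pp_h_trunc H f N)) k"
    using eventually_ge_at_top[of "max k m"]
  proof eventually_elim
    case (elim N)
    show ?case by (rule formal_ricci[OF refl]) (use elim k in \<open>auto simp: amb_order_def m_def split:
      if_splits\<close>)
  qed
qed

lemma formal_ricci_O_pp_infinity:
  assumes "\<And>x. x \<in> M \<Longrightarrow> laplacian (Hc m) x = 0" "even n"
  shows "formal_ricci_O M (pp_wave H) (pp_h_trunc H f) \<infinity>"
  unfolding formal_ricci_O_def
proof (intro allI impI)
  fix k
  show "\<forall>\<^sub>F N in sequentially. ricci_O M (amb (pp_wave H) (pp_h_trunc H f N)) k"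
    using eventually_ge_at_top[of "max k m"]
  proof eventually_elim
    case (elim N)
    show ?case by (rule formal_ricci[OF refl]) (use elim assms in auto)
  qed
qed

text \<open>\<open>F1\<close> and \<open>F2\<close> are the two parts of the potential: the one
  starting with H, and the one with the factor \<rho>^(n/2). For even n the first is a polynomial in
  \<rho>, free of convergence questions.\<close>

definition F1 :: "real^('n pp_coord amb_coord) \<Rightarrow> real" where
  "F1 = (if odd n then ser_sum Hc else poly_sum Hc m)"

definition F2 :: "real^('n pp_coord amb_coord) \<Rightarrow> real" where
  "F2 P = hp P * ser_sum fc P"

definition \<phi> :: "real^('n pp_coord) \<Rightarrow> real \<Rightarrow> real" where
  "\<phi> x r = (\<Sum>k. coeff_H H k x * r ^ k) + (\<Sum>k. coeff_f f k x * (half_power n r * r ^ k))"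

section \<open>Convergent series: smoothness and curvature of the sum\<close>

context
  fixes \<epsilon> :: real
  assumes \<epsilon>: "0 < \<epsilon>" and convH: "odd n \<Longrightarrow> converges_smoothly M \<epsilon> (coeff_H H)"
    and convf: "converges_smoothly M \<epsilon> (coeff_f f)"
begin

lemma pp_h_eq: "pp_h H f = (\<lambda>x r. \<phi> x r *\<^sub>R du2)"
  by (rule ext)+ (simp only: pp_h_def \<phi>_def n_def[symmetric])

lemma Hc_sums:
  assumes "odd n" "x \<in> M" "\<bar>r\<bar> < \<epsilon>"
  shows "(\<lambda>k. Hc k x * r ^ k) sums (H x + (\<Sum>k. coeff_H H k x * r ^ k))"
proof -
  have "summable (\<lambda>k. coeff_H H k x * r ^ k)" using convH assms by (simp add: converges_smoothly_def)
  from sums_add[OF sums_single[of 0 "\<lambda>_. H x"] summable_sums[OF this]]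
  have "(\<lambda>k. (if k = 0 then H x else 0) + coeff_H H k x * r ^ k) sums (H x
    + (\<Sum>k. coeff_H H k x * r ^ k))" .
  moreover have "(\<lambda>k. (if k = 0 then H x else 0) + coeff_H H k x * r ^ k) = (\<lambda>k. Hc k x * r ^ k)"
    using assms(1) by (auto simp: fun_eq_iff coeff_H_Hc Hc_def)
  ultimately show ?thesis by simp
qed

lemma F1_eq: "P \<in> amb_domain M \<epsilon> \<Longrightarrow> F1 P = H (base_point P)
  + (\<Sum>k. coeff_H H k (base_point P) * (P $ Crho) ^ k)"
  using Hc_sums[of "base_point P" "P $ Crho"] H_sum_even[of "base_point P" "P $ Crho"]
  by (auto simp: F1_def ser_sum_def poly_sum_def amb_domain_def sums_iff)

lemma F_eq:
  assumes P: "P \<in> amb_domain M \<epsilon>"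
  shows "H (base_point P) + \<phi> (base_point P) (P $ Crho) = F1 P + F2 P"
proof -
  have "summable (\<lambda>k. coeff_f f k (base_point P) * (P $ Crho) ^ k)"
    using convf P by (auto simp: converges_smoothly_def amb_domain_def)
  from suminf_mult[OF this, of "hp P"]
  have "(\<Sum>k. coeff_f f k (base_point P) * (half_power n (P $ Crho) * (P $ Crho) ^ k)) = F2 P"
    by (simp add: F2_def hp_def ser_sum_def coeff_f_fc mult.left_commute)
  then show ?thesis using F1_eq[OF P] by (simp add: \<phi>_def)
qed

lemma smooth_on_F1: "smooth_on (amb_domain M \<epsilon>) F1"
proof (cases "odd n")
  case True
  have "smooth_on (amb_domain M \<epsilon>) (\<lambda>P. H (base_point P)
    + (\<Sum>k. coeff_H H k (base_point P) * (P $ Crho) ^ k))"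
  proof (rule smooth_on_add[OF open_amb_domain[OF M]])
    show "smooth_on (amb_domain M \<epsilon>) (\<lambda>P. H (base_point P))"
      by (rule smooth_on_subset[OF smooth_on_base_point[OF M H]]) (auto simp: amb_domain_def)
    show "smooth_on (amb_domain M \<epsilon>) (\<lambda>P. \<Sum>k. coeff_H H k (base_point P) * (P $ Crho) ^ k)"
      using convH[OF True] by (simp add: converges_smoothly_def)
  qed
  then show ?thesis by (rule smooth_on_cong[OF open_amb_domain[OF M], rotated]) (rule F1_eq[symmetric])
next
  case False
  then show ?thesis using smooth_on_poly_sum[OF smooth_on_Hc] by (simp add: F1_def)
qed

lemma conv_Hc: "odd n \<Longrightarrow> converges_smoothly M \<epsilon> Hc"
  using smooth_on_F1 Hc_sums by (auto simp: converges_smoothly_def F1_def ser_sum_def[abs_def] sums_iff)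

lemma smooth_on_ser_fc: "smooth_on (amb_domain M \<epsilon>) (ser_sum fc)"
  using convf by (simp add: converges_smoothly_def coeff_f_fc ser_sum_def[abs_def])

lemma amb_op_F1:
  assumes P: "P \<in> amb_domain M \<epsilon>"
  shows "amb_op (- real n) F1 P = err (base_point P) * (P $ Crho) ^ m"
proof (cases "odd n")
  case True
  then show ?thesis
    using amb_op_power_series[OF M smooth_on_Hc Hc_rec conv_Hc P]
    by (simp add: F1_def ser_sum_def[abs_def] err_def)
next
  case False
  have "base_point P \<in> M" using P by (simp add: amb_domain_def)
  then have "amb_op (- real n) (poly_sum Hc m) P = - laplacian (Hc m) (base_point P) *
    (P $ Crho) ^ m / 2"
    unfolding poly_sum_def[abs_def] by (rule amb_op_polynomial[OF M smooth_on_Hc _ Hc_rec]) auto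
  with False show ?thesis by (simp add: F1_def err_def)
qed

lemma smooth_on_F2: "smooth_on (Dne \<epsilon>) F2"
  unfolding F2_def[abs_def]
  by (intro smooth_on_mult open_Dne smooth_on_hp smooth_on_subset[OF smooth_on_ser_fc]) auto

lemma amb_op_F2:
  assumes P: "P \<in> Dne \<epsilon>"
  shows "amb_op (- real n) F2 P = 0"
proof -
  have "amb_op (real n) (ser_sum fc) P = 0"
    unfolding ser_sum_def[abs_def]
    by (rule amb_op_power_series[OF M smooth_on_fc fc_rec])
      (use P convf in \<open>auto simp: coeff_f_fc\<close>)
  then show ?thesis
    unfolding F2_def[abs_def] using amb_op_hp[OF smooth_on_subset[OF smooth_on_ser_fc] P] by simp
qed

lemma invariant_F: "S \<subseteq> amb_domain M \<epsilon> \<Longrightarrow> invariant_on (Cm Cv) S (\<lambda>P. F1 P + F2 P)"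
  by (rule invariant_onI) (auto simp: F1_def F2_def poly_sum_def ser_sum_def hp_def amb_domain_def)

text \<open>Two situations are treated together: \<open>S\<close> avoids \<rho> = 0, or
  \<open>F2\<close> is smooth on the entire domain, as for n even or f = 0. In the second, the
  equation for \<open>F2\<close> holds off \<rho> = 0 and extends by continuity.\<close>

lemma ricci_pp_h:
  assumes S: "open S" "S \<subseteq> amb_domain M \<epsilon>" "smooth_on S F2" "S \<subseteq> Dne \<epsilon> \<or> S = amb_domain M \<epsilon>"
    and P: "P \<in> S"
  shows "ricci (amb (pp_wave H) (pp_h H f)) P $ i $ j
    = (if i = Cm Cu \<and> j = Cm Cu then err (base_point P) * (P $ Crho) ^ m else 0)"
proof -
  note smF1 = smooth_on_subset[OF smooth_on_F1 S(2)]
  have smF: "smooth_on S (\<lambda>P. F1 P + F2 P)" by (intro smooth_on_add S(1) smF1 S(3))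
  have "amb_op (- real n) F2 P = 0"
  proof (cases "S \<subseteq> Dne \<epsilon>")
    case True then show ?thesis using amb_op_F2 P by blast
  next
    case False
    then have SD: "S = amb_domain M \<epsilon>" using S(4) by blast
    have "continuous_on (amb_domain M \<epsilon>) (amb_op (- real n) F2)"
      using smooth_on_amb_op[OF S(1) S(3)] smooth_on_continuous_on unfolding SD by blast
    then show ?thesis by (rule zero_across_rho[OF M]) (use amb_op_F2 P SD in auto)
  qed
  then have "amb_op (- real n) (\<lambda>P. F1 P + F2 P) P = err (base_point P) * (P $ Crho) ^ m"
    using amb_op_add[OF S(1) P smF1 S(3), of "- real n"] amb_op_F1 P S(2) by auto
  moreover have "ricci (amb (pp_wave H) (\<lambda>x r. \<phi> x r *\<^sub>R du2)) P $ i $ j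
    = (if i = Cm Cu \<and> j = Cm Cu then amb_op (- real n) (\<lambda>P. F1 P + F2 P) P else 0)"
    by (rule ricci_pp_wave[OF S(1) _ smF invariant_F[OF S(2)] F_eq P, folded n_def])
      (use S(2) in \<open>auto simp: amb_domain_def\<close>)
  ultimately show ?thesis unfolding pp_h_eq by simp
qed

lemma smooth_on_err: "smooth_on M err"
  unfolding err_def[abs_def]
proof (cases "odd n")
  case False
  have "smooth_on M (\<lambda>x. (- 1 / 2) * laplacian (Hc m) x)"
    by (intro smooth_intros smooth_on_laplacian M smooth_on_Hc)
  with False show "smooth_on M (\<lambda>x. if odd n then 0 else - laplacian (Hc m) x / 2)" by simp
qed simp

lemma ambient_metric_pp: "ambient_metric M \<epsilon> (pp_wave H) (pp_h H f)"
  unfolding ambient_metric_def n_def[symmetric]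
proof (intro conjI)
  show "0 < \<epsilon>" by (rule \<epsilon>)
  show "\<forall>x\<in>M. pp_h H f x 0 = 0"
  proof
    fix x assume "x \<in> M"
    have "(\<Sum>k. coeff_H H k x * 0 ^ k) = coeff_H H 0 x" by (rule powser_zero)
    moreover have "half_power n 0 = 0" using n_ge by (intro half_power_0) auto
    ultimately have "\<phi> x 0 = 0" by (simp add: \<phi>_def coeff_H_Hc)
    then show "pp_h H f x 0 = 0" by (simp add: pp_h_eq)
  qed
  have tr: "transpose (z *\<^sub>R du2) = z *\<^sub>R (du2 :: real^('n pp_coord)^('n pp_coord))" for z
    by (auto simp: transpose_def du2_def vec_eq_iff)
  show "\<forall>x\<in>M. \<forall>\<rho>. \<bar>\<rho>\<bar> < \<epsilon> \<longrightarrow> transpose (pp_h H f x \<rho>) = pp_h H f x \<rho> \<and> invertible (pp_wave H x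
    + pp_h H f x \<rho>)"
    unfolding pp_h_eq using invertible_pp_wave tr by blast
  have "continuous_on (amb_domain M \<epsilon>) (\<lambda>P. F1 P + F2 P)"
    unfolding F2_def by (intro continuous_intros continuous_on_hp smooth_on_continuous_on
      smooth_on_F1 smooth_on_ser_fc)
  then have "continuous_on (amb_domain M \<epsilon>) (\<lambda>P. H (base_point P) + \<phi> (base_point P) (P $ Crho))"
    by (rule continuous_on_eq) (rule F_eq[symmetric])
  then show "continuous_on (amb_domain M \<epsilon>) (amb (pp_wave H) (pp_h H f))"
    unfolding pp_h_eq by (rule continuous_on_amb_pp)
  have "smooth_on (Dne \<epsilon>) (\<lambda>P. F1 P + F2 P)"
    by (intro smooth_on_add open_Dne smooth_on_F2 smooth_on_subset[OF smooth_on_F1]) auto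
  then have "smooth_on (Dne \<epsilon>) (\<lambda>P. H (base_point P) + \<phi> (base_point P) (P $ Crho))"
    by (rule smooth_on_cong[OF open_Dne, rotated]) (auto simp: F_eq)
  then show "\<forall>i j. smooth_on (Dne \<epsilon>) (\<lambda>P. amb (pp_wave H) (pp_h H f) P $ i $ j)"
    unfolding pp_h_eq using smooth_on_amb_pp[OF open_Dne] by blast
  show "\<forall>k. enat k \<le> amb_order n \<longrightarrow> ricci_O M (amb (pp_wave H) (pp_h H f)) k"
  proof (intro allI impI)
    fix k assume k: "enat k \<le> amb_order n"
    show "ricci_O M (amb (pp_wave H) (pp_h H f)) k"
    proof (rule ricci_OI[OF M \<epsilon>, where u = "\<lambda>P. err (base_point P) * (P $ Crho) ^ (m - k)"
      and I = "Cm Cu" and J = "Cm Cu"])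
      show "continuous_on (amb_domain M \<epsilon>) (\<lambda>P. err (base_point P) * (P $ Crho) ^ (m - k))"
        by (intro continuous_intros continuous_on_base smooth_on_err)
      fix P :: "real^('n pp_coord amb_coord)" and i j assume "P \<in> amb_domain M \<epsilon>" "P $ Crho \<noteq> 0"
      then have "P \<in> Dne \<epsilon>" by simp
      from ricci_pp_h[OF open_Dne _ smooth_on_F2 _ this, of i j]
      have "ricci (amb (pp_wave H) (pp_h H f)) P $ i $ j
        = (if i = Cm Cu \<and> j = Cm Cu then err (base_point P) * (P $ Crho) ^ m else 0)" by auto
      moreover have "err (base_point P) * (P $ Crho) ^ m
        = err (base_point P) * (P $ Crho) ^ (m - k) * (P $ Crho) ^ k"
      proof (cases "odd n")
        case False
        then have "k \<le> m" using k by (simp add: amb_order_def m_def)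
        then show ?thesis by (simp add: mult.assoc flip: power_add)
      qed (simp add: err_def)
      ultimately show "ricci (amb (pp_wave H) (pp_h H f)) P $ i $ j
        = (if i = Cm Cu \<and> j = Cm Cu then err (base_point P) * (P $ Crho) ^ (m
          - k) * (P $ Crho) ^ k else 0)" by simp
    qed
  qed
qed

lemma smooth_ambient_metric_pp:
  assumes "smooth_on (amb_domain M \<epsilon>) F2"
  shows "smooth_ambient_metric M \<epsilon> (pp_wave H) (pp_h H f)"
proof -
  note oD = open_amb_domain[OF M]
  have "smooth_on (amb_domain M \<epsilon>) (\<lambda>P. F1 P + F2 P)"
    by (intro smooth_on_add oD assms smooth_on_F1)
  then have "smooth_on (amb_domain M \<epsilon>) (\<lambda>P. H (base_point P) + \<phi> (base_point P) (P $ Crho))"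
    by (rule smooth_on_cong[OF oD, rotated]) (auto simp: F_eq)
  then show ?thesis
    unfolding smooth_ambient_metric_def using ambient_metric_pp smooth_on_amb_pp[OF oD]
      unfolding pp_h_eq by blast
qed

lemma ricci_pp_h_smooth:
  assumes "smooth_on (amb_domain M \<epsilon>) F2" "P \<in> amb_domain M \<epsilon>"
  shows "ricci (amb (pp_wave H) (pp_h H f)) P $ i $ j
    = (if i = Cm Cu \<and> j = Cm Cu then err (base_point P) * (P $ Crho) ^ m else 0)"
  by (rule ricci_pp_h[OF open_amb_domain[OF M] _ assms(1) _ assms(2)]) auto

lemma smooth_on_F2_even:
  assumes "even n" shows "smooth_on (amb_domain M \<epsilon>) F2"
proof -
  have "hp = (\<lambda>P. (P $ Crho) ^ (n div 2))" using assms by (simp add: hp_def[abs_def] half_power_def)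
  then have "smooth_on (amb_domain M \<epsilon>) hp" by (simp add: smooth_on_power open_amb_domain M
    smooth_on_coord)
  then show ?thesis unfolding F2_def[abs_def] by (intro smooth_on_mult open_amb_domain M
    smooth_on_ser_fc)
qed

lemma ricci_flat_pp:
  assumes "smooth_on (amb_domain M \<epsilon>) F2" "\<And>x. x \<in> M \<Longrightarrow> err x = 0"
  shows "ricci_flat_on (amb_domain M \<epsilon>) (amb (pp_wave H) (pp_h H f))"
  unfolding ricci_flat_on_def
proof
  fix P assume P: "P \<in> amb_domain M \<epsilon>"
  then have "base_point P \<in> M" by (simp add: amb_domain_def)
  then show "ricci (amb (pp_wave H) (pp_h H f)) P = 0"
    using ricci_pp_h_smooth[OF assms(1) P] assms(2) by (simp add: vec_eq_iff)
qed

end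

end

section \<open>Uniqueness\<close>

lemma rho_zero_point: "P $ Crho = 0 \<Longrightarrow> P = amb_point (P $ Ct) (base_point P) 0"
  using amb_point_base_point[of P] by simp

text \<open>The components of g + h are the tangential components of the ambient metric divided by
  t^2. The radius may be reduced so that two ambient metrics can be compared on a common
  domain.\<close>

lemma normal_form_smooth_ambient:
  assumes M: "open M" and sa: "smooth_ambient_metric M \<delta> g h" and "\<delta>' \<le> \<delta>"
    and sym: "\<And>x. x \<in> M \<Longrightarrow> transpose (g x) = g x"
  shows "normal_form g h (amb_domain M \<delta>')"
proof
  let ?S = "amb_domain M \<delta>'"
  have sub: "?S \<subseteq> amb_domain M \<delta>" using assms(3) by (auto simp: amb_domain_def)
  have am: "ambient_metric M \<delta> g h" and sm: "smooth_on (amb_domain M \<delta>) (\<lambda>P. amb g h P $ i $ j)" for i j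
    using sa by (auto simp: smooth_ambient_metric_def)
  show oS: "open ?S" by (rule open_amb_domain[OF M])
  show "0 < P $ Ct" if "P \<in> ?S" for P using that by (simp add: amb_domain_def)
  show "smooth_on ?S (\<lambda>P. (g (base_point P) + h (base_point P) (P $ Crho)) $ a $ b)" for a b
  proof (rule smooth_on_cong[OF oS])
    show "amb g h P $ Cm a $ Cm b / (P $ Ct * P $ Ct) = (g (base_point P)
      + h (base_point P) (P $ Crho)) $ a $ b"
      if "P \<in> ?S" for P using that by (simp add: amb_def amb_domain_def power2_eq_square)
    show "smooth_on ?S (\<lambda>P. amb g h P $ Cm a $ Cm b / (P $ Ct * P $ Ct))"
      by (intro smooth_intros oS smooth_on_subset[OF sm sub]) (auto simp: amb_domain_def)
  qed
  fix P assume "P \<in> ?S"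
  then have P: "base_point P \<in> M" "\<bar>P $ Crho\<bar> < \<delta>" using assms(3) by (auto simp: amb_domain_def)
  have h: "transpose (h (base_point P) (P $ Crho)) = h (base_point P) (P $ Crho)"
    and inv: "invertible (g (base_point P) + h (base_point P) (P $ Crho))"
    using am P by (auto simp: ambient_metric_def)
  show "invertible (g (base_point P) + h (base_point P) (P $ Crho))" by (rule inv)
  have "transpose (A + B) = transpose A + transpose B" for A B :: "real^'a^'a"
    by (simp add: transpose_def vec_eq_iff)
  then show "transpose (g (base_point P) + h (base_point P) (P $ Crho))
    = g (base_point P) + h (base_point P) (P $ Crho)"
    using h sym[OF P(1)] by simp
qed

section \<open>Iteration of the comparison step\<close>

context normal_form_pair
begin

lemma eqv_Suc_0:
  assumes "\<And>P a b. P \<in> S \<Longrightarrow> P $ Crho = 0 \<Longrightarrow> A.G a b P = B.G a b P"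
  shows "eqv S (Suc 0) (A.G a b) (B.G a b)"
  using assms smooth_on_D[of a b] by (auto simp: eqv_def[OF oS] smooths D_def[abs_def] intro:
    smooth_on_partial)

text \<open>Odd dimension excludes the order n/2 at every stage. At order n the
  \<rho>\<rho>-component applies: there j = n - 1 is positive, so a derivative of order j - 1
  exists.\<close>

lemma eqv_flat:
  assumes 0: "\<And>P a b. P \<in> S \<Longrightarrow> P $ Crho = 0 \<Longrightarrow> A.G a b P = B.G a b P"
    and flat: "\<And>P. P \<in> S \<Longrightarrow> ricci (amb g h) P = 0" "\<And>P. P \<in> S \<Longrightarrow> ricci (amb g h') P = 0"
    and n: "odd CARD('m)" "1 < CARD('m)"
  shows "eqv S (Suc j) (A.G a b) (B.G a b)"
proof (induction j arbitrary: a b)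
  case 0
  show ?case by (rule eqv_Suc_0) (rule assms(1))
next
  case (Suc j)
  have z: "rho_deriv i F P = rho_deriv i F' P" if "P \<in> S" "\<And>P. P \<in> S \<Longrightarrow> F P = 0" "\<And>P. P \<in> S
    \<Longrightarrow> F' P = 0" for i F F' P
    by (rule rho_deriv_cong[OF oS _ that(1)]) (simp add: that)
  show ?case
  proof (rule eqv_step[OF Suc])
    show "rho_deriv j (A.Ric a b) P = rho_deriv j (B.Ric a b) P" if "P \<in> S" for P a b
      by (rule z[OF that]) (simp_all add: A.Ric_def B.Ric_def flat)
    show "2 * Suc j \<noteq> CARD('m)" using n(1) by (metis dvd_triv_left)
    assume "Suc j = CARD('m)"
    then obtain i where "j = Suc i" using n(2) by (cases j) auto
    moreover have "rho_deriv i A.Ric_rho P = rho_deriv i B.Ric_rho P" if "P \<in> S" for P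
      by (rule z[OF that]) (simp_all add: A.Ric_rho_def B.Ric_rho_def flat)
    ultimately show "\<exists>i. j = Suc i \<and> (\<forall>P\<in>S. P $ Crho = 0
      \<longrightarrow> rho_deriv i A.Ric_rho P = rho_deriv i B.Ric_rho P)"
      by blast
  qed
qed

text \<open>The orders j + 1 met in the induction are at most m, which is less than n/2, so neither
  exceptional order occurs before agreement modulo \<rho>^(n/2) is reached.\<close>

lemma eqv_upto:
  assumes 0: "\<And>P a b. P \<in> S \<Longrightarrow> P $ Crho = 0 \<Longrightarrow> A.G a b P = B.G a b P"
    and Ric: "\<And>i P a b. i < m \<Longrightarrow> P \<in> S \<Longrightarrow> P $ Crho = 0 \<Longrightarrow> rho_deriv i (A.Ric a b) P
      = rho_deriv i (B.Ric a b) P"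
    and n: "CARD('m) = 2 * m + 2"
  shows "j \<le> m \<Longrightarrow> eqv S (Suc j) (A.G a b) (B.G a b)"
proof (induction j arbitrary: a b)
  case 0
  show ?case by (rule eqv_Suc_0) (rule assms(1))
next
  case (Suc j)
  then have "eqv S (Suc j) (A.G a b) (B.G a b)" for a b by simp
  then show ?case
    by (rule eqv_step) (use Ric Suc.prems n in auto)
qed

end

lemma ambient_initial:
  assumes "smooth_ambient_metric M \<delta> g h" "x \<in> M"
  shows "h x 0 = 0"
  using assms by (simp add: smooth_ambient_metric_def ambient_metric_def)

text \<open>The comparison shows that the difference is flat at \<rho> = 0; analyticity in \<rho> at
  each fixed x turns flatness into equality on the common interval.\<close>

lemma ricci_flat_unique:
  fixes g :: "'m::finite metric"
  assumes M: "open M" and sym: "\<And>x. x \<in> M \<Longrightarrow> transpose (g x) = g x"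
    and n: "odd CARD('m)" "1 < CARD('m)"
    and h: "smooth_ambient_metric M \<delta> g h" "ricci_flat_on (amb_domain M \<delta>) (amb g h)"
      "analytic_in_rho M \<delta> h"
    and h': "smooth_ambient_metric M \<epsilon> g h'" "ricci_flat_on (amb_domain M \<epsilon>) (amb g h')"
      "analytic_in_rho M \<epsilon> h'"
    and x: "x \<in> M" and r: "\<bar>r\<bar> < min \<epsilon> \<delta>"
  shows "h x r = h' x r"
proof -
  define d where "d = min \<epsilon> \<delta>"
  let ?S = "amb_domain M d"
  have d: "d \<le> \<delta>" "d \<le> \<epsilon>" "0 < d" using r by (auto simp: d_def)
  interpret normal_form_pair g h h' ?S
    by (intro normal_form_pair.intro normal_form_smooth_ambient[OF M h(1) d(1) sym]
      normal_form_smooth_ambient[OF M h'(1) d(2) sym])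
  have sub: "?S \<subseteq> amb_domain M \<delta>" "?S \<subseteq> amb_domain M \<epsilon>" using d by (auto simp: amb_domain_def)
  have eqv: "eqv ?S (Suc j) (A.G a b) (B.G a b)" for j a b
  proof (rule eqv_flat[OF _ _ _ n])
    show "A.G a b P = B.G a b P" if "P \<in> ?S" "P $ Crho = 0" for P a b
      using that ambient_initial[OF h(1)] ambient_initial[OF h'(1)]
        by (simp add: A.G_def B.G_def amb_domain_def)
    show "ricci (amb g h) P = 0" "ricci (amb g h') P = 0" if "P \<in> ?S" for P
      using h(2) h'(2) sub that by (auto simp: ricci_flat_on_def)
  qed
  have "h x r $ a $ b - h' x r $ a $ b = 0" for a b
  proof (rule real_analytic_identity[where f = "\<lambda>r. h x r $ a $ b - h' x r $ a $ b" and d = d])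
    show "\<bar>r\<bar> < d" using r by (simp add: d_def)
    fix s assume "\<bar>s\<bar> < d"
    then have "\<bar>s\<bar> < \<delta>" "\<bar>s\<bar> < \<epsilon>" using d by auto
    then obtain F F' where "(\<lambda>u. h x (s + u) $ a $ b) has_fps_expansion F" "(\<lambda>u. h' x (s
      + u) $ a $ b) has_fps_expansion F'"
      using h(3) h'(3) x unfolding analytic_in_rho_def by meson
    from has_fps_expansion_diff[OF this]
    show "\<exists>F. (\<lambda>u. h x (s + u) $ a $ b - h' x (s + u) $ a $ b) has_fps_expansion F" by blast
  next
    fix k
    \<comment> \<open>The tangential components divided by t^2 do not depend on t, so the slice t =
      1 carries all the information.\<close>
    have z: "rho_deriv j (D a b) (amb_point 1 x 0) = 0" for j
      using eqv[of j a b] x d(3) amb_point_mem[of x M 1 0 d]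
      unfolding eqv_def[OF oS] vanishes_iff D_def[abs_def] by simp
    have "((\<lambda>r. D a b (amb_point 1 x r) / r ^ k) \<longlongrightarrow> rho_deriv k (D a b) (amb_point 1 x 0) / fact k)
      (at 0)"
      by (rule rho_deriv_limit[OF M d(3) smooth_on_D x zero_less_one z])
    then show "((\<lambda>r. (h x r $ a $ b - h' x r $ a $ b) / r ^ k) \<longlongrightarrow> 0) (at 0)"
      by (simp add: z D_def A.G_def B.G_def)
  qed
  then show ?thesis by (simp add: vec_eq_iff)
qed

text \<open>Both tangential Ricci tensors vanish to order m = n/2 - 1, so the metrics agree modulo
  \<rho>^(n/2), and \<open>L\<close> and \<open>L'\<close> are the m-th Taylor coefficients. At this
  order the Ricci tensors can differ only by a multiple of g, which the trace conditions
  exclude.\<close>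

lemma obstruction_unique:
  fixes g :: "'m::finite metric"
  assumes M: "open M" and sym: "\<And>x. x \<in> M \<Longrightarrow> transpose (g x) = g x"
    and n: "CARD('m) = 2 * m + 2"
    and h: "smooth_ambient_metric M \<delta> g h" and h': "smooth_ambient_metric M \<epsilon> g h'"
    and L: "\<And>x a b. x \<in> M \<Longrightarrow> ((\<lambda>\<rho>. ricci (amb g h) (amb_point 1 x \<rho>) $ Cm a $ Cm b / \<rho> ^ m) \<longlongrightarrow> L x $ a
      $ b) (at 0)"
    and L': "\<And>x a b. x \<in> M \<Longrightarrow> ((\<lambda>\<rho>. ricci (amb g h') (amb_point 1 x \<rho>) $ Cm a $ Cm b / \<rho> ^ m) \<longlongrightarrow> L' x
      $ a $ b) (at 0)"
    and tr: "\<And>x. x \<in> M \<Longrightarrow> (\<Sum>a\<in>UNIV. \<Sum>b\<in>UNIV. matrix_inv (g x) $ a $ b * L x $ a $ b) = 0"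
    and tr': "\<And>x. x \<in> M \<Longrightarrow> (\<Sum>a\<in>UNIV. \<Sum>b\<in>UNIV. matrix_inv (g x) $ a $ b * L' x $ a $ b) = 0"
    and x: "x \<in> M"
  shows "L x = L' x"
proof -
  define d where "d = min \<epsilon> \<delta>"
  let ?S = "amb_domain M d"
  have "0 < \<delta>" "0 < \<epsilon>" using h h' by (auto simp: smooth_ambient_metric_def ambient_metric_def)
  then have d: "d \<le> \<delta>" "d \<le> \<epsilon>" "0 < d" by (auto simp: d_def)
  interpret normal_form_pair g h h' ?S
    by (intro normal_form_pair.intro normal_form_smooth_ambient[OF M h d(1) sym]
      normal_form_smooth_ambient[OF M h' d(2) sym])
  have m: "enat m \<le> amb_order CARD('m)" by (simp add: n amb_order_def)
  have O: "A.Ric a b \<in> O[at (amb_point t x 0) within {P. P $ Crho \<noteq> 0}](\<lambda>P. (P $ Crho) ^ m)"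
      "B.Ric a b \<in> O[at (amb_point t x 0) within {P. P $ Crho \<noteq> 0}](\<lambda>P. (P $ Crho) ^ m)"
    if "x \<in> M" "0 < t" for x t a b
    unfolding A.Ric_def[abs_def] B.Ric_def[abs_def]
    using h h' m that by (auto simp: smooth_ambient_metric_def ambient_metric_def ricci_O_def)
  have z: "rho_deriv i (A.Ric a b) (amb_point t x 0) = 0" "rho_deriv i (B.Ric a b) (amb_point t x 0)
    = 0"
    if "i < m" "x \<in> M" "0 < t" for i a b t x
    by (rule rho_deriv_zero_of_bigo[OF M d(3) A.smooth_on_Ric that(2,3) O(1)[OF that(2,3)] that(1)])
      (rule rho_deriv_zero_of_bigo[OF M d(3) B.smooth_on_Ric that(2,3) O(2)[OF that(2,3)] that(1)])
  have eqv: "eqv ?S (Suc m) (A.G a b) (B.G a b)" for a b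
  proof (rule eqv_upto[OF _ _ n order_refl])
    show "A.G a b P = B.G a b P" if "P \<in> ?S" "P $ Crho = 0" for P a b
      using that ambient_initial[OF h] ambient_initial[OF h']
        by (simp add: A.G_def B.G_def amb_domain_def)
    fix i P a b assume i: "i < m" and P: "P \<in> ?S" "P $ Crho = 0"
    have "base_point P \<in> M" "0 < P $ Ct" using P(1) by (auto simp: amb_domain_def)
    from z[OF i this] show "rho_deriv i (A.Ric a b) P = rho_deriv i (B.Ric a b) P"
      using rho_zero_point[OF P(2)] by metis
  qed
  define p where "p = amb_point 1 x 0"
  have p: "p \<in> ?S" "p $ Crho = 0" using x d by (auto simp: p_def intro!: amb_point_mem)
  have lim: "rho_deriv m (A.Ric a b) p = fact m * L x $ a $ b" "rho_deriv m (B.Ric a b) p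
    = fact m * L' x $ a $ b" for a b
  proof -
    have "((\<lambda>r. A.Ric a b (amb_point 1 x r) / r ^ m) \<longlongrightarrow> rho_deriv m (A.Ric a b) p / fact m) (at 0)"
      unfolding p_def by (intro rho_deriv_limit[OF M d(3) A.smooth_on_Ric x zero_less_one] z x) auto
    with L[OF x, of a b] have "rho_deriv m (A.Ric a b) p / fact m = L x $ a $ b"
      unfolding A.Ric_def by (rule tendsto_unique[OF at_neq_bot, rotated])
    then show "rho_deriv m (A.Ric a b) p = fact m * L x $ a $ b" by (simp add: field_simps)
    have "((\<lambda>r. B.Ric a b (amb_point 1 x r) / r ^ m) \<longlongrightarrow> rho_deriv m (B.Ric a b) p / fact m) (at 0)"
      unfolding p_def by (intro rho_deriv_limit[OF M d(3) B.smooth_on_Ric x zero_less_one] z x) auto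
    with L'[OF x, of a b] have "rho_deriv m (B.Ric a b) p / fact m = L' x $ a $ b"
      unfolding B.Ric_def by (rule tendsto_unique[OF at_neq_bot, rotated])
    then show "rho_deriv m (B.Ric a b) p = fact m * L' x $ a $ b" by (simp add: field_simps)
  qed
  have Ginv: "A.Ginv a b p = matrix_inv (g x) $ a $ b" for a b
    using ambient_initial[OF h x] by (simp add: A.Ginv_def p_def)
  have "(\<Sum>a\<in>UNIV. \<Sum>b\<in>UNIV. A.Ginv a b p * (fact m * L x $ a $ b))
    = fact m * (\<Sum>a\<in>UNIV. \<Sum>b\<in>UNIV. matrix_inv (g x) $ a $ b * L x $ a $ b)" for L
    by (simp add: Ginv sum_distrib_left mult.left_commute)
  then have tr0: "(\<Sum>a\<in>UNIV. \<Sum>b\<in>UNIV. A.Ginv a b p * rho_deriv m (A.Ric a b) p) = 0"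
      "(\<Sum>a\<in>UNIV. \<Sum>b\<in>UNIV. A.Ginv a b p * rho_deriv m (B.Ric a b) p) = 0"
    unfolding lim using tr[OF x] tr'[OF x] by simp_all
  have "rho_deriv m (A.Ric a b) p = rho_deriv m (B.Ric a b) p" for a b
    by (rule Ric_obstruction_eq[OF eqv p _ tr0]) (simp add: n)
  then have "L x $ a $ b = L' x $ a $ b" for a b unfolding lim by simp
  then show ?thesis by (simp add: vec_eq_iff)
qed

section \<open>The main theorem\<close>

lemma coeff_f_zero: "coeff_f (\<lambda>_. 0) k (x :: real^('n::finite pp_coord)) = 0"
proof -
  have "(laplacian ^^ k) (\<lambda>_ :: real^('n pp_coord). 0) = (\<lambda>_. 0)" by (induction k) auto
  then show ?thesis by (simp add: coeff_f_def)
qed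

lemma converges_smoothly_zero: "converges_smoothly M \<epsilon> (coeff_f (\<lambda>_. 0))"
  by (simp add: converges_smoothly_def coeff_f_zero)

lemma pp_h_zero: "pp_h H (\<lambda>_. 0) x r = (\<Sum>k. coeff_H H k x * r ^ k) *\<^sub>R du2"
  by (simp add: pp_h_def coeff_f_zero)

lemma analytic_in_rho_pp_h:
  assumes "converges_smoothly M \<epsilon> (coeff_H H)"
  shows "analytic_in_rho M \<epsilon> (pp_h H (\<lambda>_. 0))"
  unfolding analytic_in_rho_def
proof (intro ballI allI impI)
  fix x and r :: real and a b assume x: "x \<in> M" and r: "\<bar>r\<bar> < \<epsilon>"
  obtain F where F: "(\<lambda>s. \<Sum>k. coeff_H H k x * (r + s) ^ k) has_fps_expansion F"
    using power_series_has_fps_expansion[OF _ r, of "\<lambda>k. coeff_H H k x"] assms x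
    by (auto simp: converges_smoothly_def)
  from has_fps_expansion_cmult_right[OF this, of "du2 $ a $ b"]
  show "\<exists>F. (\<lambda>s. pp_h H (\<lambda>_. 0) x (r + s) $ a $ b) has_fps_expansion F"
    unfolding pp_h_zero by auto
qed

lemma transpose_pp_wave_0: "transpose (pp_wave H x) = pp_wave H x"
  using transpose_pp_wave[of H x 0] by simp

context pp_data
begin

lemma pp_data_zero: "pp_data M H (\<lambda>_. 0) n m"
proof
  show "indep_v M (\<lambda>_. 0)" by (simp add: indep_v_def)
qed (rule n_def m_def M H Hv smooth_on_const)+

lemma pp_ambient_metric_odd:
  assumes n: "odd n" and \<epsilon>: "0 < \<epsilon>" and conv: "converges_smoothly M \<epsilon> (coeff_H H)"
  shows "smooth_ambient_metric M \<epsilon> (pp_wave H) (pp_h H (\<lambda>_. 0))"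
    "ricci_flat_on (amb_domain M \<epsilon>) (amb (pp_wave H) (pp_h H (\<lambda>_. 0)))"
    "analytic_in_rho M \<epsilon> (pp_h H (\<lambda>_. 0))"
    "smooth_ambient_metric M \<delta> (pp_wave H) h \<Longrightarrow> ricci_flat_on (amb_domain M \<delta>) (amb (pp_wave H) h) \<Longrightarrow>
      analytic_in_rho M \<delta> h \<Longrightarrow> x \<in> M \<Longrightarrow> \<bar>\<rho>\<bar> < min \<epsilon> \<delta> \<Longrightarrow> h x \<rho> = pp_h H (\<lambda>_. 0) x \<rho>"
proof -
  interpret Z: pp_data M H "\<lambda>_. 0" n m by (rule pp_data_zero)
  \<comment> \<open>With f = 0 the half-integral term is absent, which gives smoothness across
    \<rho> = 0 although n is odd.\<close>
  have F2: "smooth_on (amb_domain M \<epsilon>) Z.F2"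
  proof -
    have "Z.F2 = (\<lambda>_. 0)"
      by (simp add: fun_eq_iff Z.F2_def Z.ser_sum_def Z.coeff_f_fc[symmetric] coeff_f_zero)
    then show ?thesis by simp
  qed
  show 1: "smooth_ambient_metric M \<epsilon> (pp_wave H) (pp_h H (\<lambda>_. 0))"
    by (rule Z.smooth_ambient_metric_pp[OF \<epsilon> conv converges_smoothly_zero F2])
  show 2: "ricci_flat_on (amb_domain M \<epsilon>) (amb (pp_wave H) (pp_h H (\<lambda>_. 0)))"
    by (rule Z.ricci_flat_pp[OF \<epsilon> conv converges_smoothly_zero F2]) (simp add: Z.err_def n)
  show 3: "analytic_in_rho M \<epsilon> (pp_h H (\<lambda>_. 0))"
    by (rule analytic_in_rho_pp_h[OF conv])
  show "h x \<rho> = pp_h H (\<lambda>_. 0) x \<rho>"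
    if "smooth_ambient_metric M \<delta> (pp_wave H) h" "ricci_flat_on (amb_domain M \<delta>) (amb (pp_wave H) h)"
      "analytic_in_rho M \<delta> h" "x \<in> M" "\<bar>\<rho>\<bar> < min \<epsilon> \<delta>"
    by (rule ricci_flat_unique[OF M transpose_pp_wave_0 _ _ that(1-3) 1 2 3 that(4,5)])
      (use n n_ge in \<open>auto simp: n_def\<close>)
qed

text \<open>The factor between \<open>err\<close> and the iterated Laplacian of H: -1/2 from the
  Ricci formula, divided by the denominator of the last coefficient. It depends on the dimension
  alone.\<close>

definition obstruction_const :: real where
  "obstruction_const = - 1 / (2 * (fact m * (\<Prod>i=1..m. 2 * real i - real n)))"

lemma err_eq:
  assumes "even n" "x \<in> M"
  shows "err x = obstruction_const * (laplacian ^^ (n div 2)) H x"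
proof -
  have "n div 2 = Suc m" using even_n[OF assms(1)] by simp
  then show ?thesis
    using assms(1) laplacian_lap_coeff_eq[OF M H assms(2), of "- real n" m]
    by (simp add: err_def obstruction_const_def Hc_def)
qed

text \<open>The metric with f = 0 realises the obstruction with L = \<open>err\<close> times
  \<open>du2\<close>, trace free because the uu entry of the inverse metric is 0; uniqueness of L
  yields the other direction. For even n the series in H is a polynomial, so \<epsilon> = 1 is
  admissible.\<close>

lemma is_obstruction_iff:
  assumes n: "even n" and \<kappa>: "\<kappa> \<noteq> 0"
  shows "is_obstruction \<kappa> M (pp_wave H) Ob \<longleftrightarrow>
    (\<forall>x\<in>M. Ob x = (\<kappa> * obstruction_const * (laplacian ^^ (n div 2)) H x) *\<^sub>R du2)"
proof -
  interpret Z: pp_data M H "\<lambda>_. 0" n m by (rule pp_data_zero)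
  define L0 where "L0 x = err x *\<^sub>R (du2 :: real^('n pp_coord)^('n pp_coord))" for x
  have convH: "odd n \<Longrightarrow> converges_smoothly M 1 (coeff_H H)" using n by simp
  note Z = zero_less_one convH converges_smoothly_zero
  have sa: "smooth_ambient_metric M 1 (pp_wave H) (pp_h H (\<lambda>_. 0))"
    by (rule Z.smooth_ambient_metric_pp[OF Z Z.smooth_on_F2_even[OF Z n]])
  have lim: "((\<lambda>\<rho>. ricci (amb (pp_wave H) (pp_h H (\<lambda>_. 0)))
    (amb_point t x \<rho>) $ Cm a $ Cm b / \<rho> ^ m) \<longlongrightarrow> L0 x $ a $ b) (at 0)"
    if "x \<in> M" "0 < t" for x t a b
  proof (rule tendsto_eventually)
    have "eventually (\<lambda>r. r \<in> {-1<..<1}) (nhds (0::real))" by (intro eventually_nhds_in_open) auto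
    then show "eventually (\<lambda>\<rho>. ricci (amb (pp_wave H) (pp_h H (\<lambda>_. 0)))
      (amb_point t x \<rho>) $ Cm a $ Cm b / \<rho> ^ m = L0 x $ a $ b) (at 0)"
      unfolding eventually_at_filter
    proof eventually_elim
      case (elim r)
      then have "amb_point t x r \<in> amb_domain M 1" using that by (intro amb_point_mem) auto
      from Z.ricci_pp_h_smooth[OF Z Z.smooth_on_F2_even[OF Z n] this, of "Cm a" "Cm b"]
      show ?case by (auto simp: L0_def du2_def)
    qed
  qed
  have tr: "(\<Sum>a\<in>UNIV. \<Sum>b\<in>UNIV. matrix_inv (pp_wave H x) $ a $ b * L0 x $ a $ b) = 0" for x
  proof -
    have "matrix_inv (pp_wave H x) $ Cu $ Cu = 0" using matrix_inv_pp_wave[of H x 0 Cu Cu] by simp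
    then show ?thesis by (simp add: sum_pp_coord L0_def du2_def)
  qed
  have m: "CARD('n pp_coord) div 2 - 1 = m" "CARD('n pp_coord) = 2 * m + 2"
    using even_n[OF n] by (simp_all add: n_def)
  have eq: "\<kappa> *\<^sub>R L0 x = (\<kappa> * obstruction_const * (laplacian ^^ (n div 2)) H x) *\<^sub>R du2"
    if "x \<in> M" for x
    using err_eq[OF n that] by (simp add: L0_def mult.assoc)
  show ?thesis
  proof
    assume "is_obstruction \<kappa> M (pp_wave H) Ob"
    then obtain \<epsilon> h L where L: "smooth_ambient_metric M \<epsilon> (pp_wave H) h"
        "\<And>x t a b. x \<in> M \<Longrightarrow> 0 < t \<Longrightarrow>
           ((\<lambda>\<rho>. ricci (amb (pp_wave H) h) (amb_point t x \<rho>) $ Cm a $ Cm b / \<rho> ^ m) \<longlongrightarrow> L x $ a $ b)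
             (at 0)"
        "\<And>x. x \<in> M \<Longrightarrow> (\<Sum>a\<in>UNIV. \<Sum>b\<in>UNIV. matrix_inv (pp_wave H x) $ a $ b * L x $ a $ b) = 0"
        "\<And>x. x \<in> M \<Longrightarrow> Ob x = \<kappa> *\<^sub>R L x"
      unfolding is_obstruction_def m(1) by blast
    have "L x = L0 x" if "x \<in> M" for x
      by (rule obstruction_unique[OF M transpose_pp_wave_0 m(2) L(1) sa L(2) lim L(3) tr that]) auto
    then show "\<forall>x\<in>M. Ob x = (\<kappa> * obstruction_const * (laplacian ^^ (n div 2)) H x) *\<^sub>R du2"
      using L(4) eq by simp
  next
    assume "\<forall>x\<in>M. Ob x = (\<kappa> * obstruction_const * (laplacian ^^ (n div 2)) H x) *\<^sub>R du2"
    then have "\<forall>x\<in>M. Ob x = \<kappa> *\<^sub>R L0 x" using eq by simp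
    then show "is_obstruction \<kappa> M (pp_wave H) Ob"
      unfolding is_obstruction_def m(1) using sa lim tr by blast
  qed
qed

lemma obstruction_const_nonzero: "even n \<Longrightarrow> obstruction_const \<noteq> 0"
proof -
  assume n: "even n"
  have "2 * real i - real n \<noteq> 0" if "i \<in> {1..m}" for i
    using that even_n[OF n] by auto
  then show ?thesis by (simp add: obstruction_const_def)
qed

lemma obstruction_zero:
  assumes n: "even n" and \<kappa>: "\<kappa> \<noteq> 0" and ob: "is_obstruction \<kappa> M (pp_wave H) (\<lambda>_. 0)" and x: "x \<in> M"
  shows "err x = 0"
proof -
  have "(\<kappa> * obstruction_const * (laplacian ^^ (n div 2)) H x) *\<^sub>R
    (du2 :: real^('n pp_coord)^('n pp_coord)) = 0"
    using is_obstruction_iff[OF n \<kappa>] ob x by metis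
  then have "((\<kappa> * obstruction_const * (laplacian ^^ (n div 2)) H x) *\<^sub>R
    (du2 :: real^('n pp_coord)^('n pp_coord))) $ Cu $ Cu = 0"
    by (simp only: zero_index)
  then show ?thesis using \<kappa> err_eq[OF n x] by (simp add: du2_def)
qed

end

theorem theorem1p5:
  fixes \<kappa> :: real
  assumes "\<kappa> \<noteq> 0"
  shows "\<exists>c::real. c \<noteq> 0 \<and>
    (\<forall>(M :: (real^('n::finite pp_coord)) set) H f.
      open M \<and> smooth_on M H \<and> indep_v M H \<and> smooth_on M f \<and> indep_v M f \<longrightarrow>
      formal_ricci_O M (pp_wave H) (pp_h_trunc H f) (amb_order CARD('n pp_coord)) \<and>
      (\<forall>\<epsilon>>0. (odd CARD('n pp_coord) \<longrightarrow> converges_smoothly M \<epsilon> (coeff_H H)) \<and>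
              converges_smoothly M \<epsilon> (coeff_f f) \<longrightarrow>
         ambient_metric M \<epsilon> (pp_wave H) (pp_h H f) \<and>
         (even CARD('n pp_coord) \<longrightarrow> smooth_ambient_metric M \<epsilon> (pp_wave H) (pp_h H f))) \<and>
      (odd CARD('n pp_coord) \<longrightarrow>
         (\<forall>\<epsilon>>0. converges_smoothly M \<epsilon> (coeff_H H) \<longrightarrow>
            smooth_ambient_metric M \<epsilon> (pp_wave H) (pp_h H (\<lambda>_. 0)) \<and>
            ricci_flat_on (amb_domain M \<epsilon>) (amb (pp_wave H) (pp_h H (\<lambda>_. 0))) \<and>
            analytic_in_rho M \<epsilon> (pp_h H (\<lambda>_. 0)) \<and>
            (\<forall>\<delta> h. smooth_ambient_metric M \<delta> (pp_wave H) h \<and>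
                    ricci_flat_on (amb_domain M \<delta>) (amb (pp_wave H) h) \<and>
                    analytic_in_rho M \<delta> h \<longrightarrow>
               (\<forall>x\<in>M. \<forall>\<rho>. \<bar>\<rho>\<bar> < min \<epsilon> \<delta> \<longrightarrow> h x \<rho> = pp_h H (\<lambda>_. 0) x \<rho>)))) \<and>
      (even CARD('n pp_coord) \<longrightarrow>
         (\<forall>Ob. is_obstruction \<kappa> M (pp_wave H) Ob \<longleftrightarrow>
            (\<forall>x\<in>M. Ob x = (c * (laplacian ^^ (CARD('n pp_coord) div 2)) H x) *\<^sub>R du2)) \<and>
         (is_obstruction \<kappa> M (pp_wave H) (\<lambda>_. 0) \<longrightarrow>
            formal_ricci_O M (pp_wave H) (pp_h_trunc H f) \<infinity> \<and>
            (\<forall>\<epsilon>>0. converges_smoothly M \<epsilon> (coeff_f f) \<longrightarrow>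
               ricci_flat_on (amb_domain M \<epsilon>) (amb (pp_wave H) (pp_h H f))))))"
proof -
  let "\<exists>c. c \<noteq> 0 \<and> (\<forall>M H f. ?hyps M H f \<longrightarrow> ?concl c M H f)" = ?thesis
  define m where "m = (CARD('n pp_coord) - 2) div 2"
  \<comment> \<open>\<open>c\<close> is fixed before M, H and f, so \<open>obstruction_const\<close>
    is written out here in terms of the dimension. For odd n the value 1 only secures
    \<open>c \<noteq> 0\<close>.\<close>
  define c where "c = (if even CARD('n pp_coord)
    then \<kappa> * (- 1 / (2 * (fact m * (\<Prod>i=1..m. 2 * real i - real CARD('n pp_coord))))) else 1)"
  have main: "?concl c M H f" if asm: "?hyps M H f" for M H f
  proof -
    interpret pp_data M H f "CARD('n pp_coord)" m
      using asm by unfold_locales (auto simp: m_def)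
    show ?thesis
    proof (intro conjI allI impI)
      show "formal_ricci_O M (pp_wave H) (pp_h_trunc H f) (amb_order CARD('n pp_coord))"
        by (rule formal_ricci_O_pp)
    next
      fix \<epsilon> :: real
      assume "0 < \<epsilon>" "(odd CARD('n pp_coord) \<longrightarrow> converges_smoothly M \<epsilon>
        (coeff_H H)) \<and> converges_smoothly M \<epsilon> (coeff_f f)"
      then have conv: "0 < \<epsilon>" "odd CARD('n pp_coord) \<Longrightarrow> converges_smoothly M \<epsilon> (coeff_H H)"
        "converges_smoothly M \<epsilon> (coeff_f f)"
        by auto
      show "ambient_metric M \<epsilon> (pp_wave H) (pp_h H f)" by (rule ambient_metric_pp[OF conv])
      show "smooth_ambient_metric M \<epsilon> (pp_wave H) (pp_h H f)" if "even CARD('n pp_coord)"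
        by (rule smooth_ambient_metric_pp[OF conv smooth_on_F2_even[OF conv that]])
    next
      fix \<epsilon> :: real
      assume odd: "odd CARD('n pp_coord)" and \<epsilon>: "0 < \<epsilon>" "converges_smoothly M \<epsilon> (coeff_H H)"
      show "smooth_ambient_metric M \<epsilon> (pp_wave H) (pp_h H (\<lambda>_. 0))"
        "ricci_flat_on (amb_domain M \<epsilon>) (amb (pp_wave H) (pp_h H (\<lambda>_. 0)))"
        "analytic_in_rho M \<epsilon> (pp_h H (\<lambda>_. 0))"
        by (rule pp_ambient_metric_odd[OF odd \<epsilon>])+
      show "\<forall>x\<in>M. \<forall>\<rho>. \<bar>\<rho>\<bar> < min \<epsilon> \<delta> \<longrightarrow> h x \<rho> = pp_h H (\<lambda>_. 0) x \<rho>"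
        if "smooth_ambient_metric M \<delta> (pp_wave H) h \<and> ricci_flat_on (amb_domain M \<delta>) (amb
          (pp_wave H) h) \<and>
          analytic_in_rho M \<delta> h" for \<delta> h
        using pp_ambient_metric_odd(4)[OF odd \<epsilon>] that by blast
    next
      fix Ob
      assume even: "even CARD('n pp_coord)"
      have "c = \<kappa> * obstruction_const" using even by (simp add: c_def obstruction_const_def)
      then show "is_obstruction \<kappa> M (pp_wave H) Ob \<longleftrightarrow>
          (\<forall>x\<in>M. Ob x = (c * (laplacian ^^ (CARD('n pp_coord) div 2)) H x) *\<^sub>R du2)"
        using is_obstruction_iff[OF even assms] by simp
    next
      assume even: "even CARD('n pp_coord)" and ob: "is_obstruction \<kappa> M (pp_wave H) (\<lambda>_. 0)"
      note err = obstruction_zero[OF even assms ob]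
      show "formal_ricci_O M (pp_wave H) (pp_h_trunc H f) \<infinity>"
        by (rule formal_ricci_O_pp_infinity[OF _ even]) (use err even in \<open>simp add: err_def\<close>)
      fix \<epsilon> :: real assume \<epsilon>: "0 < \<epsilon>" and conv: "converges_smoothly M \<epsilon> (coeff_f f)"
      have H: "odd CARD('n pp_coord) \<Longrightarrow> converges_smoothly M \<epsilon> (coeff_H H)" using even by simp
      show "ricci_flat_on (amb_domain M \<epsilon>) (amb (pp_wave H) (pp_h H f))"
        by (rule ricci_flat_pp[OF \<epsilon> H conv smooth_on_F2_even[OF \<epsilon> H conv even] err])
    qed
  qed
  have "c \<noteq> 0"
  proof (cases "even CARD('n pp_coord)")
    case True
    \<comment> \<open>An instance over the empty set gives access to the nonvanishing of the
      constant, which involves the dimension alone.\<close>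
    interpret pp_data "{} :: (real^('n pp_coord)) set" "\<lambda>_. 0" "\<lambda>_. 0" "CARD('n pp_coord)" m
      by unfold_locales (auto simp: m_def indep_v_def)
    from obstruction_const_nonzero[OF True] assms True show ?thesis
      by (simp add: c_def obstruction_const_def)
  qed (simp add: c_def)
  then show ?thesis using main by (intro exI[of _ c]) blast
qed

end
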